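(* Let $0<\varepsilon<1$. There is a Dirichlet series $f$ mapping $\mathbb{C}_0$ to $\mathbb{D}$ with $f(+\infty)=0$ such that \[\lim_{T\to\infty} N_f(\xi,T) = \log{\frac{1}{|\xi|}}\] for quasi-every $\xi$ in $\mathbb{D} \setminus \{0\}$, and such that \[\mathscr{M}_f(\xi) \leq \log{\frac{1}{|\xi|}} - (1-\varepsilon) \frac{1-|\xi|^2}{2}\] for every $\xi$ in $\mathbb{D}\setminus\{0\}$.
   Context: $\mathbb{C}_\kappa=\{s:\mathrm{Re}\,s>\kappa\}$ and $\mathbb{D}$ is the open unit disc. A "Dirichlet series mapping $\mathbb{C}_0$ to $\mathbb{D}$" is an analytic function $f:\mathbb{C}_0\to\mathbb{D}$ represented by a Dirichlet series $\sum_{n\ge1}a_nn^{-s}$ converging in $\mathbb{C}_\kappa$ for some $\kappa>0$; $f(+\infty)=a_1$. For $T>0$ and $\xi\in\mathbb{D}$, $N_f(\xi,T)=\frac{\pi}{T}\sum\mathrm{Re}\,s$, summing over all $s\in\mathbb{C}_0$ with $f(s)=\xi$ and $|\mathrm{Im}\,s|<T$, with multiplicity. The mean counting function is \[\mathscr{M}_f(\xi)=\lim_{\sigma_0\to0^+}\lim_{T\to\infty}\frac{\pi}{T}\sum_{\substack{s\in f^{-1}(\{\xi\})\\ |\mathrm{Im}\,s|<T,\ \mathrm{Re}\,s>\sigma_0}}(\mathrm{Re}\,s-\sigma_0),\] zeros counted with multiplicity; these limits exist for every $\xi\in\mathbb{D}\setminus\{f(+\infty)\}$. "Quasi-every" means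 outside a set of logarithmic capacity zero. *)

theory Defs
  imports "HOL-Complex_Analysis.Complex_Analysis"
begin

text \<open>A Dirichlet series mapping the right half-plane C_0 into the unit disc D.
  The coefficient of n^(-s) is a n (for n >= 1; a 0 is unused), so f(+infinity) = a 1.\<close>
definition dirichlet_series_C0_D :: "(complex \<Rightarrow> complex) \<Rightarrow> (nat \<Rightarrow> complex) \<Rightarrow> bool" where
  "dirichlet_series_C0_D f a \<longleftrightarrow>
     f holomorphic_on {s. Re s > 0} \<and>
     f ` {s. Re s > 0} \<subseteq> ball 0 1 \<and>
     (\<exists>\<kappa>>0. \<forall>s. Re s > \<kappa> \<longrightarrow>
        (\<lambda>n. a (Suc n) * of_nat (Suc n) powr (- s)) sums f s)"

definition N_count :: "(complex \<Rightarrow> complex) \<Rightarrow> complex \<Rightarrow> real \<Rightarrow> ennreal" where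
  "N_count f \<xi> T = ennreal (pi / T) *
     (\<integral>\<^sup>+ s. ennreal (Re s * of_int (zorder (\<lambda>z. f z - \<xi>) s))
        \<partial>count_space {s. Re s > 0 \<and> \<bar>Im s\<bar> < T \<and> f s = \<xi>})"

text \<open>The truncated quantity inside the mean counting function (a finite sum for sigma0 > 0).\<close>
definition M_trunc :: "(complex \<Rightarrow> complex) \<Rightarrow> complex \<Rightarrow> real \<Rightarrow> real \<Rightarrow> real" where
  "M_trunc f \<xi> \<sigma>0 T = pi / T *
     (\<Sum>s\<in>{s. Re s > \<sigma>0 \<and> \<bar>Im s\<bar> < T \<and> f s = \<xi>}.
        (Re s - \<sigma>0) * of_int (zorder (\<lambda>z. f z - \<xi>) s))"

definition mean_counting :: "(complex \<Rightarrow> complex) \<Rightarrow> complex \<Rightarrow> real" where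
  "mean_counting f \<xi> = Lim (at_right 0) (\<lambda>\<sigma>0. Lim at_top (\<lambda>T. M_trunc f \<xi> \<sigma>0 T))"

text \<open>Logarithmic capacity zero (polar set): every nonzero finite Borel measure with
  compact support inside E has logarithmic energy +infinity. Since the kernel log(1/|z-w|)
  is bounded below on a compact set, the energy is +infinity iff the integral of its
  positive part is +infinity.\<close>
definition log_kernel_pos :: "complex \<Rightarrow> complex \<Rightarrow> ennreal" where
  "log_kernel_pos z w = (if z = w then \<infinity> else ennreal (max 0 (- ln (cmod (z - w)))))"

definition log_capacity_zero :: "complex set \<Rightarrow> bool" where
  "log_capacity_zero E \<longleftrightarrow>
     (\<forall>(\<mu>::complex measure) K. compact K \<and> K \<subseteq> E \<and> sets \<mu> = sets borel \<and> finite_measure \<mu>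
        \<and> emeasure \<mu> (space \<mu> - K) = 0 \<and> emeasure \<mu> (space \<mu>) \<noteq> 0
        \<longrightarrow> (\<integral>\<^sup>+ z. (\<integral>\<^sup>+ w. log_kernel_pos z w \<partial>\<mu>) \<partial>\<mu>) = \<infinity>)"

end

theory Submission
  imports Defs "HOL-Analysis.Kronecker_Approximation_Theorem"
begin

text \<open>
  Jensen's formula on rectangles shows that, as \<open>T \<rightarrow> \<infinity>\<close>, the truncated sum \<open>M_trunc f \<xi> \<sigma> T\<close> plus the mean of
  the Green function \<open>green \<xi> (f (\<sigma> + i t))\<close> over \<open>\<bar>t\<bar> < T\<close> tends to \<open>ln (1 / \<bar>\<xi>\<bar>)\<close>, uniformly in \<open>\<sigma>\<close>.
  Two requirements on \<open>f\<close> are then left. If \<open>f\<close> is small on most of every line \<open>Re s = \<sigma>\<close>, the mean of the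
  Green function is about \<open>ln (1 / \<bar>\<xi>\<bar>) \<ge> (1 - \<bar>\<xi>\<bar>\<^sup>2) / 2\<close> and the mean counting function is small. If for
  every \<open>T\<close> there are lines close to the imaginary axis on which \<open>\<bar>f\<bar>\<close> is nearly 1 for most \<open>\<bar>t\<bar> < T\<close>, then
  averaging over \<open>\<xi>\<close> against a measure with bounded Green potential gives a Frostman theorem: \<open>N_count\<close>
  tends to \<open>ln (1 / \<bar>\<xi>\<bar>)\<close> for quasi-every \<open>\<xi>\<close>.

  Both hold for a sum of blocks \<open>f\<^sub>j\<^sub>+\<^sub>1 = f\<^sub>j + \<phi>\<^sub>j 6 powr (- M\<^sub>j s)\<close>, where \<open>\<phi>\<^sub>j = (1 - \<bar>f\<^sub>j\<bar>\<^sup>2) k\<^sub>j / 2\<close> on the imaginary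
  axis, \<open>k\<^sub>j \<in> [0, 1]\<close> is a Fejer kernel with frequencies in \<open>\<int> ln 2 + \<int> ln 3\<close> that is at least \<open>1 / 2\<close>
  near the origin and has tiny mean, and \<open>M\<^sub>j\<close> is so large that \<open>6 powr (- M\<^sub>j s)\<close> oscillates fast and is
  negligible away from the axis.
\<close>

subsection \<open>A Jensen formula for rectangles\<close>

text \<open>The two requirements are compatible only because of the order of the limits: the mean
  counting function fixes \<sigma> and lets T tend to infinity, whereas \<open>N_count\<close> goes
  down to the axis at fixed T. In the second limit \<sigma> is chosen after T, so the asymptotics
  must be uniform in \<sigma>. Two primes are used because a series in powers of 2 alone is periodic
  on vertical lines: being near the unit circle on a long interval would force this on the whole
  line. The nonzero numbers a ln 2 + b ln 3 become arbitrarily small, so a kernel of tiny mean can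
  stay above 1 / 2 on any prescribed interval. The factor \<open>6 powr (- M s)\<close> also makes
  all exponents positive, which turns a block into an ordinary Dirichlet polynomial over integers
  2^a 3^b. The factor 1 / 2 in the blocks keeps the partial sums in the closed disc whatever the
  phases, since c + (1 - c^2) / 2 <= 1 for 0 <= c <= 1. The Green function is bounded below by an
  expression linear in |f|, so a small mean of |f| on each line is all that the estimate of the mean
  counting function asks for.\<close>

lemma ln_cmod_has_derivative_along_line:
  fixes q :: "complex \<Rightarrow> complex"
  assumes "q holomorphic_on S" "open S" "u + of_real x * d \<in> S" "q (u + of_real x * d) \<noteq> 0"
  shows "((\<lambda>x. ln (cmod (q (u + of_real x * d)))) has_vector_derivative
           Re (d * deriv q (u + of_real x * d) / q (u + of_real x * d))) (at x)"
proof -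
  define w where "w = (\<lambda>x::real. q (u + of_real x * d))"
  define w' where "w' = d * deriv q (u + of_real x * d)"
  have "(q has_field_derivative deriv q (u + of_real x * d)) (at (u + of_real x * d))"
    using assms holomorphic_derivI by blast
  moreover have "((\<lambda>x::real. u + of_real x * d) has_vector_derivative d) (at x)"
    by (auto intro!: derivative_eq_intros)
  ultimately have w: "(w has_vector_derivative w') (at x)"
    unfolding w_def w'_def using field_vector_diff_chain_at by (fastforce simp: o_def)
  have nz: "w x \<noteq> 0" using assms by (simp add: w_def)
  \<comment> \<open>ln |q| is handled as half of ln (r^2 + i^2), so no branch of the complex
    logarithm has to be chosen along the segment.\<close>
  define r i where "r = (\<lambda>x. Re (w x))" and "i = (\<lambda>x. Im (w x))"
  have "(r has_real_derivative Re w') (at x)" "(i has_real_derivative Im w') (at x)"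
    using w unfolding r_def i_def
    by (simp_all add: has_vector_derivative_complex_iff has_real_derivative_iff_has_vector_derivative)
  moreover have pos: "(r x)\<^sup>2 + (i x)\<^sup>2 > 0"
    using nz by (simp add: r_def i_def complex_eq_iff sum_power2_gt_zero_iff)
  ultimately have "((\<lambda>x. (r x)\<^sup>2 + (i x)\<^sup>2) has_real_derivative 2 * r x * Re w' + 2 * i x * Im w') (at x)"
    by (auto intro!: derivative_eq_intros)
  from DERIV_cdivide[OF DERIV_chain2[OF DERIV_ln_divide[OF pos] this], of 2]
  have "((\<lambda>x. ln ((r x)\<^sup>2 + (i x)\<^sup>2) / 2) has_real_derivative
       (2 * r x * Re w' + 2 * i x * Im w') / ((r x)\<^sup>2 + (i x)\<^sup>2) / 2) (at x)"
    by (simp add: mult.commute)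
  moreover have "(2 * r x * Re w' + 2 * i x * Im w') / ((r x)\<^sup>2 + (i x)\<^sup>2) / 2
      = Re (w' / w x)"
  proof -
    have "(2 * r x * Re w' + 2 * i x * Im w') / N / 2 = (Re w' * r x + Im w' * i x) / N" for N
      by (simp add: add_divide_distrib mult_ac)
    then show ?thesis unfolding Re_divide by (simp only: r_def i_def)
  qed
  moreover have "ln ((r x)\<^sup>2 + (i x)\<^sup>2) / 2 = ln (cmod (w x))" for x
    by (cases "w x = 0") (simp_all add: r_def i_def cmod_def ln_sqrt complex_eq_iff sum_power2_gt_zero_iff)
  ultimately show ?thesis
    by (simp add: has_real_derivative_iff_has_vector_derivative w_def w'_def)
qed

text \<open>For the sides on which the weight is purely imaginary. Only Re (d q' / q), the
  derivative of ln |q|, enters there, so the argument of q may wind freely.\<close>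

lemma log_side_by_parts:
  fixes q :: "complex \<Rightarrow> complex" and v v' :: "real \<Rightarrow> real"
  assumes q: "q holomorphic_on S" "open S" and ab: "a \<le> b"
    and S: "\<And>x. x \<in> {a..b} \<Longrightarrow> u + of_real x * d \<in> S"
    and nz: "\<And>x. x \<in> {a..b} \<Longrightarrow> q (u + of_real x * d) \<noteq> 0"
    and v: "\<And>x. (v has_real_derivative v' x) (at x)" and v': "continuous_on {a..b} v'"
  shows "((\<lambda>x. Re (d * deriv q (u + of_real x * d) / q (u + of_real x * d)) * v x) has_integral
     ln (cmod (q (u + of_real b * d))) * v b - ln (cmod (q (u + of_real a * d))) * v a
      - integral {a..b} (\<lambda>x. ln (cmod (q (u + of_real x * d))) * v' x)) {a..b}"
proof (rule integration_by_parts[of "(*)"])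
  have c: "continuous_on {a..b} (\<lambda>x. q (u + of_real x * d))"
    by (rule continuous_on_compose2[OF holomorphic_on_imp_continuous_on[OF q(1)]])
      (auto intro!: continuous_intros S)
  show cl: "continuous_on {a..b} (\<lambda>x. ln (cmod (q (u + of_real x * d))))"
    by (intro continuous_intros c) (use nz in auto)
  show "continuous_on {a..b} v"
    by (meson DERIV_isCont continuous_at_imp_continuous_on v)
  show "((\<lambda>x. ln (cmod (q (u + of_real x * d)))) has_vector_derivative
      Re (d * deriv q (u + of_real x * d) / q (u + of_real x * d))) (at x)" if "x \<in> {a..b}" for x
    by (rule ln_cmod_has_derivative_along_line[OF q]) (use that S nz in auto)
  show "(v has_vector_derivative v' x) (at x)" for x
    using v by (simp add: has_real_derivative_iff_has_vector_derivative)
  have "(\<lambda>x. ln (cmod (q (u + of_real x * d))) * v' x) integrable_on {a..b}"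
    by (intro integrable_continuous_interval continuous_intros cl v')
  then show "((\<lambda>x. ln (cmod (q (u + of_real x * d))) * v' x) has_integral
      ln (cmod (q (u + of_real b * d))) * v b - ln (cmod (q (u + of_real a * d))) * v a -
     (ln (cmod (q (u + of_real b * d))) * v b - ln (cmod (q (u + of_real a * d))) * v a
      - integral {a..b} (\<lambda>x. ln (cmod (q (u + of_real x * d))) * v' x))) {a..b}"
    by (simp add: has_integral_integral)
qed (use ab bounded_bilinear_mult in auto)

text \<open>For the right side, where the weight is genuinely complex and arg q contributes. The
  condition Re q > 0 keeps the values away from the branch cut of \<open>Ln\<close>.\<close>

lemma Ln_side_by_parts:
  fixes q :: "complex \<Rightarrow> complex" and v v' :: "real \<Rightarrow> complex"
  assumes q: "q holomorphic_on S" "open S" and ab: "a \<le> b"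
    and S: "\<And>x. x \<in> {a..b} \<Longrightarrow> u + of_real x * d \<in> S"
    and pos: "\<And>x. x \<in> {a..b} \<Longrightarrow> Re (q (u + of_real x * d)) > 0"
    and v: "\<And>x. (v has_vector_derivative v' x) (at x)" and v': "continuous_on {a..b} v'"
  shows "((\<lambda>x. d * deriv q (u + of_real x * d) / q (u + of_real x * d) * v x) has_integral
     Ln (q (u + of_real b * d)) * v b - Ln (q (u + of_real a * d)) * v a
      - integral {a..b} (\<lambda>x. Ln (q (u + of_real x * d)) * v' x)) {a..b}"
proof (rule integration_by_parts[of "(*)"])
  have nR: "q (u + of_real x * d) \<notin> \<real>\<^sub>\<le>\<^sub>0" if "x \<in> {a..b}" for x
    using pos[OF that] by (auto simp: complex_nonpos_Reals_iff)
  have c: "continuous_on {a..b} (\<lambda>x. q (u + of_real x * d))"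
    by (rule continuous_on_compose2[OF holomorphic_on_imp_continuous_on[OF q(1)]])
      (auto intro!: continuous_intros S)
  show cl: "continuous_on {a..b} (\<lambda>x. Ln (q (u + of_real x * d)))"
    by (intro continuous_intros c) (use nR in auto)
  show "continuous_on {a..b} v"
    using v has_vector_derivative_continuous continuous_at_imp_continuous_on by blast
  show "((\<lambda>x. Ln (q (u + of_real x * d))) has_vector_derivative
      d * deriv q (u + of_real x * d) / q (u + of_real x * d)) (at x)" if "x \<in> {a..b}" for x
  proof -
    have "(q has_field_derivative deriv q (u + of_real x * d)) (at (u + of_real x * d))"
      using q S[OF that] holomorphic_derivI by blast
    then have "((\<lambda>z. Ln (q z)) has_field_derivative
        deriv q (u + of_real x * d) / q (u + of_real x * d)) (at (u + of_real x * d))"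
      using nR[OF that] by (auto intro!: derivative_eq_intros simp: field_simps)
    moreover have "((\<lambda>x::real. u + of_real x * d) has_vector_derivative d) (at x)"
      by (auto intro!: derivative_eq_intros)
    ultimately show ?thesis
      using field_vector_diff_chain_at by (fastforce simp: o_def)
  qed
  show "(v has_vector_derivative v' x) (at x)" for x
    by (rule v)
  have "(\<lambda>x. Ln (q (u + of_real x * d)) * v' x) integrable_on {a..b}"
    by (intro integrable_continuous_interval continuous_intros cl v')
  then show "((\<lambda>x. Ln (q (u + of_real x * d)) * v' x) has_integral
      Ln (q (u + of_real b * d)) * v b - Ln (q (u + of_real a * d)) * v a -
     (Ln (q (u + of_real b * d)) * v b - Ln (q (u + of_real a * d)) * v a
      - integral {a..b} (\<lambda>x. Ln (q (u + of_real x * d)) * v' x))) {a..b}"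
    by (simp add: has_integral_integral)
qed (use ab bounded_bilinear_mult in auto)

lemma sinh_Complex: "sinh (Complex x y) = Complex (sinh x * cos y) (cosh x * sin y)"
proof -
  have "exp (Complex x y) = exp x * (cos y + \<i> * sin y)"
    "exp (- Complex x y) = exp (-x) * (cos y - \<i> * sin y)"
    by (simp_all add: complex_eq_iff Re_exp Im_exp)
  then show ?thesis
    by (simp add: sinh_field_def cosh_field_def complex_eq_iff field_simps)
qed

lemma cosh_Complex: "cosh (Complex x y) = Complex (cosh x * cos y) (sinh x * sin y)"
proof -
  have "exp (Complex x y) = exp x * (cos y + \<i> * sin y)"
    "exp (- Complex x y) = exp (-x) * (cos y - \<i> * sin y)"
    by (simp_all add: complex_eq_iff Re_exp Im_exp)
  then show ?thesis
    by (simp add: sinh_field_def cosh_field_def complex_eq_iff field_simps)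
qed

text \<open>The residue theorem for \<open>q' / q\<close> times \<open>sinh (\<kappa> (z - \<sigma> - i \<tau>))\<close>: the real part of the weight vanishes
  on the horizontal sides and so does that of its derivative on the left one. Only the right side
  needs a logarithm of \<open>q\<close> itself.\<close>

text \<open>The residue theorem for \<open>q' / q\<close> times \<open>sinh (\<kappa> (z - \<sigma> - i \<tau>))\<close>. On the left and horizontal sides
  this weight is purely imaginary, so that \<open>arg q\<close> enters on the right side only.\<close>
lemma rectangle_formula:
  fixes q :: "complex \<Rightarrow> complex"
  assumes q: "q holomorphic_on S" "open S" and A: "\<sigma> < A" and T: "0 < T"
    and \<kappa>: "\<kappa> = pi / (2 * T)"
    and sub: "cbox (Complex \<sigma> (\<tau> - T)) (Complex A (\<tau> + T)) \<subseteq> S"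
    and left: "\<And>t. t \<in> {\<tau> - T..\<tau> + T} \<Longrightarrow> q (Complex \<sigma> t) \<noteq> 0"
    and hor: "\<And>x. x \<in> {\<sigma>..A} \<Longrightarrow> q (Complex x (\<tau> - T)) \<noteq> 0 \<and> q (Complex x (\<tau> + T)) \<noteq> 0"
    and right: "\<And>t. t \<in> {\<tau> - T..\<tau> + T} \<Longrightarrow> Re (q (Complex A t)) > 0"
  shows "2 * pi * (\<Sum>p\<in>{p \<in> box (Complex \<sigma> (\<tau> - T)) (Complex A (\<tau> + T)). q p = 0}.
      sinh (\<kappa> * (Re p - \<sigma>)) * cos (\<kappa> * (Im p - \<tau>)) * zorder q p) =
    \<kappa> * (integral {\<tau> - T..\<tau> + T} (\<lambda>t. ln (cmod (q (Complex \<sigma> t))) * cos (\<kappa> * (t - \<tau>)))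
     + integral {\<sigma>..A} (\<lambda>x. ln (cmod (q (Complex x (\<tau> - T)))) * sinh (\<kappa> * (x - \<sigma>)))
     + integral {\<sigma>..A} (\<lambda>x. ln (cmod (q (Complex x (\<tau> + T)))) * sinh (\<kappa> * (x - \<sigma>)))
     - Re (integral {\<tau> - T..\<tau> + T} (\<lambda>t. Ln (q (Complex A t)) * cosh (Complex (\<kappa> * (A - \<sigma>)) (\<kappa> * (t - \<tau>))))))"
proof -
  define a c p0 where "a = Complex \<sigma> (\<tau> - T)" and "c = Complex A (\<tau> + T)" and "p0 = Complex \<sigma> \<tau>"
  define V where "V = (\<lambda>s. sinh (of_real \<kappa> * (s - p0)))"
  define f where "f = (\<lambda>s. deriv q s * V s / q s)"
  have le: "Re a < Re c" "Im a < Im c" using A T by (auto simp: a_def c_def)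
  have VC: "V (Complex x y) = Complex (sinh (\<kappa> * (x - \<sigma>)) * cos (\<kappa> * (y - \<tau>))) (cosh (\<kappa> * (x - \<sigma>)) * sin (\<kappa> * (y - \<tau>)))"
    for x y
  proof -
    have "of_real \<kappa> * (Complex x y - p0) = Complex (\<kappa> * (x - \<sigma>)) (\<kappa> * (y - \<tau>))"
      by (simp add: p0_def complex_eq_iff)
    then show ?thesis by (simp add: V_def sinh_Complex)
  qed
  have kT: "\<kappa> * T = pi / 2" using \<kappa> T by simp
  have cs: "cos (\<kappa> * T) = 0" "sin (\<kappa> * T) = 1" unfolding kT by simp_all
  have Vhol: "V holomorphic_on X" for X
    unfolding V_def sinh_field_def by (intro holomorphic_intros) auto
  have nzbd: "q z \<noteq> 0" if z: "z \<in> cbox a c - box a c" for z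
  proof -
    have zz: "z = Complex (Re z) (Im z)" by simp
    from z consider "Re z = \<sigma>" "Im z \<in> {\<tau> - T..\<tau> + T}" | "Re z = A" "Im z \<in> {\<tau> - T..\<tau> + T}"
      | "Im z = \<tau> - T" "Re z \<in> {\<sigma>..A}" | "Im z = \<tau> + T" "Re z \<in> {\<sigma>..A}"
      by (force simp: a_def c_def in_box_complex_iff in_cbox_complex_iff)
    then show ?thesis
    proof cases
      case 1 then show ?thesis using left[of "Im z"] zz by metis
    next
      case 2 then show ?thesis using right[of "Im z"] zz by fastforce
    next
      case 3 then show ?thesis using hor[of "Re z"] zz by metis
    next
      case 4 then show ?thesis using hor[of "Re z"] zz by metis
    qed
  qed
  have sub': "cbox a c \<subseteq> S" using sub by (simp add: a_def c_def)
  obtain e where e: "e > 0" "(\<Union>x\<in>cbox a c. cball x e) \<subseteq> S"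
    using compact_subset_open_imp_ball_epsilon_subset[OF compact_cbox \<open>open S\<close> sub']
    by (metis compact_cbox compact_subset_open_imp_cball_epsilon_subset q(2) sub')
  \<comment> \<open>The argument principle is applied on the enlargement by e/4. The enlargement by
    e/2, still inside S, is a domain containing the closed e/4 box, so q has only finitely many
    zeros near the rectangle.\<close>
  define B where "B = (\<lambda>r. box (a - Complex r r) (c + Complex r r))"
  have BS: "B (e/2) \<subseteq> S"
  proof
    fix z assume z: "z \<in> B (e/2)"
    \<comment> \<open>The point of the closed rectangle nearest to z, found by clamping both
      coordinates.\<close>
    define w where "w = Complex (max (Re a) (min (Re c) (Re z))) (max (Im a) (min (Im c) (Im z)))"
    have "w \<in> cbox a c" using le by (auto simp: w_def in_cbox_complex_iff)
    moreover have "z \<in> cball w e"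
    proof -
      have "\<bar>Re (w - z)\<bar> \<le> e/2" "\<bar>Im (w - z)\<bar> \<le> e/2"
        using z le e by (auto simp: w_def B_def in_box_complex_iff max_def min_def abs_if)
      then show ?thesis using cmod_le[of "w - z"] by (simp add: dist_norm)
    qed
    ultimately show "z \<in> S" using e(2) by blast
  qed
  define S' where "S' = B (e/4)"
  have S': "open S'" "convex S'" "S' \<subseteq> S" "cbox a c \<subseteq> S'"
  proof -
    show "S' \<subseteq> S" using BS e by (force simp: S'_def B_def in_box_complex_iff)
    show "cbox a c \<subseteq> S'" using e by (auto simp: S'_def B_def in_box_complex_iff in_cbox_complex_iff)
  qed (auto simp: S'_def B_def convex_box)
  have fin: "finite {w \<in> S'. q w = 0}"
  proof (cases "q constant_on B (e/2)")
    case True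
    have "a \<in> cbox a c - box a c" using le by (auto simp: in_box_complex_iff in_cbox_complex_iff)
    then have "q a \<noteq> 0" "a \<in> B (e/2)"
      using nzbd le e by (auto simp: B_def in_box_complex_iff)
    moreover have "S' \<subseteq> B (e/2)" using e by (force simp: S'_def B_def in_box_complex_iff)
    ultimately have "{w \<in> S'. q w = 0} = {}" using True by (force simp: constant_on_def)
    then show ?thesis by (simp only: finite.emptyI)
  next
    case False
    have "finite {w \<in> cbox (a - Complex (e/4) (e/4)) (c + Complex (e/4) (e/4)). q w = 0}"
    proof (rule holomorphic_compact_finite_zeros)
      show "q holomorphic_on B (e/2)" using q BS holomorphic_on_subset by blast
      show "open (B (e/2))" "connected (B (e/2))"
        by (auto simp: B_def convex_box convex_connected)
      show "cbox (a - Complex (e/4) (e/4)) (c + Complex (e/4) (e/4)) \<subseteq> B (e/2)"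
        using e by (auto simp: B_def in_box_complex_iff in_cbox_complex_iff)
    qed (use False in auto)
    then show ?thesis
      by (rule rev_finite_subset) (auto simp: S'_def B_def in_box_complex_iff in_cbox_complex_iff)
  qed
  have pi: "path_image (rectpath a c) = cbox a c - box a c"
    using le by (intro path_image_rectpath_cbox_minus_box) auto
  have "contour_integral (rectpath a c) f = 2 * pi * \<i> *
      (\<Sum>p\<in>{w \<in> S'. q w = 0 \<or> w \<in> {}}. winding_number (rectpath a c) p * V p * zorder q p)"
    unfolding f_def
  proof (rule argument_principle)
    show "q holomorphic_on S' - {}" using q S' holomorphic_on_subset by blast
    show "path_image (rectpath a c) \<subseteq> S' - {w \<in> S'. q w = 0 \<or> w \<in> {}}"
      using pi S' nzbd by auto
    show "\<forall>z. z \<notin> S' \<longrightarrow> winding_number (rectpath a c) z = 0"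
      using S' le by (auto intro!: winding_number_rectpath_outside)
  qed (use S' fin Vhol convex_connected in auto)
  also have "(\<Sum>p\<in>{w \<in> S'. q w = 0 \<or> w \<in> {}}. winding_number (rectpath a c) p * V p * zorder q p)
      = (\<Sum>p\<in>{p \<in> box a c. q p = 0}. V p * zorder q p)"
  proof (rule sum.mono_neutral_cong_right)
    show "{p \<in> box a c. q p = 0} \<subseteq> {w \<in> S'. q w = 0 \<or> w \<in> {}}"
      using S' box_subset_cbox by blast
    show "\<forall>i\<in>{w \<in> S'. q w = 0 \<or> w \<in> {}} - {p \<in> box a c. q p = 0}.
       winding_number (rectpath a c) i * V i * (zorder q i) = 0"
    proof
      fix i assume i: "i \<in> {w \<in> S'. q w = 0 \<or> w \<in> {}} - {p \<in> box a c. q p = 0}"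
      then have "i \<notin> cbox a c" using nzbd by auto
      then have "winding_number (rectpath a c) i = 0"
        using le by (intro winding_number_rectpath_outside) auto
      then show "winding_number (rectpath a c) i * V i * (zorder q i) = 0" by simp
    qed
    show "winding_number (rectpath a c) x * V x * (zorder q x) = V x * (zorder q x)"
      if "x \<in> {p \<in> box a c. q p = 0}" for x
      using winding_number_rectpath[of x a c] that le by simp
  qed (use fin in auto)
  finally have ci: "contour_integral (rectpath a c) f = 2 * pi * \<i> * (\<Sum>p\<in>{p \<in> box a c. q p = 0}. V p * zorder q p)" .
  have fcont: "continuous_on (cbox a c - box a c) f"
  proof -
    have "deriv q holomorphic_on S" by (rule holomorphic_deriv) (use q in auto)
    then show ?thesis unfolding f_def
      by (intro continuous_intros holomorphic_on_imp_continuous_on)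
        (use q sub' nzbd Vhol in \<open>auto intro: holomorphic_on_subset\<close>)
  qed
  \<comment> \<open>Passes from the parameter interval [0, 1] of \<open>linepath\<close> to the
    coordinate itself; d is the direction, 1 or \<i>.\<close>
  have side: "(f has_contour_integral integral {\<alpha>..\<beta>} (\<lambda>x. d * f (u + of_real x * d)))
       (linepath (u + of_real \<alpha> * d) (u + of_real \<beta> * d))"
    "(\<lambda>x. d * f (u + of_real x * d)) integrable_on {\<alpha>..\<beta>}"
    if "\<alpha> < \<beta>" and im: "\<And>x. x \<in> {\<alpha>..\<beta>} \<Longrightarrow> u + of_real x * d \<in> cbox a c - box a c" for \<alpha> \<beta> u d
  proof -
    show int: "(\<lambda>x. d * f (u + of_real x * d)) integrable_on {\<alpha>..\<beta>}"
      by (intro integrable_continuous_interval continuous_intros continuous_on_compose2[OF fcont])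
        (use im in auto)
    define J where "J = integral {\<alpha>..\<beta>} (\<lambda>x. d * f (u + of_real x * d))"
    have "((\<lambda>x. d * f (u + of_real x * d)) has_integral J) (cbox \<alpha> \<beta>)"
      using int by (simp add: J_def has_integral_integral)
    from has_integral_affinity[OF this, of "\<beta> - \<alpha>" \<alpha>] that(1)
    have "((\<lambda>x. d * f (u + of_real ((\<beta> - \<alpha>) * x + \<alpha>) * d)) has_integral (1 / (\<beta> - \<alpha>)) *\<^sub>R J) 
       ((\<lambda>x. (1 / (\<beta> - \<alpha>)) * x + - ((1 / (\<beta> - \<alpha>)) * \<alpha>)) ` {\<alpha>..\<beta>})"
      by simp
    also have "(\<lambda>x. (1 / (\<beta> - \<alpha>)) * x + - ((1 / (\<beta> - \<alpha>)) * \<alpha>)) ` {\<alpha>..\<beta>} = {0..1}"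
    proof -
      have "(1 / (\<beta> - \<alpha>)) * \<beta> + - ((1 / (\<beta> - \<alpha>)) * \<alpha>) = 1"
        using that(1) by (simp add: diff_divide_distrib[symmetric])
      then show ?thesis
        using that(1) by (subst image_affinity_atLeastAtMost) auto
    qed
    finally have "((\<lambda>x. of_real (\<beta> - \<alpha>) * (d * f (u + of_real ((\<beta> - \<alpha>) * x + \<alpha>) * d))) has_integral
        of_real (\<beta> - \<alpha>) * ((1 / (\<beta> - \<alpha>)) *\<^sub>R J)) {0..1}"
      by (rule has_integral_mult_right)
    moreover have "of_real (\<beta> - \<alpha>) * ((1 / (\<beta> - \<alpha>)) *\<^sub>R J) = J"
      using that(1) by (simp add: scaleR_conv_of_real flip: of_real_diff)
    moreover have "of_real (\<beta> - \<alpha>) * (d * f (u + of_real ((\<beta> - \<alpha>) * x + \<alpha>) * d))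
       = f (linepath (u + of_real \<alpha> * d) (u + of_real \<beta> * d) x) * (u + of_real \<beta> * d - (u + of_real \<alpha> * d))" for x
    proof -
      have "linepath (u + of_real \<alpha> * d) (u + of_real \<beta> * d) x = u + of_real ((\<beta> - \<alpha>) * x + \<alpha>) * d"
        by (simp add: linepath_def scaleR_conv_of_real algebra_simps)
      moreover have "of_real (\<beta> - \<alpha>) * (d * X) = X * (u + of_real \<beta> * d - (u + of_real \<alpha> * d))" for X
        by (simp add: algebra_simps)
      ultimately show ?thesis by (simp only:)
    qed
    ultimately show "(f has_contour_integral J) (linepath (u + of_real \<alpha> * d) (u + of_real \<beta> * d))"
      unfolding has_contour_integral_linepath by simp
  qed
  define Jb Jt Jl Jr where
    "Jb = integral {\<sigma>..A} (\<lambda>x. 1 * f (Complex 0 (\<tau> - T) + of_real x * 1))" and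
    "Jt = integral {\<sigma>..A} (\<lambda>x. 1 * f (Complex 0 (\<tau> + T) + of_real x * 1))" and
    "Jl = integral {\<tau> - T..\<tau> + T} (\<lambda>x. \<i> * f (Complex \<sigma> 0 + of_real x * \<i>))" and
    "Jr = integral {\<tau> - T..\<tau> + T} (\<lambda>x. \<i> * f (Complex A 0 + of_real x * \<i>))"
  have CR: "Complex 0 y + of_real x * 1 = Complex x y" "Complex x 0 + of_real y * \<i> = Complex x y" for x y
    by (auto simp: complex_eq_iff)
  have bd: "Complex x (\<tau> - T) \<in> cbox a c - box a c" "Complex x (\<tau> + T) \<in> cbox a c - box a c"
    if "x \<in> {\<sigma>..A}" for x using that T by (auto simp: a_def c_def in_box_complex_iff in_cbox_complex_iff)
  have bd': "Complex \<sigma> y \<in> cbox a c - box a c" "Complex A y \<in> cbox a c - box a c"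
    if "y \<in> {\<tau> - T..\<tau> + T}" for y using that A by (auto simp: a_def c_def in_box_complex_iff in_cbox_complex_iff)
  have sb: "(f has_contour_integral Jb) (linepath a (Complex A (\<tau> - T)))"
    and st: "(f has_contour_integral Jt) (linepath (Complex \<sigma> (\<tau> + T)) c)"
    and sl: "(f has_contour_integral Jl) (linepath a (Complex \<sigma> (\<tau> + T)))"
    and sr: "(f has_contour_integral Jr) (linepath (Complex A (\<tau> - T)) c)"
    using side(1)[of \<sigma> A "Complex 0 (\<tau> - T)" 1] side(1)[of \<sigma> A "Complex 0 (\<tau> + T)" 1]
       side(1)[of "\<tau> - T" "\<tau> + T" "Complex \<sigma> 0" \<i>] side(1)[of "\<tau> - T" "\<tau> + T" "Complex A 0" \<i>]
       A T bd bd' unfolding Jb_def Jt_def Jl_def Jr_def CR a_def c_def by auto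
  have "(f has_contour_integral (Jb + (Jr + (- Jt + - Jl)))) (rectpath a c)"
    unfolding rectpath_def Let_def
    by (intro has_contour_integral_join)
      (use sb st sl sr has_contour_integral_reverse_linepath in \<open>auto simp: a_def c_def\<close>)
  then have "Jb + Jr - Jt - Jl = 2 * pi * \<i> * (\<Sum>p\<in>{p \<in> box a c. q p = 0}. V p * zorder q p)"
    unfolding ci[symmetric] using contour_integral_unique[of f] by simp
  then have main: "2 * pi * (\<Sum>p\<in>{p \<in> box a c. q p = 0}. Re (V p) * zorder q p) = Im Jb + Im Jr - Im Jt - Im Jl"
    by (simp add: complex_eq_iff)
  have ReV: "Re (V p) = sinh (\<kappa> * (Re p - \<sigma>)) * cos (\<kappa> * (Im p - \<tau>))" for p
    using VC[of "Re p" "Im p"] by simp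
  have ImI: "Im (integral {\<alpha>..\<beta>} g) = J"
    if "g integrable_on {\<alpha>..\<beta>}" "((\<lambda>x. Im (g x)) has_integral J) {\<alpha>..\<beta>}" for g :: "real \<Rightarrow> complex" and \<alpha> \<beta> J
    using that has_integral_Im[OF integrable_integral[OF that(1)]] has_integral_unique by blast
  define L where "L = (\<lambda>x y. ln (cmod (q (Complex x y))))"
  \<comment> \<open>On the bottom side the weight is -\<i> cosh, on the top side +\<i> cosh; hence
    the opposite signs here and in \<open>Jt\<close>.\<close>
  have Jb: "Im Jb = - (L A (\<tau> - T) * cosh (\<kappa> * (A - \<sigma>)) - L \<sigma> (\<tau> - T)
      - integral {\<sigma>..A} (\<lambda>x. L x (\<tau> - T) * (sinh (\<kappa> * (x - \<sigma>)) * \<kappa>)))"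
    unfolding Jb_def
  proof (rule ImI)
    show "(\<lambda>x. 1 * f (Complex 0 (\<tau> - T) + of_real x * 1)) integrable_on {\<sigma>..A}"
      by (rule side(2)) (use A bd CR in auto)
    have "((\<lambda>x. Re (1 * deriv q (Complex 0 (\<tau> - T) + of_real x * 1) / q (Complex 0 (\<tau> - T) + of_real x * 1)) * cosh (\<kappa> * (x - \<sigma>))) has_integral
       ln (cmod (q (Complex 0 (\<tau> - T) + of_real A * 1))) * cosh (\<kappa> * (A - \<sigma>)) - ln (cmod (q (Complex 0 (\<tau> - T) + of_real \<sigma> * 1))) * cosh (\<kappa> * (\<sigma> - \<sigma>))
        - integral {\<sigma>..A} (\<lambda>x. ln (cmod (q (Complex 0 (\<tau> - T) + of_real x * 1))) * (sinh (\<kappa> * (x - \<sigma>)) * \<kappa>))) {\<sigma>..A}"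
      by (rule log_side_by_parts[OF q])
        (use A hor bd sub' in \<open>auto simp: CR simp del: mult_1_right intro!: derivative_eq_intros continuous_intros\<close>)
    from has_integral_neg[OF this]
    show "((\<lambda>x. Im (1 * f (Complex 0 (\<tau> - T) + of_real x * 1))) has_integral 
        - (L A (\<tau> - T) * cosh (\<kappa> * (A - \<sigma>)) - L \<sigma> (\<tau> - T)
        - integral {\<sigma>..A} (\<lambda>x. L x (\<tau> - T) * (sinh (\<kappa> * (x - \<sigma>)) * \<kappa>)))) {\<sigma>..A}"
      unfolding CR f_def VC L_def using cs
      by (simp add: times_divide_eq_left[symmetric] del: times_divide_eq_left)
  qed
  have Jt: "Im Jt = L A (\<tau> + T) * cosh (\<kappa> * (A - \<sigma>)) - L \<sigma> (\<tau> + T)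
      - integral {\<sigma>..A} (\<lambda>x. L x (\<tau> + T) * (sinh (\<kappa> * (x - \<sigma>)) * \<kappa>))"
    unfolding Jt_def
  proof (rule ImI)
    show "(\<lambda>x. 1 * f (Complex 0 (\<tau> + T) + of_real x * 1)) integrable_on {\<sigma>..A}"
      by (rule side(2)) (use A bd CR in auto)
    have "((\<lambda>x. Re (1 * deriv q (Complex 0 (\<tau> + T) + of_real x * 1) / q (Complex 0 (\<tau> + T) + of_real x * 1)) * cosh (\<kappa> * (x - \<sigma>))) has_integral
       ln (cmod (q (Complex 0 (\<tau> + T) + of_real A * 1))) * cosh (\<kappa> * (A - \<sigma>)) - ln (cmod (q (Complex 0 (\<tau> + T) + of_real \<sigma> * 1))) * cosh (\<kappa> * (\<sigma> - \<sigma>))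
        - integral {\<sigma>..A} (\<lambda>x. ln (cmod (q (Complex 0 (\<tau> + T) + of_real x * 1))) * (sinh (\<kappa> * (x - \<sigma>)) * \<kappa>))) {\<sigma>..A}"
      by (rule log_side_by_parts[OF q])
        (use A hor bd sub' in \<open>auto simp: CR simp del: mult_1_right intro!: derivative_eq_intros continuous_intros\<close>)
    then show "((\<lambda>x. Im (1 * f (Complex 0 (\<tau> + T) + of_real x * 1))) has_integral 
        (L A (\<tau> + T) * cosh (\<kappa> * (A - \<sigma>)) - L \<sigma> (\<tau> + T)
        - integral {\<sigma>..A} (\<lambda>x. L x (\<tau> + T) * (sinh (\<kappa> * (x - \<sigma>)) * \<kappa>)))) {\<sigma>..A}"
      unfolding CR f_def VC L_def using cs
      by (simp add: times_divide_eq_left[symmetric] del: times_divide_eq_left)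
  qed
  have kT': "\<kappa> * (\<tau> + T - \<tau>) = pi/2" "\<kappa> * (\<tau> - T - \<tau>) = - (pi/2)" using kT by simp_all
  have ri: "Re (\<i> * z / w) = - Im (z / w)" for z w
    by (simp only: times_divide_eq_right[symmetric] Re_i_times)
  have Jl: "Im Jl = L \<sigma> (\<tau> + T) + L \<sigma> (\<tau> - T)
      - integral {\<tau> - T..\<tau> + T} (\<lambda>y. L \<sigma> y * (cos (\<kappa> * (y - \<tau>)) * \<kappa>))"
    unfolding Jl_def
  proof (rule ImI)
    show "(\<lambda>x. \<i> * f (Complex \<sigma> 0 + of_real x * \<i>)) integrable_on {\<tau> - T..\<tau> + T}"
      by (rule side(2)) (use T bd' CR in auto)
    have "((\<lambda>x. Re (\<i> * deriv q (Complex \<sigma> 0 + of_real x * \<i>) / q (Complex \<sigma> 0 + of_real x * \<i>)) * sin (\<kappa> * (x - \<tau>))) has_integral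
       ln (cmod (q (Complex \<sigma> 0 + of_real (\<tau> + T) * \<i>))) * sin (\<kappa> * (\<tau> + T - \<tau>)) - ln (cmod (q (Complex \<sigma> 0 + of_real (\<tau> - T) * \<i>))) * sin (\<kappa> * (\<tau> - T - \<tau>))
        - integral {\<tau> - T..\<tau> + T} (\<lambda>x. ln (cmod (q (Complex \<sigma> 0 + of_real x * \<i>))) * (cos (\<kappa> * (x - \<tau>)) * \<kappa>))) {\<tau> - T..\<tau> + T}"
      by (rule log_side_by_parts[OF q])
        (use T left bd' sub' in \<open>auto simp: CR simp del: of_real_add of_real_diff intro!: derivative_eq_intros continuous_intros\<close>)
    then show "((\<lambda>x. Im (\<i> * f (Complex \<sigma> 0 + of_real x * \<i>))) has_integral 
        (L \<sigma> (\<tau> + T) + L \<sigma> (\<tau> - T)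
      - integral {\<tau> - T..\<tau> + T} (\<lambda>y. L \<sigma> y * (cos (\<kappa> * (y - \<tau>)) * \<kappa>)))) {\<tau> - T..\<tau> + T}"
      unfolding CR f_def VC L_def kT' ri
      by (simp add: times_divide_eq_left[symmetric] del: times_divide_eq_left)
  qed
  have Vd: "((\<lambda>y. V (Complex x y)) has_vector_derivative \<i> * (of_real \<kappa> * cosh (Complex (\<kappa> * (x - \<sigma>)) (\<kappa> * (y - \<tau>))))) (at y)" for x y
    unfolding VC cosh_Complex has_vector_derivative_complex_iff
    by (auto intro!: derivative_eq_intros)
  have Jr: "Im Jr = cosh (\<kappa> * (A - \<sigma>)) * (L A (\<tau> + T) + L A (\<tau> - T))
      - \<kappa> * Re (integral {\<tau> - T..\<tau> + T} (\<lambda>t. Ln (q (Complex A t)) * cosh (Complex (\<kappa> * (A - \<sigma>)) (\<kappa> * (t - \<tau>)))))"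
  proof -
    have "((\<lambda>x. \<i> * deriv q (Complex A 0 + of_real x * \<i>) / q (Complex A 0 + of_real x * \<i>) * V (Complex A x)) has_integral
       Ln (q (Complex A 0 + of_real (\<tau> + T) * \<i>)) * V (Complex A (\<tau> + T)) - Ln (q (Complex A 0 + of_real (\<tau> - T) * \<i>)) * V (Complex A (\<tau> - T))
        - integral {\<tau> - T..\<tau> + T} (\<lambda>x. Ln (q (Complex A 0 + of_real x * \<i>)) * (\<i> * (of_real \<kappa> * cosh (Complex (\<kappa> * (A - \<sigma>)) (\<kappa> * (x - \<tau>))))))) {\<tau> - T..\<tau> + T}"
    proof (rule Ln_side_by_parts[OF q _ _ _ Vd])
      show "continuous_on {\<tau> - T..\<tau> + T} (\<lambda>y. \<i> * (of_real \<kappa> * cosh (Complex (\<kappa> * (A - \<sigma>)) (\<kappa> * (y - \<tau>)))))"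
        unfolding cosh_Complex Complex_eq by (intro continuous_intros)
    qed (use T right bd' sub' in \<open>auto simp: CR simp del: of_real_add of_real_diff\<close>)
    note J = this
    define I where "I = integral {\<tau> - T..\<tau> + T} (\<lambda>t. Ln (q (Complex A t)) * cosh (Complex (\<kappa> * (A - \<sigma>)) (\<kappa> * (t - \<tau>))))"
    have "Jr = Ln (q (Complex A (\<tau> + T))) * V (Complex A (\<tau> + T)) - Ln (q (Complex A (\<tau> - T))) * V (Complex A (\<tau> - T))
        - integral {\<tau> - T..\<tau> + T} (\<lambda>x. (\<i> * of_real \<kappa>) * (Ln (q (Complex A x)) * cosh (Complex (\<kappa> * (A - \<sigma>)) (\<kappa> * (x - \<tau>)))))"
      using J unfolding Jr_def CR f_def
      by (intro integral_unique) (simp add: algebra_simps)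
    also have "\<dots> = Ln (q (Complex A (\<tau> + T))) * V (Complex A (\<tau> + T)) - Ln (q (Complex A (\<tau> - T))) * V (Complex A (\<tau> - T))
        - \<i> * of_real \<kappa> * I"
      unfolding I_def integral_mult_right ..
    finally have "Im Jr = Re (Ln (q (Complex A (\<tau> + T)))) * cosh (\<kappa> * (A - \<sigma>)) + Re (Ln (q (Complex A (\<tau> - T)))) * cosh (\<kappa> * (A - \<sigma>)) - \<kappa> * Re I"
      unfolding VC kT' by simp
    moreover have "Re (Ln (q (Complex A y))) = L A y" if "y \<in> {\<tau> - T..\<tau> + T}" for y
      using right[OF that] unfolding L_def by (intro Re_Ln) auto
    ultimately show ?thesis
      using T unfolding I_def[symmetric] by (simp add: distrib_left mult.commute)
  qed
  have comm: "integral X (\<lambda>x. g x * (h x * \<kappa>)) = \<kappa> * integral X (\<lambda>x. g x * h x)" for X and g h :: "real \<Rightarrow> real"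
    unfolding integral_mult_right[symmetric] by (simp add: mult_ac)
  \<comment> \<open>The boundary terms of the four integrations by parts cancel at the corners; at
    the two right corners this uses Re (Ln q) = ln |q|.\<close>
  have alg: "- (x1 - x2 - \<kappa> * I1) + (C * (y1 + y2) - \<kappa> * I4) - (z1 - z2 - \<kappa> * I2) - (z2 + x2 - \<kappa> * I3) = \<kappa> * (I3 + I1 + I2 - I4)"
    if "x1 = y2 * C" "z1 = y1 * C" for x1 x2 y1 y2 z1 z2 C I1 I2 I3 I4 :: real
    using that by (simp add: ring_distribs mult.commute)
  show ?thesis
    using main unfolding Jb Jt Jl Jr ReV comm alg[OF refl refl] unfolding L_def a_def c_def .
qed

subsection \<open>Counting zeros with the Green function\<close>

text \<open>Green function of the unit disc with pole \<xi>. At w = \<xi> division by zero leaves a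
  finite default value instead of infinity, so vertical lines meeting solutions of f s = \<xi> must
  be avoided or shown to be negligible.\<close>

definition green :: "complex \<Rightarrow> complex \<Rightarrow> real" where
  "green \<xi> w = ln (cmod (1 - cnj \<xi> * w) / cmod (\<xi> - w))"

lemma one_minus_cnj_mult_nonzero: "cmod \<xi> < 1 \<Longrightarrow> cmod w < 1 \<Longrightarrow> 1 - cnj \<xi> * w \<noteq> 0"
  using mult_strict_mono'[of "cmod \<xi>" 1 "cmod w" 1]
  by (metis complex_mod_cnj eq_iff_diff_eq_0 less_irrefl mult.right_neutral norm_ge_zero norm_mult norm_one)

lemma pseudo_hyperbolic_identity:
  "(cmod (1 - cnj \<xi> * w))\<^sup>2 - (cmod (\<xi> - w))\<^sup>2 = (1 - (cmod \<xi>)\<^sup>2) * (1 - (cmod w)\<^sup>2)"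
  unfolding cmod_power2 by (simp add: power2_eq_square algebra_simps)

lemma cmod_diff_le_cmod_one_minus:
  assumes "cmod \<xi> < 1" "cmod w < 1" shows "cmod (\<xi> - w) \<le> cmod (1 - cnj \<xi> * w)"
proof -
  have "0 \<le> (1 - (cmod \<xi>)\<^sup>2) * (1 - (cmod w)\<^sup>2)"
    using assms by (intro mult_nonneg_nonneg) (auto simp: abs_square_le_1)
  then have "(cmod (\<xi> - w))\<^sup>2 \<le> (cmod (1 - cnj \<xi> * w))\<^sup>2"
    using pseudo_hyperbolic_identity[of \<xi> w] by linarith
  then show ?thesis by (rule power2_le_imp_le) simp
qed

lemma green_nonneg:
  assumes "cmod \<xi> < 1" "cmod w < 1" shows "0 \<le> green \<xi> w"
proof (cases "w = \<xi>")
  case False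
  then show ?thesis using cmod_diff_le_cmod_one_minus[OF assms] unfolding green_def
    by (intro ln_ge_zero) (auto simp: field_simps)
qed (simp add: green_def)

locale half_plane_map =
  fixes f :: "complex \<Rightarrow> complex"
  assumes holo: "f holomorphic_on {s. Re s > 0}"
    and disc: "\<And>s. Re s > 0 \<Longrightarrow> cmod (f s) < 1"
    and vanish: "\<And>\<delta>. \<delta> > 0 \<Longrightarrow> \<exists>A>0. \<forall>s. Re s \<ge> A \<longrightarrow> cmod (f s) \<le> \<delta>"

locale half_plane_value = half_plane_map +
  fixes \<xi> :: complex
  assumes xi: "\<xi> \<noteq> 0" "cmod \<xi> < 1"
begin

text \<open>The Moebius map of the disc sending \<xi> to 0, composed with f and divided by its value
  at 0. With this normalisation Q is close to 1 far to the right and ln |Q| = L - green.\<close>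

definition Q :: "complex \<Rightarrow> complex" where "Q s = (1 - f s / \<xi>) / (1 - cnj \<xi> * f s)"

definition mult :: "complex \<Rightarrow> real" where "mult s = of_int (zorder (\<lambda>z. f z - \<xi>) s)"

definition zeros :: "real \<Rightarrow> real \<Rightarrow> complex set" where
  "zeros \<sigma> X = {s. Re s > \<sigma> \<and> \<bar>Im s\<bar> < X \<and> f s = \<xi>}"

definition L :: real where "L = ln (1 / cmod \<xi>)"

lemma L_pos: "L > 0"
  using xi by (auto simp: L_def ln_div)

lemma halfplane: "open {s. Re s > 0}" "connected {s. Re s > 0}" "convex {s. Re s > 0}"
  by (simp_all add: open_halfspace_Re_gt convex_halfspace_Re_gt convex_connected)

lemma no_zeros_far: obtains A where "A > 0" "\<And>s. Re s \<ge> A \<Longrightarrow> f s \<noteq> \<xi>"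
proof -
  obtain B where B: "B > 0" "\<forall>s. Re s \<ge> B \<longrightarrow> cmod (f s) \<le> cmod \<xi> / 2"
    using vanish[of "cmod \<xi> / 2"] xi by auto
  have "f s \<noteq> \<xi>" if "Re s \<ge> B" for s
  proof
    assume "f s = \<xi>"
    then have "cmod \<xi> \<le> cmod \<xi> / 2" using B that by blast
    then show False using xi by simp
  qed
  then show ?thesis using that B by blast
qed

lemma finite_zeros_cbox:
  assumes "0 < \<sigma>" shows "finite {z \<in> cbox (Complex \<sigma> a) (Complex A b). f z = \<xi>}"
proof (cases "(\<lambda>z. f z - \<xi>) constant_on {s. Re s > 0}")
  case True
  obtain B where B: "B > 0" "\<And>s. Re s \<ge> B \<Longrightarrow> f s \<noteq> \<xi>" using no_zeros_far by blast
  then have "f (of_real B) \<noteq> \<xi>" by simp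
  obtain c where c: "\<And>z. Re z > 0 \<Longrightarrow> f z - \<xi> = c" using True by (auto simp: constant_on_def)
  have "c \<noteq> 0" using c[of "of_real B"] B(1) \<open>f (of_real B) \<noteq> \<xi>\<close> by auto
  then have "f z \<noteq> \<xi>" if "Re z > 0" for z using c[OF that] by auto
  then have "{z \<in> cbox (Complex \<sigma> a) (Complex A b). f z = \<xi>} = {}"
    using assms by (force simp: in_cbox_complex_iff)
  then show ?thesis by (simp only: finite.emptyI)
next
  case False
  have "finite {z \<in> cbox (Complex \<sigma> a) (Complex A b). f z - \<xi> = 0}"
    by (rule holomorphic_compact_finite_zeros[of _ "{s. Re s > 0}"])
      (use False assms halfplane holo in \<open>auto simp: in_cbox_complex_iff intro!: holomorphic_intros\<close>)
  then show ?thesis by simp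
qed

lemma finite_zeros: assumes "0 < \<sigma>" shows "finite (zeros \<sigma> X)"
proof -
  obtain A where A: "A > 0" "\<And>s. Re s \<ge> A \<Longrightarrow> f s \<noteq> \<xi>" using no_zeros_far by blast
  have "zeros \<sigma> X \<subseteq> {z \<in> cbox (Complex \<sigma> (-X)) (Complex A X). f z = \<xi>}"
    using A(2) by (force simp: zeros_def in_cbox_complex_iff)
  then show ?thesis using finite_zeros_cbox[OF assms] finite_subset by blast
qed

definition all_zeros :: "complex set" where "all_zeros = {s. Re s > 0 \<and> f s = \<xi>}"

lemma countable_all_zeros: "countable all_zeros"
proof -
  have "all_zeros \<subseteq> (\<Union>n. zeros (1 / Suc n) (Suc n))"
  proof
    fix s assume s: "s \<in> all_zeros"
    obtain n where n: "1 / Re s + \<bar>Im s\<bar> < real n" using reals_Archimedean2 by blast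
    have "1 / Re s > 0" using s by (auto simp: all_zeros_def)
    then have "1 / Re s < Suc n" "\<bar>Im s\<bar> < Suc n" using n by linarith+
    then have "1 / Suc n < Re s" using s by (auto simp: all_zeros_def field_simps)
    then show "s \<in> (\<Union>n. zeros (1 / Suc n) (Suc n))"
      using s \<open>\<bar>Im s\<bar> < Suc n\<close> by (auto simp: all_zeros_def zeros_def intro!: exI[of _ n])
  qed
  moreover have "countable (\<Union>n. zeros (1 / Suc n) (Suc n))"
    by (intro countable_UN) (auto intro!: countable_finite finite_zeros)
  ultimately show ?thesis using countable_subset by blast
qed

lemma den_nz: "Re s > 0 \<Longrightarrow> 1 - cnj \<xi> * f s \<noteq> 0"
  using one_minus_cnj_mult_nonzero xi disc by blast

lemma Q_holo: "Q holomorphic_on {s. Re s > 0}"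
  unfolding Q_def using den_nz xi by (intro holomorphic_intros holo) auto

lemma Q_eq_0_iff: "Re s > 0 \<Longrightarrow> Q s = 0 \<longleftrightarrow> f s = \<xi>"
  using den_nz[of s] xi by (auto simp: Q_def)

lemma ln_cmod_Q: "Re s > 0 \<Longrightarrow> f s \<noteq> \<xi> \<Longrightarrow> ln (cmod (Q s)) = L - green \<xi> (f s)"
proof -
  assume s: "Re s > 0" "f s \<noteq> \<xi>"
  have "Q s = (\<xi> - f s) / (\<xi> * (1 - cnj \<xi> * f s))" using xi by (simp add: Q_def field_simps)
  then show ?thesis using s xi den_nz[of s]
    by (simp add: L_def green_def norm_divide norm_mult ln_div ln_mult)
qed

lemma eventually_ne_value:
  assumes "Re s > 0" shows "eventually (\<lambda>z. f z - \<xi> \<noteq> 0) (at s)"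
proof -
  obtain B where B: "B > 0" "\<And>s. Re s \<ge> B \<Longrightarrow> f s \<noteq> \<xi>" using no_zeros_far by blast
  have "\<forall>\<^sub>F z in at s. f z - \<xi> \<noteq> 0 \<and> z \<in> {s. Re s > 0}"
  proof (rule non_zero_neighbour_alt)
    show "f (of_real B) - \<xi> \<noteq> 0" "of_real B \<in> {s. Re s > 0}" using B by auto
  qed (use assms holo halfplane in \<open>auto intro!: holomorphic_intros\<close>)
  then show ?thesis by (rule eventually_mono) auto
qed

text \<open>Q is f - \<xi> times the zero-free analytic factor \<open>h\<close>.\<close>

lemma zorder_Q: assumes "Re s > 0" "f s = \<xi>" shows "real_of_int (zorder Q s) = mult s"
proof -
  define h where "h = (\<lambda>z. - 1 / (\<xi> * (1 - cnj \<xi> * f z)))"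
  have an: "(\<lambda>z. f z - \<xi>) analytic_on {s}" "h analytic_on {s}"
    unfolding analytic_at h_def using holo halfplane assms(1) den_nz xi
    by (auto intro!: exI[of _ "{s. Re s > 0}"] holomorphic_intros)
  have ev: "eventually (\<lambda>z. f z - \<xi> \<noteq> 0) (at s)" using eventually_ne_value assms by blast
  have hp: "eventually (\<lambda>z. z \<in> {s. Re s > 0}) (at s)"
    using halfplane(1) assms(1) eventually_at_in_open' by blast
  have hnz: "h z \<noteq> 0" if "Re z > 0" for z using den_nz[OF that] xi by (simp add: h_def)
  have "zorder Q s = zorder (\<lambda>z. (f z - \<xi>) * h z) s"
  proof -
    have "1 - f z / \<xi> = (f z - \<xi>) * (- 1 / \<xi>)" for z using xi by (simp add: field_simps)
    moreover have "a * (- 1 / \<xi>) / D = a * (- 1 / (\<xi> * D))" for a D by simp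
    ultimately have "Q z = (f z - \<xi>) * h z" for z unfolding Q_def h_def by (simp only:)
    then have "Q = (\<lambda>z. (f z - \<xi>) * h z)" by (rule ext)
    then show ?thesis by (rule arg_cong)
  qed
  also have "\<dots> = zorder (\<lambda>z. f z - \<xi>) s + zorder h s"
    by (rule zorder_times_analytic[OF an]) (use ev hp hnz in \<open>auto elim: eventually_elim2\<close>)
  also have "zorder h s = 0" by (rule zorder_eq_0I[OF an(2)]) (use hnz assms in auto)
  finally show ?thesis by (simp add: mult_def)
qed

lemma mult_ge_0: assumes "Re s > 0" "f s = \<xi>" shows "mult s \<ge> 0"
proof -
  have "eventually (\<lambda>z. f z - \<xi> \<noteq> 0) (at s)" using eventually_ne_value assms by blast
  then have "frequently (\<lambda>z. f z - \<xi> \<noteq> 0) (at s)" by (intro eventually_frequently) auto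
  moreover have "(\<lambda>z. f z - \<xi>) analytic_on {s}"
    unfolding analytic_at using holo halfplane assms(1)
    by (auto intro!: exI[of _ "{s. Re s > 0}"] holomorphic_intros)
  ultimately show ?thesis unfolding mult_def using zorder_ge_0 by fastforce
qed

text \<open>Supplies the abscissa of the right side of the rectangles: from there on
  \<open>Ln (Q s)\<close> is defined and small, and there are no solutions of f s = \<xi>.\<close>

lemma Q_near_1:
  assumes "\<delta> > 0"
  obtains A where "A > 1" "\<And>s. Re s \<ge> A \<Longrightarrow> f s \<noteq> \<xi>" "\<And>s. Re s \<ge> A \<Longrightarrow> Re (Q s) > 0"
    "\<And>s. Re s \<ge> A \<Longrightarrow> cmod (Ln (Q s)) \<le> \<delta>"
proof -
  define q where "q = (\<lambda>w. (1 - w / \<xi>) / (1 - cnj \<xi> * w))"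
  have q0: "isCont q 0" unfolding q_def using xi by (intro continuous_intros) auto
  have q1: "q 0 = 1" by (simp add: q_def)
  have "isCont (\<lambda>w. Re (q w)) 0" "isCont (\<lambda>w. Ln (q w)) 0"
    using q0 q1 by (auto intro!: continuous_intros)
  then have "\<forall>\<^sub>F w in at 0. Re (q w) > 0" "\<forall>\<^sub>F w in at 0. cmod (Ln (q w)) < \<delta>"
    using q1 assms unfolding isCont_def
    by (auto dest: order_tendstoD(1)[of _ 1 _ 0] tendstoD[of _ 0 _ \<delta>] simp: dist_norm)
  then have "\<forall>\<^sub>F w in at 0. Re (q w) > 0 \<and> cmod (Ln (q w)) < \<delta>" by (rule eventually_conj)
  then obtain d where d: "d > 0" "\<And>w. w \<noteq> 0 \<Longrightarrow> cmod w < d \<Longrightarrow> Re (q w) > 0 \<and> cmod (Ln (q w)) < \<delta>"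
    unfolding eventually_at by (auto simp: dist_norm)
  have d': "Re (q w) > 0 \<and> cmod (Ln (q w)) < \<delta>" if "cmod w < d" for w
    using d(2)[of w] that q1 assms by (cases "w = 0") auto
  obtain A where A: "A > 0" "\<And>s. Re s \<ge> A \<Longrightarrow> f s \<noteq> \<xi>" using no_zeros_far by blast
  obtain B where B: "B > 0" "\<forall>s. Re s \<ge> B \<longrightarrow> cmod (f s) \<le> d / 2"
    using vanish[of "d/2"] d by auto
  have Qq: "Q s = q (f s)" for s by (simp add: Q_def q_def)
  have lt: "cmod (f s) < d" if "Re s \<ge> B" for s
    proof -
    have "cmod (f s) \<le> d / 2" using B(2) that by blast
    then show ?thesis using d(1) by simp
  qed
  show ?thesis
    by (rule that[of "A + B + 1"]) (use A B lt d' in \<open>auto simp: Qq less_imp_le\<close>)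
qed

definition gl :: "real \<Rightarrow> real \<Rightarrow> real" where "gl x y = green \<xi> (f (Complex x y))"

lemma gl_nonneg: "x > 0 \<Longrightarrow> gl x y \<ge> 0"
  unfolding gl_def by (rule green_nonneg) (use xi disc in auto)

text \<open>The zero sum of the rectangle formula for centre height \<tau> and half-height T. No
  right edge appears because the rectangles reach beyond all solutions of f s = \<xi>.\<close>

definition zsum :: "real \<Rightarrow> real \<Rightarrow> real \<Rightarrow> real" where
  "zsum T \<sigma> \<tau> = (\<Sum>p\<in>{p. Re p > \<sigma> \<and> \<bar>Im p - \<tau>\<bar> < T \<and> f p = \<xi>}.
     sinh (pi / (2 * T) * (Re p - \<sigma>)) * cos (pi / (2 * T) * (Im p - \<tau>)) * mult p)"

lemma continuous_on_gl:
  assumes "S \<subseteq> {s. Re s > 0}" "\<And>s. s \<in> S \<Longrightarrow> f s \<noteq> \<xi>"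
  shows "continuous_on S (\<lambda>s. green \<xi> (f s))"
proof -
  have "continuous_on S f" using holo assms(1) holomorphic_on_imp_continuous_on holomorphic_on_subset by blast
  then show ?thesis unfolding green_def
    by (intro continuous_intros) (use assms den_nz in auto)
qed

lemma continuous_on_gl_vertical:
  assumes "\<sigma> > 0" "\<And>p. p \<in> all_zeros \<Longrightarrow> Re p \<noteq> \<sigma>"
  shows "continuous_on X (gl \<sigma>)"
proof -
  have "continuous_on (Complex \<sigma> ` X) (\<lambda>s. green \<xi> (f s))"
    by (rule continuous_on_gl) (use assms(1) assms(2)[of "Complex \<sigma> _"] in \<open>auto simp: all_zeros_def\<close>)
  moreover have "continuous_on X (Complex \<sigma>)" unfolding Complex_eq by (intro continuous_intros)
  ultimately show ?thesis unfolding gl_def using continuous_on_compose2 by blast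
qed

lemma continuous_on_gl_horizontal:
  assumes "X \<subseteq> {0<..}" "\<And>p. p \<in> all_zeros \<Longrightarrow> Im p \<noteq> y"
  shows "continuous_on X (\<lambda>x. gl x y)"
proof -
  have "continuous_on ((\<lambda>x. Complex x y) ` X) (\<lambda>s. green \<xi> (f s))"
    by (rule continuous_on_gl) (use assms(1) assms(2)[of "Complex _ y"] in \<open>auto simp: all_zeros_def\<close>)
  moreover have "continuous_on X (\<lambda>x. Complex x y)" unfolding Complex_eq by (intro continuous_intros)
  ultimately show ?thesis unfolding gl_def using continuous_on_compose2 by blast
qed

text \<open>Insert ln |Q| = L - green. The constant L contributes 2 L / \<kappa> on the left side
  and L / \<kappa> (cosh (\<kappa> (A - \<sigma>)) - 1) on each horizontal side, together 2 L cosh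
  (\<kappa> (A - \<sigma>)) after multiplication by \<kappa>. The error term is the right
  side.\<close>

lemma rectangle_green:
  assumes A: "\<And>s. Re s \<ge> A \<Longrightarrow> f s \<noteq> \<xi> \<and> Re (Q s) > 0 \<and> cmod (Ln (Q s)) \<le> \<delta>"
    and s: "0 < \<sigma>" "\<sigma> < A" and T: "0 < T" and \<kappa>: "\<kappa> = pi / (2 * T)"
    and gen: "\<And>p. p \<in> all_zeros \<Longrightarrow> Re p \<noteq> \<sigma> \<and> Im p \<noteq> \<tau> - T \<and> Im p \<noteq> \<tau> + T"
  shows "\<bar>2 * pi * zsum T \<sigma> \<tau> + \<kappa> * (integral {\<tau> - T..\<tau> + T} (\<lambda>t. gl \<sigma> t * cos (\<kappa> * (t - \<tau>)))
     + integral {\<sigma>..A} (\<lambda>x. gl x (\<tau> - T) * sinh (\<kappa> * (x - \<sigma>)))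
     + integral {\<sigma>..A} (\<lambda>x. gl x (\<tau> + T) * sinh (\<kappa> * (x - \<sigma>))))
     - 2 * L * cosh (\<kappa> * (A - \<sigma>))\<bar> \<le> pi * \<delta> * cosh (\<kappa> * (A - \<sigma>))"
proof -
  have k0: "\<kappa> > 0" using \<kappa> T by simp
  have kT: "\<kappa> * T = pi / 2" using \<kappa> T by simp
  define R where "R = integral {\<tau> - T..\<tau> + T} (\<lambda>t. Ln (Q (Complex A t)) * cosh (Complex (\<kappa> * (A - \<sigma>)) (\<kappa> * (t - \<tau>))))"
  have ne: "f (Complex x y) \<noteq> \<xi>" if "x > 0" "x = \<sigma> \<or> y = \<tau> - T \<or> y = \<tau> + T" for x y
    using gen[of "Complex x y"] that by (auto simp: all_zeros_def)
  have main: "2 * pi * (\<Sum>p\<in>{p \<in> box (Complex \<sigma> (\<tau> - T)) (Complex A (\<tau> + T)). Q p = 0}.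
      sinh (\<kappa> * (Re p - \<sigma>)) * cos (\<kappa> * (Im p - \<tau>)) * zorder Q p) =
    \<kappa> * (integral {\<tau> - T..\<tau> + T} (\<lambda>t. ln (cmod (Q (Complex \<sigma> t))) * cos (\<kappa> * (t - \<tau>)))
     + integral {\<sigma>..A} (\<lambda>x. ln (cmod (Q (Complex x (\<tau> - T)))) * sinh (\<kappa> * (x - \<sigma>)))
     + integral {\<sigma>..A} (\<lambda>x. ln (cmod (Q (Complex x (\<tau> + T)))) * sinh (\<kappa> * (x - \<sigma>)))
     - Re R)" unfolding R_def
    by (rule rectangle_formula[OF Q_holo halfplane(1)])
      (use s T \<kappa> A ne Q_eq_0_iff in \<open>auto simp: in_cbox_complex_iff\<close>)
  have eqset: "{p \<in> box (Complex \<sigma> (\<tau> - T)) (Complex A (\<tau> + T)). Q p = 0} = {p. Re p > \<sigma> \<and> \<bar>Im p - \<tau>\<bar> < T \<and> f p = \<xi>}"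
  proof -
    have "Re p < A" if "f p = \<xi>" for p using A[of p] that by force
    then show ?thesis using s Q_eq_0_iff by (auto simp: in_box_complex_iff)
  qed
  have z: "(\<Sum>p\<in>{p \<in> box (Complex \<sigma> (\<tau> - T)) (Complex A (\<tau> + T)). Q p = 0}.
      sinh (\<kappa> * (Re p - \<sigma>)) * cos (\<kappa> * (Im p - \<tau>)) * zorder Q p) = zsum T \<sigma> \<tau>"
    unfolding zsum_def eqset \<kappa>[symmetric] by (rule sum.cong) (use s zorder_Q in auto)
  have cosI: "((\<lambda>t. L * cos (\<kappa> * (t - \<tau>))) has_integral 2 * L / \<kappa>) {\<tau> - T..\<tau> + T}"
  proof -
    have "((\<lambda>t. L * cos (\<kappa> * (t - \<tau>))) has_integral L / \<kappa> * sin (\<kappa> * (\<tau> + T - \<tau>)) - L / \<kappa> * sin (\<kappa> * (\<tau> - T - \<tau>))) {\<tau> - T..\<tau> + T}"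
      by (rule fundamental_theorem_of_calculus)
        (use T k0 in \<open>auto intro!: derivative_eq_intros simp flip: has_real_derivative_iff_has_vector_derivative\<close>)
    moreover have "sin (\<kappa> * (\<tau> + T - \<tau>)) = 1" "sin (\<kappa> * (\<tau> - T - \<tau>)) = -1"
    proof -
      have "\<kappa> * (\<tau> + T - \<tau>) = pi / 2" "\<kappa> * (\<tau> - T - \<tau>) = - (pi / 2)" using kT by simp_all
      then show "sin (\<kappa> * (\<tau> + T - \<tau>)) = 1" "sin (\<kappa> * (\<tau> - T - \<tau>)) = -1" by (simp_all only: sin_minus sin_pi_half)
    qed
    ultimately show ?thesis by simp
  qed
  have sinhI: "((\<lambda>x. L * sinh (\<kappa> * (x - \<sigma>))) has_integral L / \<kappa> * (cosh (\<kappa> * (A - \<sigma>)) - 1)) {\<sigma>..A}"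
  proof -
    have "((\<lambda>x. L * sinh (\<kappa> * (x - \<sigma>))) has_integral L / \<kappa> * cosh (\<kappa> * (A - \<sigma>)) - L / \<kappa> * cosh (\<kappa> * (\<sigma> - \<sigma>))) {\<sigma>..A}"
      by (rule fundamental_theorem_of_calculus)
        (use s k0 in \<open>auto intro!: derivative_eq_intros simp flip: has_real_derivative_iff_has_vector_derivative\<close>)
    then show ?thesis by (simp add: right_diff_distrib)
  qed
  have conv: "integral X (\<lambda>t. ln (cmod (Q (c t))) * w t) = I - integral X (\<lambda>t. green \<xi> (f (c t)) * w t)"
    if "((\<lambda>t. L * w t) has_integral I) X" "continuous_on X (\<lambda>t. green \<xi> (f (c t)))" "continuous_on X w"
      "X = {a..b}" "\<And>t. t \<in> X \<Longrightarrow> Re (c t) > 0 \<and> f (c t) \<noteq> \<xi>" for X c and w :: "real \<Rightarrow> real" and I a b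
  proof -
    have "(\<lambda>t. green \<xi> (f (c t)) * w t) integrable_on X"
      unfolding that(4) by (rule integrable_continuous_interval) (use that in \<open>auto intro!: continuous_intros\<close>)
    then have "((\<lambda>t. L * w t - green \<xi> (f (c t)) * w t) has_integral I - integral X (\<lambda>t. green \<xi> (f (c t)) * w t)) X"
      by (intro has_integral_diff that(1) integrable_integral)
    moreover have "ln (cmod (Q (c t))) * w t = L * w t - green \<xi> (f (c t)) * w t" if "t \<in> X" for t
      using ln_cmod_Q[of "c t"] \<open>\<And>t. t \<in> X \<Longrightarrow> Re (c t) > 0 \<and> f (c t) \<noteq> \<xi>\<close>[OF that] by (simp add: left_diff_distrib)
    ultimately have "((\<lambda>t. ln (cmod (Q (c t))) * w t) has_integral I - integral X (\<lambda>t. green \<xi> (f (c t)) * w t)) X"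
      by (subst has_integral_cong) auto
    then show ?thesis by (rule integral_unique)
  qed
  have l: "integral {\<tau> - T..\<tau> + T} (\<lambda>t. ln (cmod (Q (Complex \<sigma> t))) * cos (\<kappa> * (t - \<tau>)))
     = 2 * L / \<kappa> - integral {\<tau> - T..\<tau> + T} (\<lambda>t. gl \<sigma> t * cos (\<kappa> * (t - \<tau>)))"
    unfolding gl_def
    by (rule conv[OF cosI]) (use s ne gen continuous_on_gl_vertical in \<open>auto simp: gl_def[symmetric] intro!: continuous_intros\<close>)
  have bt: "integral {\<sigma>..A} (\<lambda>x. ln (cmod (Q (Complex x y))) * sinh (\<kappa> * (x - \<sigma>)))
      = L / \<kappa> * (cosh (\<kappa> * (A - \<sigma>)) - 1) - integral {\<sigma>..A} (\<lambda>x. gl x y * sinh (\<kappa> * (x - \<sigma>)))"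
    if "y = \<tau> - T \<or> y = \<tau> + T" for y
    unfolding gl_def
    by (rule conv[OF sinhI]) (use s ne gen that in \<open>auto simp: gl_def[symmetric] intro!: continuous_intros continuous_on_gl_horizontal\<close>)
  \<comment> \<open>The integrand is at most \<delta> cosh x, because |cosh (x + \<i> y)| <= cosh x.
    The length 2 T of the side becomes \<pi> after multiplication by \<kappa>.\<close>
  have "cmod R \<le> \<delta> * cosh (\<kappa> * (A - \<sigma>)) * (\<tau> + T - (\<tau> - T))"
    unfolding R_def
  proof (rule integral_bound)
    have "continuous_on {\<tau> - T..\<tau> + T} (\<lambda>t. Q (Complex A t))"
      by (rule continuous_on_compose2[OF holomorphic_on_imp_continuous_on[OF Q_holo]])
        (use s in \<open>auto simp: Complex_eq intro!: continuous_intros\<close>)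
    moreover have "Q (Complex A t) \<notin> \<real>\<^sub>\<le>\<^sub>0" for t
      using A[of "Complex A t"] by (auto simp: complex_nonpos_Reals_iff)
    ultimately show "continuous_on {\<tau> - T..\<tau> + T} (\<lambda>t. Ln (Q (Complex A t)) * cosh (Complex (\<kappa> * (A - \<sigma>)) (\<kappa> * (t - \<tau>))))"
      unfolding cosh_Complex unfolding Complex_eq by (intro continuous_intros) auto
    show "cmod (Ln (Q (Complex A t)) * cosh (Complex (\<kappa> * (A - \<sigma>)) (\<kappa> * (t - \<tau>)))) \<le> \<delta> * cosh (\<kappa> * (A - \<sigma>))" for t
      unfolding norm_mult
    proof (rule mult_mono)
      show "cmod (Ln (Q (Complex A t))) \<le> \<delta>" using A by simp
      then show "0 \<le> \<delta>" using norm_ge_zero order_trans by blast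
      let ?x = "\<kappa> * (A - \<sigma>)" and ?y = "\<kappa> * (t - \<tau>)"
      have "(sinh ?x * sin ?y)\<^sup>2 \<le> (cosh ?x * sin ?y)\<^sup>2"
        unfolding power_mult_distrib by (intro mult_right_mono) (simp_all add: sinh_square_eq)
      moreover have "(cosh ?x * cos ?y)\<^sup>2 + (cosh ?x * sin ?y)\<^sup>2 = (cosh ?x)\<^sup>2"
        unfolding power_mult_distrib distrib_left[symmetric] by simp
      ultimately have "(cmod (cosh (Complex ?x ?y)))\<^sup>2 \<le> (cosh ?x)\<^sup>2"
        unfolding cosh_Complex cmod_power2 by simp
      then show "cmod (cosh (Complex ?x ?y)) \<le> cosh ?x"
        by (rule power2_le_imp_le) simp
    qed auto
  qed (use T in auto)
  then have "\<bar>\<kappa> * Re R\<bar> \<le> \<kappa> * (\<delta> * cosh (\<kappa> * (A - \<sigma>)) * (2 * T))"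
    using abs_Re_le_cmod[of R] k0 by (simp add: abs_mult)
  also have "\<dots> = 2 * (\<kappa> * T) * \<delta> * cosh (\<kappa> * (A - \<sigma>))" by (simp add: mult_ac)
  finally have "\<bar>\<kappa> * Re R\<bar> \<le> pi * \<delta> * cosh (\<kappa> * (A - \<sigma>))" unfolding kT by simp
  moreover have "2 * pi * zsum T \<sigma> \<tau> = \<kappa> * (2 * L / \<kappa> - i1 + (L / \<kappa> * (C - 1) - i2) + (L / \<kappa> * (C - 1) - i3) - r) \<Longrightarrow>
      2 * pi * zsum T \<sigma> \<tau> + \<kappa> * (i1 + i2 + i3) - 2 * L * C = - (\<kappa> * r)" for i1 i2 i3 C r
  proof -
    have "\<kappa> * (b - i1 + (a * (C - 1) - i2) + (a * (C - 1) - i3) - r)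
      = \<kappa> * b + 2 * (\<kappa> * a) * (C - 1) - \<kappa> * (i1 + i2 + i3) - \<kappa> * r" for a b
      by (simp add: algebra_simps)
    moreover have "\<kappa> * (2 * L / \<kappa>) = 2 * L" "\<kappa> * (L / \<kappa>) = L" using k0 by simp_all
    ultimately have "\<kappa> * (2 * L / \<kappa> - i1 + (L / \<kappa> * (C - 1) - i2) + (L / \<kappa> * (C - 1) - i3) - r)
      = 2 * L + 2 * L * (C - 1) - \<kappa> * (i1 + i2 + i3) - \<kappa> * r" by (simp only:)
    then show "2 * pi * zsum T \<sigma> \<tau> = \<kappa> * (2 * L / \<kappa> - i1 + (L / \<kappa> * (C - 1) - i2) + (L / \<kappa> * (C - 1) - i3) - r) \<Longrightarrow>
      2 * pi * zsum T \<sigma> \<tau> + \<kappa> * (i1 + i2 + i3) - 2 * L * C = - (\<kappa> * r)"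
      by (simp add: algebra_simps)
  qed
  note this[OF main[unfolded z l bt[OF disjI1[OF refl]] bt[OF disjI2[OF refl]]]]
  ultimately show ?thesis by simp
qed

end

section \<open>Control of the horizontal sides\<close>

context half_plane_value begin

lemma zsum_nonneg: assumes "\<sigma> > 0" "T > 0" shows "zsum T \<sigma> \<tau> \<ge> 0"
  unfolding zsum_def
proof (rule sum_nonneg)
  fix p assume p: "p \<in> {p. Re p > \<sigma> \<and> \<bar>Im p - \<tau>\<bar> < T \<and> f p = \<xi>}"
  have "\<bar>pi / (2 * T) * (Im p - \<tau>)\<bar> \<le> pi / (2 * T) * T"
    using p assms unfolding abs_mult by (intro mult_mono) auto
  then have "\<bar>pi / (2 * T) * (Im p - \<tau>)\<bar> \<le> pi / 2" using assms by simp
  then have "cos (pi / (2 * T) * (Im p - \<tau>)) \<ge> 0" by (intro cos_ge_zero) (simp_all only: abs_le_iff, simp_all)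
  then show "0 \<le> sinh (pi / (2 * T) * (Re p - \<sigma>)) * cos (pi / (2 * T) * (Im p - \<tau>)) * mult p"
    using p assms mult_ge_0[of p] by (intro mult_nonneg_nonneg) auto
qed

lemma integral_gl_horizontal_nonneg:
  assumes "0 < \<sigma>" "\<And>p. p \<in> all_zeros \<Longrightarrow> Im p \<noteq> y" "\<kappa> \<ge> 0"
  shows "integral {\<sigma>..A} (\<lambda>x. gl x y * sinh (\<kappa> * (x - \<sigma>))) \<ge> 0"
    and "(\<lambda>x. gl x y * sinh (\<kappa> * (x - \<sigma>))) integrable_on {\<sigma>..A}"
proof -
  show i: "(\<lambda>x. gl x y * sinh (\<kappa> * (x - \<sigma>))) integrable_on {\<sigma>..A}"
    by (intro integrable_continuous_interval continuous_intros continuous_on_gl_horizontal) (use assms in auto)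
  show "integral {\<sigma>..A} (\<lambda>x. gl x y * sinh (\<kappa> * (x - \<sigma>))) \<ge> 0"
    by (rule integral_nonneg[OF i]) (use assms gl_nonneg in auto)
qed

lemma integral_gl_cos_nonneg:
  assumes "0 < \<sigma>" "\<And>p. p \<in> all_zeros \<Longrightarrow> Re p \<noteq> \<sigma>" "T > 0"
  shows "integral {\<tau> - T..\<tau> + T} (\<lambda>t. gl \<sigma> t * cos (pi / (2 * T) * (t - \<tau>))) \<ge> 0"
proof (rule integral_nonneg)
  show "(\<lambda>t. gl \<sigma> t * cos (pi / (2 * T) * (t - \<tau>))) integrable_on {\<tau> - T..\<tau> + T}"
    by (intro integrable_continuous_interval continuous_intros continuous_on_gl_vertical) (use assms in auto)
  fix t assume t: "t \<in> {\<tau> - T..\<tau> + T}"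
  have "\<bar>pi / (2 * T) * (t - \<tau>)\<bar> \<le> pi / (2 * T) * T"
    using t assms unfolding abs_mult by (intro mult_mono) auto
  then have "\<bar>pi / (2 * T) * (t - \<tau>)\<bar> \<le> pi / 2" using assms by simp
  then have "cos (pi / (2 * T) * (t - \<tau>)) \<ge> 0" by (intro cos_ge_zero) (simp_all only: abs_le_iff, simp_all)
  then show "0 \<le> gl \<sigma> t * cos (pi / (2 * T) * (t - \<tau>))" using gl_nonneg assms by simp
qed

text \<open>Apply the formula to the rectangle of half-height 1 whose top side lies at height y. All
  its other terms are nonnegative, so the top side alone is bounded by the right-hand side,
  uniformly in y and \<sigma>.\<close>

lemma horizontal_bound:
  assumes A: "\<And>s. Re s \<ge> A \<Longrightarrow> f s \<noteq> \<xi> \<and> Re (Q s) > 0 \<and> cmod (Ln (Q s)) \<le> \<delta>"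
    and s: "0 < \<sigma>" "\<sigma> < A" and \<delta>: "\<delta> > 0"
    and gen: "\<And>p. p \<in> all_zeros \<Longrightarrow> Re p \<noteq> \<sigma> \<and> Im p \<noteq> y \<and> Im p \<noteq> y - 2"
  shows "integral {\<sigma>..A} (\<lambda>x. gl x y * sinh (pi / 2 * (x - \<sigma>))) \<le> 2 / pi * ((2 * L + pi * \<delta>) * cosh (pi / 2 * A))"
proof -
  have "\<bar>2 * pi * zsum 1 \<sigma> (y - 1) + pi / 2 * (integral {(y - 1) - 1..(y - 1) + 1} (\<lambda>t. gl \<sigma> t * cos (pi / 2 * (t - (y - 1))))
     + integral {\<sigma>..A} (\<lambda>x. gl x ((y - 1) - 1) * sinh (pi / 2 * (x - \<sigma>)))
     + integral {\<sigma>..A} (\<lambda>x. gl x ((y - 1) + 1) * sinh (pi / 2 * (x - \<sigma>))))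
     - 2 * L * cosh (pi / 2 * (A - \<sigma>))\<bar> \<le> pi * \<delta> * cosh (pi / 2 * (A - \<sigma>))"
    by (rule rectangle_green[OF A]) (use s gen in auto)
  moreover have "zsum 1 \<sigma> (y - 1) \<ge> 0" using s zsum_nonneg by simp
  moreover have "integral {(y - 1) - 1..(y - 1) + 1} (\<lambda>t. gl \<sigma> t * cos (pi / 2 * (t - (y - 1)))) \<ge> 0"
    using integral_gl_cos_nonneg[of \<sigma> 1 "y - 1"] s gen by auto
  moreover have "integral {\<sigma>..A} (\<lambda>x. gl x ((y - 1) - 1) * sinh (pi / 2 * (x - \<sigma>))) \<ge> 0"
    by (rule integral_gl_horizontal_nonneg) (use s gen in auto)
  moreover have "pi / 2 * I3 \<le> (2 * L + pi * \<delta>) * C"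
    if "\<bar>2 * pi * z + pi / 2 * (I1 + I2 + I3) - 2 * L * C\<bar> \<le> pi * \<delta> * C" "z \<ge> 0" "I1 \<ge> 0" "I2 \<ge> 0" for z I1 I2 I3 C
  proof -
    have "0 \<le> 2 * pi * z" "0 \<le> pi / 2 * (I1 + I2)" using that by simp_all
    moreover have "pi / 2 * (I1 + I2 + I3) = pi / 2 * (I1 + I2) + pi / 2 * I3" by (rule distrib_left)
    ultimately show ?thesis using that(1) unfolding distrib_right by linarith
  qed
  ultimately have "pi / 2 * integral {\<sigma>..A} (\<lambda>x. gl x (y - 1 + 1) * sinh (pi / 2 * (x - \<sigma>)))
      \<le> (2 * L + pi * \<delta>) * cosh (pi / 2 * (A - \<sigma>))" by blast
  also have "\<dots> \<le> (2 * L + pi * \<delta>) * cosh (pi / 2 * A)"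
    using L_pos \<delta> s by (intro mult_left_mono cosh_real_nonneg_le_iff[THEN iffD2]) auto
  finally have "2 / pi * (pi / 2 * integral {\<sigma>..A} (\<lambda>x. gl x (y - 1 + 1) * sinh (pi / 2 * (x - \<sigma>))))
     \<le> 2 / pi * ((2 * L + pi * \<delta>) * cosh (pi / 2 * A))" by (intro mult_left_mono) auto
  then show ?thesis by simp
qed

text \<open>Convexity of sinh. It compares the weight of a tall rectangle with that of the rectangle
  of half-height 1 in \<open>horizontal_bound\<close>.\<close>

lemma sinh_scale_le:
  fixes y :: real assumes "0 \<le> l" "l \<le> 1" "0 \<le> y" shows "sinh (l * y) \<le> l * sinh y"
proof -
  have "convex_on {0..} (sinh :: real \<Rightarrow> real)"
    by (rule convex_on_realI[where f' = cosh]) (auto intro!: derivative_eq_intros simp: cosh_real_nonneg_le_iff)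
  from convex_onD[OF this, of l 0 y] assms show ?thesis by simp
qed

lemma sinh_bounds:
  fixes u :: real assumes "0 \<le> u" shows "u \<le> sinh u" "sinh u \<le> u * cosh u"
proof -
  have "u \<le> sinh u \<and> sinh u \<le> u * cosh u"
  proof (cases "u = 0")
    case False
    then obtain z where z: "0 < z" "z < u" "sinh u - sinh 0 = (u - 0) * cosh z"
    proof -
      have "\<exists>z. 0 < z \<and> z < u \<and> sinh u - sinh 0 = (u - 0) * cosh z"
        by (rule MVT2) (use False assms in \<open>auto intro!: derivative_eq_intros\<close>)
      then show ?thesis using that by blast
    qed
    have "cosh z \<ge> 1" by (rule cosh_real_ge_1)
    moreover have "cosh z \<le> cosh u" using z by (simp add: cosh_real_nonneg_le_iff)
    ultimately show ?thesis using z assms by (simp add: mult_left_mono) 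
  qed simp
  then show "u \<le> sinh u" "sinh u \<le> u * cosh u" by auto
qed

text \<open>The upper bound drops the horizontal sides, which are nonnegative. For the lower bound
  \<open>sinh_scale_le\<close> costs a factor 2 \<kappa> / \<pi>, and together with the outer factor
  \<kappa> the two sides contribute O(1 / T^2). The heights \<tau> \<plusminus> T - 2 in
  \<open>gen\<close> belong to the auxiliary rectangles of \<open>horizontal_bound\<close>.\<close>

lemma strip_bounds:
  assumes A: "\<And>s. Re s \<ge> A \<Longrightarrow> f s \<noteq> \<xi> \<and> Re (Q s) > 0 \<and> cmod (Ln (Q s)) \<le> \<delta>"
    and s: "0 < \<sigma>" "\<sigma> < A" and \<delta>: "\<delta> > 0" "pi * \<delta> \<le> 2 * L" and T: "T \<ge> 1" and \<kappa>: "\<kappa> = pi / (2 * T)"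
    and gen: "\<And>p. p \<in> all_zeros \<Longrightarrow> Re p \<noteq> \<sigma> \<and> Im p \<noteq> \<tau> - T \<and> Im p \<noteq> \<tau> - T - 2 \<and> Im p \<noteq> \<tau> + T \<and> Im p \<noteq> \<tau> + T - 2"
    and C: "C = 2 / pi * ((2 * L + pi * \<delta>) * cosh (pi / 2 * A))"
  defines "Z \<equiv> 2 * pi * zsum T \<sigma> \<tau> + \<kappa> * integral {\<tau> - T..\<tau> + T} (\<lambda>t. gl \<sigma> t * cos (\<kappa> * (t - \<tau>)))"
  shows "Z \<le> (2 * L + pi * \<delta>) * cosh (\<kappa> * A)" "Z \<ge> 2 * L - pi * \<delta> - 4 * \<kappa>\<^sup>2 / pi * C"
proof -
  have k0: "\<kappa> > 0" "\<kappa> \<le> pi / 2" using T unfolding \<kappa> by (auto simp: divide_simps)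
  define h where "h = (\<lambda>y. integral {\<sigma>..A} (\<lambda>x. gl x y * sinh (\<kappa> * (x - \<sigma>))))"
  have main: "\<bar>Z + \<kappa> * (h (\<tau> - T) + h (\<tau> + T)) - 2 * L * cosh (\<kappa> * (A - \<sigma>))\<bar> \<le> pi * \<delta> * cosh (\<kappa> * (A - \<sigma>))"
    using rectangle_green[OF A s _ \<kappa>, of \<tau>] T gen unfolding h_def Z_def by (simp add: algebra_simps)
  have h0: "h y \<ge> 0" if "\<And>p. p \<in> all_zeros \<Longrightarrow> Im p \<noteq> y" for y
    unfolding h_def by (rule integral_gl_horizontal_nonneg) (use that s k0 in auto)
  have hC: "h y \<le> 2 * \<kappa> / pi * C" if "\<And>p. p \<in> all_zeros \<Longrightarrow> Im p \<noteq> y \<and> Im p \<noteq> y - 2" for y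
  proof -
    have "h y \<le> integral {\<sigma>..A} (\<lambda>x. (2 * \<kappa> / pi) * (gl x y * sinh (pi / 2 * (x - \<sigma>))))"
      unfolding h_def
    proof (rule integral_le)
      show "(\<lambda>x. gl x y * sinh (\<kappa> * (x - \<sigma>))) integrable_on {\<sigma>..A}"
        by (rule integral_gl_horizontal_nonneg) (use that s k0 in auto)
      show "(\<lambda>x. (2 * \<kappa> / pi) * (gl x y * sinh (pi / 2 * (x - \<sigma>)))) integrable_on {\<sigma>..A}"
        by (intro integrable_on_mult_right integral_gl_horizontal_nonneg) (use that s in auto)
      fix x assume x: "x \<in> {\<sigma>..A}"
      have "sinh ((2 * \<kappa> / pi) * (pi / 2 * (x - \<sigma>))) \<le> (2 * \<kappa> / pi) * sinh (pi / 2 * (x - \<sigma>))"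
        using x k0 by (intro sinh_scale_le) (auto simp: field_simps)
      moreover have "(2 * \<kappa> / pi) * (pi / 2 * (x - \<sigma>)) = \<kappa> * (x - \<sigma>)" by simp
      ultimately have "gl x y * sinh (\<kappa> * (x - \<sigma>)) \<le> gl x y * ((2 * \<kappa> / pi) * sinh (pi / 2 * (x - \<sigma>)))"
        using gl_nonneg[of x y] x s by (intro mult_left_mono) auto
      then show "gl x y * sinh (\<kappa> * (x - \<sigma>)) \<le> (2 * \<kappa> / pi) * (gl x y * sinh (pi / 2 * (x - \<sigma>)))"
        by (simp only: mult_ac)
    qed
    also have "\<dots> = 2 * \<kappa> / pi * integral {\<sigma>..A} (\<lambda>x. gl x y * sinh (pi / 2 * (x - \<sigma>)))" by (rule integral_mult_right)
    also have "\<dots> \<le> 2 * \<kappa> / pi * C"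
      unfolding C by (intro mult_left_mono horizontal_bound[OF A s \<delta>(1)]) (use gen that k0 in auto)
    finally show ?thesis .
  qed
  have "Z \<le> (2 * L + pi * \<delta>) * cosh (\<kappa> * (A - \<sigma>))"
  proof -
    have "\<kappa> * (h (\<tau> - T) + h (\<tau> + T)) \<ge> 0" using h0 gen k0 by simp
    then show ?thesis using main by (simp add: distrib_right)
  qed
  also have "\<dots> \<le> (2 * L + pi * \<delta>) * cosh (\<kappa> * A)"
    using L_pos \<delta> s k0 by (intro mult_left_mono cosh_real_nonneg_le_iff[THEN iffD2]) auto
  finally show "Z \<le> (2 * L + pi * \<delta>) * cosh (\<kappa> * A)" .
  have "h (\<tau> - T) + h (\<tau> + T) \<le> 2 * (2 * \<kappa> / pi * C)" proof -
    have "h (\<tau> - T) \<le> 2 * \<kappa> / pi * C" "h (\<tau> + T) \<le> 2 * \<kappa> / pi * C"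
      by (rule hC; use gen in simp)+
    from add_mono[OF this] show ?thesis by (simp only: mult_2)
  qed
  then have "\<kappa> * (h (\<tau> - T) + h (\<tau> + T)) \<le> \<kappa> * (2 * (2 * \<kappa> / pi * C))"
    by (rule mult_left_mono) (use k0 in auto)
  also have "\<dots> = 4 * \<kappa>\<^sup>2 / pi * C" by (simp add: power2_eq_square)
  finally have "Z \<ge> (2 * L - pi * \<delta>) * cosh (\<kappa> * (A - \<sigma>)) - 4 * \<kappa>\<^sup>2 / pi * C" using main by (simp add: left_diff_distrib)
  moreover have "(2 * L - pi * \<delta>) * 1 \<le> (2 * L - pi * \<delta>) * cosh (\<kappa> * (A - \<sigma>))"
    using \<delta> by (intro mult_left_mono cosh_real_ge_1) auto
  ultimately show "Z \<ge> 2 * L - pi * \<delta> - 4 * \<kappa>\<^sup>2 / pi * C" by simp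
qed

end

text \<open>The cosine weight of a rectangle extended by 0. Clamping the argument, instead of a case
  distinction, makes continuity immediate, since the cosine vanishes at both clamped ends.\<close>

definition cos_bump :: "real \<Rightarrow> real \<Rightarrow> real" where
  "cos_bump T x = cos (pi / (2 * T) * max (- T) (min T x))"

lemma continuous_on_cos_bump [continuous_intros]:
  fixes g :: "'a::t2_space \<Rightarrow> real"
  assumes "continuous_on S g" shows "continuous_on S (\<lambda>x. cos_bump T (g x))"
  using assms unfolding cos_bump_def
  by (intro continuous_on_cos continuous_on_mult continuous_on_const continuous_on_max continuous_on_min)

lemma cos_bump_inside: "\<bar>x\<bar> \<le> T \<Longrightarrow> cos_bump T x = cos (pi / (2 * T) * x)"
  by (auto simp: cos_bump_def max_def min_def abs_le_iff)

lemma cos_bump_outside: assumes "T > 0" "\<bar>x\<bar> \<ge> T" shows "cos_bump T x = 0"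
proof -
  have "max (- T) (min T x) = T \<or> max (- T) (min T x) = - T" using assms by (cases "x < 0") auto
  moreover have "pi / (2 * T) * T = pi / 2" "pi / (2 * T) * - T = - (pi / 2)" using assms by simp_all
  ultimately show ?thesis unfolding cos_bump_def by (metis cos_minus cos_pi_half)
qed

lemma cos_bump_nonneg: assumes "T > 0" shows "cos_bump T x \<ge> 0"
proof -
  have "\<bar>pi / (2 * T) * max (- T) (min T x)\<bar> \<le> pi / (2 * T) * T"
    using assms unfolding abs_mult by (intro mult_mono) auto
  then have "\<bar>pi / (2 * T) * max (- T) (min T x)\<bar> \<le> pi / 2" using assms by simp
  then show ?thesis unfolding cos_bump_def by (intro cos_ge_zero) (simp_all only: abs_le_iff, simp_all)
qed

lemma cos_bump_even: "T > 0 \<Longrightarrow> cos_bump T (- x) = cos_bump T x"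
  by (cases "\<bar>x\<bar> \<le> T") (auto simp: cos_bump_inside cos_bump_outside)

lemma integral_cos_bump_superset:
  assumes "T > 0" "a \<le> - T" "T \<le> b" shows "(cos_bump T has_integral 4 * T / pi) {a..b}"
proof (rule has_integral_on_superset)
  have "((\<lambda>x. cos (pi / (2 * T) * x)) has_integral 2 * T / pi * sin (pi / (2 * T) * T) - 2 * T / pi * sin (pi / (2 * T) * - T)) {- T..T}"
    by (rule fundamental_theorem_of_calculus)
      (use assms in \<open>auto intro!: derivative_eq_intros simp flip: has_real_derivative_iff_has_vector_derivative\<close>)
  moreover have "pi / (2 * T) * T = pi / 2" "pi / (2 * T) * - T = - (pi / 2)" using assms by simp_all
  ultimately have "((\<lambda>x. cos (pi / (2 * T) * x)) has_integral 4 * T / pi) {- T..T}"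
    by (simp only: sin_minus sin_pi_half) simp
  then show "(cos_bump T has_integral 4 * T / pi) {- T..T}"
    by (rule has_integral_eq[rotated]) (subst cos_bump_inside, auto simp: abs_le_iff)
  show "cos_bump T x = 0" if "x \<notin> {- T..T}" for x using that assms by (intro cos_bump_outside) auto
qed (use assms in auto)

lemma integral_cos_bump_bounds:
  assumes "T > 0" shows "0 \<le> integral {a..b} (cos_bump T)" "integral {a..b} (cos_bump T) \<le> 4 * T / pi"
proof -
  have i: "cos_bump T integrable_on {u..v}" for u v
    by (rule integrable_continuous_interval) (use continuous_on_cos_bump[of "{u..v}" "\<lambda>x. x"] in auto)
  show "0 \<le> integral {a..b} (cos_bump T)" by (rule integral_nonneg[OF i]) (use assms cos_bump_nonneg in auto)
  have "integral {a..b} (cos_bump T) \<le> integral {min a (- T)..max b T} (cos_bump T)"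
    by (rule integral_subset_le[OF _ i i]) (use assms cos_bump_nonneg in auto)
  also have "\<dots> = 4 * T / pi" by (rule integral_unique[OF integral_cos_bump_superset]) (use assms in auto)
  finally show "integral {a..b} (cos_bump T) \<le> 4 * T / pi" .
qed

text \<open>Total weight that height t receives when the centre \<tau> runs through [-Y, Y]: the
  full mass 4 T / \<pi> for |t| <= Y - T, and between 0 and that in general.\<close>

definition bump_mass :: "real \<Rightarrow> real \<Rightarrow> real \<Rightarrow> real" where
  "bump_mass T Y t = integral {- Y..Y} (\<lambda>\<tau>. cos_bump T (t - \<tau>))"

lemma bump_mass_eq: "T > 0 \<Longrightarrow> bump_mass T Y t = integral {- Y - t..Y - t} (cos_bump T)"
proof -
  assume "T > 0"
  have "bump_mass T Y t = integral {(- Y - t) - (- t)..(Y - t) - (- t)} (\<lambda>\<tau>. cos_bump T (\<tau> + (- t)))"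
    unfolding bump_mass_def using cos_bump_even[OF \<open>T > 0\<close>, of "t - _"] by simp
  also have "\<dots> = integral {- Y - t..Y - t} (cos_bump T)" by (rule integral_shift_real_ivl)
  finally show ?thesis .
qed

lemma bump_mass_bounds:
  assumes "T > 0"
  shows "0 \<le> bump_mass T Y t" "bump_mass T Y t \<le> 4 * T / pi"
    and "\<bar>t\<bar> \<le> Y - T \<Longrightarrow> bump_mass T Y t = 4 * T / pi"
  using integral_cos_bump_bounds[OF assms] integral_unique[OF integral_cos_bump_superset[OF assms, of "- Y - t" "Y - t"]]
  by (auto simp: bump_mass_eq[OF assms] abs_le_iff)

text \<open>The rectangle estimates fail for the countably many centres whose horizontal sides meet
  a zero; the average over all centres does not see them.\<close>

lemma integral_countable_exception_bounds:
  fixes Z :: "real \<Rightarrow> real"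
  assumes "continuous_on {a..b} Z" "a \<le> b" "countable N"
    and lo: "\<And>x. x \<in> {a..b} - N \<Longrightarrow> l \<le> Z x" and up: "\<And>x. x \<in> {a..b} - N \<Longrightarrow> Z x \<le> u"
  shows "(b - a) * l \<le> integral {a..b} Z" "integral {a..b} Z \<le> (b - a) * u"
proof -
  have Z: "(Z has_integral integral {a..b} Z) {a..b}"
    using assms(1) integrable_continuous_interval integrable_integral by blast
  have "negligible (\<Union>x\<in>N. {x})" using assms(3) by (intro negligible_countable_Union) auto
  then have N: "negligible N" by simp
  have "((\<lambda>x. if x \<in> N then u else Z x) has_integral integral {a..b} Z) {a..b}"
    by (rule has_integral_spike[OF N _ Z]) auto
  from has_integral_le[OF this has_integral_const_real[of u]] assms(2) up
  show "integral {a..b} Z \<le> (b - a) * u" by auto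
  have "((\<lambda>x. if x \<in> N then l else Z x) has_integral integral {a..b} Z) {a..b}"
    by (rule has_integral_spike[OF N _ Z]) auto
  from has_integral_le[OF has_integral_const_real[of l] this] assms(2) lo
  show "(b - a) * l \<le> integral {a..b} Z" by auto
qed

section \<open>Averaging over centres and the asymptotics of the zero sums\<close>

context half_plane_value begin

text \<open>Fubini in the centre \<tau>: the cosine, which favours heights near \<tau>, is replaced
  by \<open>bump_mass\<close>, which is constant away from the ends of the range.\<close>

lemma averaged_bounds:
  assumes T: "T > 0" and \<kappa>: "\<kappa> = pi / (2 * T)" and s: "\<sigma> > 0" and Y: "Y > 0"
    and gen: "\<And>p. p \<in> all_zeros \<Longrightarrow> Re p \<noteq> \<sigma>" and N: "countable N"
    and lo: "\<And>\<tau>. \<tau> \<notin> N \<Longrightarrow> lo \<le> 2 * pi * zsum T \<sigma> \<tau> + \<kappa> * integral {\<tau> - T..\<tau> + T} (\<lambda>t. gl \<sigma> t * cos (\<kappa> * (t - \<tau>)))"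
    and up: "\<And>\<tau>. \<tau> \<notin> N \<Longrightarrow> 2 * pi * zsum T \<sigma> \<tau> + \<kappa> * integral {\<tau> - T..\<tau> + T} (\<lambda>t. gl \<sigma> t * cos (\<kappa> * (t - \<tau>))) \<le> up"
  defines "I \<equiv> 2 * pi * (\<Sum>p\<in>zeros \<sigma> (Y + T). sinh (\<kappa> * (Re p - \<sigma>)) * mult p * bump_mass T Y (Im p))
      + \<kappa> * integral {- (Y + T)..Y + T} (\<lambda>t. gl \<sigma> t * bump_mass T Y t)"
  shows "2 * Y * lo \<le> I" "I \<le> 2 * Y * up"
proof -
  define P where "P = zeros \<sigma> (Y + T)"
  have finP: "finite P" using finite_zeros s P_def by simp
  \<comment> \<open>With \<open>cos_bump\<close> and a fixed range of summation and integration, Z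
    is continuous in \<tau>, and it agrees with the original expression for \<tau> in
    [-Y, Y].\<close>
  define Z where "Z = (\<lambda>\<tau>. 2 * pi * (\<Sum>p\<in>P. sinh (\<kappa> * (Re p - \<sigma>)) * mult p * cos_bump T (Im p - \<tau>))
      + \<kappa> * integral {- (Y + T)..Y + T} (\<lambda>t. gl \<sigma> t * cos_bump T (t - \<tau>)))"
  have cg: "continuous_on S (gl \<sigma>)" for S by (rule continuous_on_gl_vertical) (use s gen in auto)
  have Zeq: "Z \<tau> = 2 * pi * zsum T \<sigma> \<tau> + \<kappa> * integral {\<tau> - T..\<tau> + T} (\<lambda>t. gl \<sigma> t * cos (\<kappa> * (t - \<tau>)))"
    if \<tau>: "\<tau> \<in> {- Y..Y}" for \<tau>
  proof -
    have "(\<Sum>p\<in>P. sinh (\<kappa> * (Re p - \<sigma>)) * mult p * cos_bump T (Im p - \<tau>)) = zsum T \<sigma> \<tau>"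
      unfolding zsum_def
    proof (rule sum.mono_neutral_cong_right[OF finP])
      show "{p. \<sigma> < Re p \<and> \<bar>Im p - \<tau>\<bar> < T \<and> f p = \<xi>} \<subseteq> P"
        using \<tau> by (auto simp: P_def zeros_def)
      show "\<forall>p\<in>P - {p. \<sigma> < Re p \<and> \<bar>Im p - \<tau>\<bar> < T \<and> f p = \<xi>}. sinh (\<kappa> * (Re p - \<sigma>)) * mult p * cos_bump T (Im p - \<tau>) = 0"
      proof
        fix p assume "p \<in> P - {p. \<sigma> < Re p \<and> \<bar>Im p - \<tau>\<bar> < T \<and> f p = \<xi>}"
        then have "\<bar>Im p - \<tau>\<bar> \<ge> T" by (auto simp: P_def zeros_def)
        then show "sinh (\<kappa> * (Re p - \<sigma>)) * mult p * cos_bump T (Im p - \<tau>) = 0"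
          using cos_bump_outside[OF T] by simp
      qed
      show "sinh (\<kappa> * (Re p - \<sigma>)) * mult p * cos_bump T (Im p - \<tau>) =
         sinh (pi / (2 * T) * (Re p - \<sigma>)) * cos (pi / (2 * T) * (Im p - \<tau>)) * mult p"
        if "p \<in> {p. \<sigma> < Re p \<and> \<bar>Im p - \<tau>\<bar> < T \<and> f p = \<xi>}" for p
        using that unfolding \<kappa> by (subst cos_bump_inside) auto
    qed
    moreover have "integral {- (Y + T)..Y + T} (\<lambda>t. gl \<sigma> t * cos_bump T (t - \<tau>))
       = integral {\<tau> - T..\<tau> + T} (\<lambda>t. gl \<sigma> t * cos (\<kappa> * (t - \<tau>)))"
    proof (rule integral_unique, rule has_integral_on_superset)
      have "((\<lambda>t. gl \<sigma> t * cos (\<kappa> * (t - \<tau>))) has_integral integral {\<tau> - T..\<tau> + T} (\<lambda>t. gl \<sigma> t * cos (\<kappa> * (t - \<tau>)))) {\<tau> - T..\<tau> + T}"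
        by (intro integrable_integral integrable_continuous_interval continuous_intros cg)
      then show "((\<lambda>t. gl \<sigma> t * cos_bump T (t - \<tau>)) has_integral integral {\<tau> - T..\<tau> + T} (\<lambda>t. gl \<sigma> t * cos (\<kappa> * (t - \<tau>)))) {\<tau> - T..\<tau> + T}"
        by (rule has_integral_eq[rotated]) (subst cos_bump_inside, auto simp: \<kappa>)
      show "gl \<sigma> t * cos_bump T (t - \<tau>) = 0" if "t \<notin> {\<tau> - T..\<tau> + T}" for t
        using that T by (subst cos_bump_outside) auto
      show "{\<tau> - T..\<tau> + T} \<subseteq> {- (Y + T)..Y + T}" using \<tau> by auto
    qed
    ultimately show ?thesis by (simp add: Z_def)
  qed
  have pc: "continuous_on (cbox (- Y, - (Y + T)) (Y, Y + T)) (\<lambda>(\<tau>, t). gl \<sigma> t * cos_bump T (t - \<tau>))"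
    unfolding case_prod_unfold
    by (intro continuous_intros continuous_on_compose2[OF cg[of UNIV]]) auto
  have cZ: "continuous_on {- Y..Y} Z"
  proof -
    have "continuous_on {- Y..Y} (\<lambda>\<tau>. integral (cbox (- (Y + T)) (Y + T)) (\<lambda>t. gl \<sigma> t * cos_bump T (t - \<tau>)))"
      by (rule integral_continuous_on_param)
        (rule continuous_on_subset[OF pc], auto)
    then show ?thesis unfolding Z_def by (intro continuous_intros) auto
  qed
  have "integral {- Y..Y} Z = I"
  proof -
    have "integral {- Y..Y} (\<lambda>\<tau>. integral {- (Y + T)..Y + T} (\<lambda>t. gl \<sigma> t * cos_bump T (t - \<tau>)))
       = integral {- (Y + T)..Y + T} (\<lambda>t. gl \<sigma> t * bump_mass T Y t)"
      using integral_swap_continuous[OF pc] unfolding bump_mass_def by simp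
    moreover have "integral {- Y..Y} (\<lambda>\<tau>. \<Sum>p\<in>P. sinh (\<kappa> * (Re p - \<sigma>)) * mult p * cos_bump T (Im p - \<tau>))
      = (\<Sum>p\<in>P. sinh (\<kappa> * (Re p - \<sigma>)) * mult p * bump_mass T Y (Im p))"
      unfolding bump_mass_def
      by (subst integral_sum[OF finP])
        (auto intro!: integrable_continuous_interval continuous_intros)
    moreover have "integral {- Y..Y} Z = 2 * pi * integral {- Y..Y} (\<lambda>\<tau>. \<Sum>p\<in>P. sinh (\<kappa> * (Re p - \<sigma>)) * mult p * cos_bump T (Im p - \<tau>))
       + \<kappa> * integral {- Y..Y} (\<lambda>\<tau>. integral {- (Y + T)..Y + T} (\<lambda>t. gl \<sigma> t * cos_bump T (t - \<tau>)))"
    proof -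
      have "(\<lambda>\<tau>. 2 * pi * (\<Sum>p\<in>P. sinh (\<kappa> * (Re p - \<sigma>)) * mult p * cos_bump T (Im p - \<tau>))) integrable_on {- Y..Y}"
        by (intro integrable_continuous_interval continuous_intros)
      moreover have "(\<lambda>\<tau>. \<kappa> * integral {- (Y + T)..Y + T} (\<lambda>t. gl \<sigma> t * cos_bump T (t - \<tau>))) integrable_on {- Y..Y}"
      proof -
        have "continuous_on {- Y..Y} (\<lambda>\<tau>. integral (cbox (- (Y + T)) (Y + T)) (\<lambda>t. gl \<sigma> t * cos_bump T (t - \<tau>)))"
          by (rule integral_continuous_on_param)
            (rule continuous_on_subset[OF pc], auto)
        then show ?thesis by (intro integrable_continuous_interval continuous_intros) auto
      qed
      ultimately show ?thesis unfolding Z_def by (simp only: integral_add integral_mult_right)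
    qed
    ultimately show ?thesis unfolding I_def P_def by simp
  qed
  with integral_countable_exception_bounds[OF cZ _ N, of lo up] lo up Zeq Y
  show "2 * Y * lo \<le> I" "I \<le> 2 * Y * up" by auto
qed

text \<open>Divided by 2 X this is \<open>M_trunc\<close> plus the mean of the Green function on the
  line Re s = \<sigma>.\<close>

definition W :: "real \<Rightarrow> real \<Rightarrow> real" where
  "W \<sigma> X = 2 * pi * (\<Sum>p\<in>zeros \<sigma> X. (Re p - \<sigma>) * mult p) + integral {- X..X} (gl \<sigma>)"

text \<open>The upper bound lets the centres range over [-(X+T), X+T], so that every height up to X
  receives full mass. The lower bound uses [-(X-T), X-T], so that only heights up to X are touched.
  On the zeros, u <= sinh u <= u cosh (\<kappa> A) with u = \<kappa> (Re p - \<sigma>) exchanges the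
  sinh weight for the linear one.\<close>

lemma W_bounds:
  assumes A: "\<And>s. Re s \<ge> A \<Longrightarrow> f s \<noteq> \<xi> \<and> Re (Q s) > 0 \<and> cmod (Ln (Q s)) \<le> \<delta>"
    and s: "0 < \<sigma>" "\<sigma> < A" and \<delta>: "\<delta> > 0" "pi * \<delta> \<le> 2 * L" and T: "T \<ge> 1" and \<kappa>: "\<kappa> = pi / (2 * T)"
    and gen: "\<And>p. p \<in> all_zeros \<Longrightarrow> Re p \<noteq> \<sigma>"
    and C: "C = 2 / pi * ((2 * L + pi * \<delta>) * cosh (pi / 2 * A))" and X: "X > T"
  shows "W \<sigma> X \<le> (X + T) * ((2 * L + pi * \<delta>) * cosh (\<kappa> * A))"
    and "(X - T) * (2 * L - pi * \<delta> - 4 * \<kappa>\<^sup>2 / pi * C) \<le> cosh (\<kappa> * A) * W \<sigma> X"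
proof -
  have k0: "\<kappa> > 0" and kT: "4 * T / pi = 2 / \<kappa>" and T0: "T > 0" using T unfolding \<kappa> by auto
  define lo up where "lo = 2 * L - pi * \<delta> - 4 * \<kappa>\<^sup>2 / pi * C" and "up = (2 * L + pi * \<delta>) * cosh (\<kappa> * A)"
  \<comment> \<open>The centres for which a zero lies at one of the four heights \<tau> \<plusminus>
    T and \<tau> \<plusminus> T - 2.\<close>
  define N where "N = (\<Union>p\<in>all_zeros. {Im p + T, Im p + T + 2, Im p - T, Im p - T + 2})"
  have N: "countable N" unfolding N_def using countable_all_zeros by (intro countable_UN) auto
  have Nb: "lo \<le> 2 * pi * zsum T \<sigma> \<tau> + \<kappa> * integral {\<tau> - T..\<tau> + T} (\<lambda>t. gl \<sigma> t * cos (\<kappa> * (t - \<tau>)))"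
    "2 * pi * zsum T \<sigma> \<tau> + \<kappa> * integral {\<tau> - T..\<tau> + T} (\<lambda>t. gl \<sigma> t * cos (\<kappa> * (t - \<tau>))) \<le> up"
    if "\<tau> \<notin> N" for \<tau>
  proof -
    have g: "Re p \<noteq> \<sigma> \<and> Im p \<noteq> \<tau> - T \<and> Im p \<noteq> \<tau> - T - 2 \<and> Im p \<noteq> \<tau> + T \<and> Im p \<noteq> \<tau> + T - 2"
      if p: "p \<in> all_zeros" for p
      using \<open>\<tau> \<notin> N\<close> p gen[OF p] by (auto simp: N_def dest!: bspec[OF _ p])
    show "lo \<le> 2 * pi * zsum T \<sigma> \<tau> + \<kappa> * integral {\<tau> - T..\<tau> + T} (\<lambda>t. gl \<sigma> t * cos (\<kappa> * (t - \<tau>)))"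
      "2 * pi * zsum T \<sigma> \<tau> + \<kappa> * integral {\<tau> - T..\<tau> + T} (\<lambda>t. gl \<sigma> t * cos (\<kappa> * (t - \<tau>))) \<le> up"
      unfolding lo_def up_def using strip_bounds[OF A s \<delta> T \<kappa> g C] by auto
  qed
  have cg: "continuous_on S (gl \<sigma>)" for S by (rule continuous_on_gl_vertical) (use s gen in auto)
  have gi: "gl \<sigma> integrable_on {a..b}" for a b by (rule integrable_continuous_interval[OF cg])
  have bmc: "continuous_on S (bump_mass T Y)" for S Y
  proof -
    have "continuous_on UNIV (\<lambda>t. integral (cbox (- Y) Y) (\<lambda>\<tau>. cos_bump T (t - \<tau>)))"
      by (rule integral_continuous_on_param) (auto simp: case_prod_unfold intro!: continuous_intros)
    then show ?thesis unfolding bump_mass_def using continuous_on_subset by auto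
  qed
  have gbi: "(\<lambda>t. gl \<sigma> t * bump_mass T Y t) integrable_on {a..b}" for a b Y
    by (intro integrable_continuous_interval continuous_intros cg bmc)
  have sg: "sinh (\<kappa> * (Re p - \<sigma>)) * mult p \<ge> 0" if "p \<in> zeros \<sigma> Y" for p Y
    using that s k0 mult_ge_0[of p] by (auto simp: zeros_def)
  define S where "S = (\<Sum>p\<in>zeros \<sigma> X. sinh (\<kappa> * (Re p - \<sigma>)) * mult p)"
  define G where "G = integral {- X..X} (gl \<sigma>)"
  have G0: "G \<ge> 0" unfolding G_def by (rule integral_nonneg[OF gi]) (use gl_nonneg s in auto)
  have M: "0 \<le> bump_mass T Y t" "bump_mass T Y t \<le> 2 / \<kappa>" "\<bar>t\<bar> \<le> Y - T \<Longrightarrow> bump_mass T Y t = 2 / \<kappa>" for Y t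
    using bump_mass_bounds(1,2)[OF T0, of Y t] bump_mass_bounds(3)[OF T0, of t Y] unfolding kT by auto
  have w1: "\<kappa> * (\<Sum>p\<in>zeros \<sigma> X. (Re p - \<sigma>) * mult p) \<le> S"
    unfolding S_def sum_distrib_left
  proof (rule sum_mono)
    fix p assume p: "p \<in> zeros \<sigma> X"
    then have "\<kappa> * (Re p - \<sigma>) \<le> sinh (\<kappa> * (Re p - \<sigma>))" using k0 by (intro sinh_bounds) (auto simp: zeros_def)
    moreover have "mult p \<ge> 0" using p s mult_ge_0[of p] by (auto simp: zeros_def)
    ultimately have "\<kappa> * (Re p - \<sigma>) * mult p \<le> sinh (\<kappa> * (Re p - \<sigma>)) * mult p" by (rule mult_right_mono)
    then show "\<kappa> * ((Re p - \<sigma>) * mult p) \<le> sinh (\<kappa> * (Re p - \<sigma>)) * mult p" by (simp only: mult.assoc)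
  qed
  have w2: "S \<le> cosh (\<kappa> * A) * (\<kappa> * (\<Sum>p\<in>zeros \<sigma> X. (Re p - \<sigma>) * mult p))"
    unfolding S_def sum_distrib_left
  proof (rule sum_mono)
    fix p assume p: "p \<in> zeros \<sigma> X"
    have pA: "Re p < A" using A[of p] p by (force simp: zeros_def)
    have "sinh (\<kappa> * (Re p - \<sigma>)) \<le> \<kappa> * (Re p - \<sigma>) * cosh (\<kappa> * (Re p - \<sigma>))"
      using k0 p by (intro sinh_bounds) (auto simp: zeros_def)
    also have "\<dots> \<le> \<kappa> * (Re p - \<sigma>) * cosh (\<kappa> * A)"
      using k0 p s pA by (intro mult_left_mono cosh_real_nonneg_le_iff[THEN iffD2]) (auto simp: zeros_def)
    finally have "sinh (\<kappa> * (Re p - \<sigma>)) * mult p \<le> \<kappa> * (Re p - \<sigma>) * cosh (\<kappa> * A) * mult p"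
      using p s mult_ge_0[of p] by (intro mult_right_mono) (auto simp: zeros_def)
    then show "sinh (\<kappa> * (Re p - \<sigma>)) * mult p \<le> cosh (\<kappa> * A) * (\<kappa> * ((Re p - \<sigma>) * mult p))"
      by (simp only: mult_ac)
  qed
  have W: "\<kappa> * W \<sigma> X = 2 * pi * (\<kappa> * (\<Sum>p\<in>zeros \<sigma> X. (Re p - \<sigma>) * mult p)) + \<kappa> * G"
    unfolding W_def G_def by (simp add: algebra_simps)
  have half1: "\<kappa> / 2 * (2 / \<kappa> * x) = x" and half2: "\<kappa> / 2 * (2 * x * y) = \<kappa> * (x * y)" for x y
    using k0 by simp_all
  have "2 / \<kappa> * (2 * pi * S + \<kappa> * G) \<le> 2 * pi * (\<Sum>p\<in>zeros \<sigma> ((X + T) + T). sinh (\<kappa> * (Re p - \<sigma>)) * mult p * bump_mass T (X + T) (Im p))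
      + \<kappa> * integral {- ((X + T) + T)..(X + T) + T} (\<lambda>t. gl \<sigma> t * bump_mass T (X + T) t)"
  proof -
    have "S * (2 / \<kappa>) = (\<Sum>p\<in>zeros \<sigma> X. sinh (\<kappa> * (Re p - \<sigma>)) * mult p * bump_mass T (X + T) (Im p))"
      unfolding S_def sum_distrib_right by (rule sum.cong) (use M(3) in \<open>auto simp: zeros_def\<close>)
    also have "\<dots> \<le> (\<Sum>p\<in>zeros \<sigma> ((X + T) + T). sinh (\<kappa> * (Re p - \<sigma>)) * mult p * bump_mass T (X + T) (Im p))"
    proof (rule sum_mono2)
      show "finite (zeros \<sigma> ((X + T) + T))" by (rule finite_zeros) (rule s)
      show "zeros \<sigma> X \<subseteq> zeros \<sigma> ((X + T) + T)" using T0 by (auto simp: zeros_def)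
      show "0 \<le> sinh (\<kappa> * (Re p - \<sigma>)) * mult p * bump_mass T (X + T) (Im p)"
        if "p \<in> zeros \<sigma> ((X + T) + T) - zeros \<sigma> X" for p
        by (rule mult_nonneg_nonneg[OF sg M(1)]) (use that in auto)
    qed
    finally have 1: "S * (2 / \<kappa>) \<le> \<dots>" .
    have "G * (2 / \<kappa>) = integral {- X..X} (\<lambda>t. gl \<sigma> t * bump_mass T (X + T) t)"
      unfolding G_def integral_mult_left[symmetric] by (rule integral_cong) (use M(3) in auto)
    also have "\<dots> \<le> integral {- ((X + T) + T)..(X + T) + T} (\<lambda>t. gl \<sigma> t * bump_mass T (X + T) t)"
      by (rule integral_subset_le[OF _ gbi gbi]) (use T0 gl_nonneg s M(1) in auto)
    finally have 2: "G * (2 / \<kappa>) \<le> \<dots>" .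
    have "2 / \<kappa> * (2 * pi * S + \<kappa> * G) = 2 * pi * (S * (2 / \<kappa>)) + \<kappa> * (G * (2 / \<kappa>))"
      by (simp only: algebra_simps)
    also have "\<dots> \<le> 2 * pi * (\<Sum>p\<in>zeros \<sigma> ((X + T) + T). sinh (\<kappa> * (Re p - \<sigma>)) * mult p * bump_mass T (X + T) (Im p))
      + \<kappa> * integral {- ((X + T) + T)..(X + T) + T} (\<lambda>t. gl \<sigma> t * bump_mass T (X + T) t)"
      by (intro add_mono mult_left_mono 1 2) (use k0 in auto)
    finally show ?thesis .
  qed
  also have "\<dots> \<le> 2 * (X + T) * up"
    by (rule averaged_bounds(2)[OF T0 \<kappa> s(1) _ gen N Nb]) (use X T0 in auto)
  finally have "\<kappa> / 2 * (2 / \<kappa> * (2 * pi * S + \<kappa> * G)) \<le> \<kappa> / 2 * (2 * (X + T) * up)"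
    by (rule mult_left_mono) (use k0 in simp)
  then have "2 * pi * S + \<kappa> * G \<le> \<kappa> * ((X + T) * up)" unfolding half1 half2 .
  moreover have "\<kappa> * W \<sigma> X \<le> 2 * pi * S + \<kappa> * G" unfolding W using w1 by simp
  ultimately have "\<kappa> * W \<sigma> X \<le> \<kappa> * ((X + T) * up)" by linarith
  then show "W \<sigma> X \<le> (X + T) * ((2 * L + pi * \<delta>) * cosh (\<kappa> * A))"
    unfolding up_def[symmetric] using k0 by simp
  have XT: "(X - T) + T = X" by simp
  have "2 * (X - T) * lo \<le> 2 * pi * (\<Sum>p\<in>zeros \<sigma> ((X - T) + T). sinh (\<kappa> * (Re p - \<sigma>)) * mult p * bump_mass T (X - T) (Im p))
      + \<kappa> * integral {- ((X - T) + T)..(X - T) + T} (\<lambda>t. gl \<sigma> t * bump_mass T (X - T) t)"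
    by (rule averaged_bounds(1)[OF T0 \<kappa> s(1) _ gen N Nb]) (use X T0 in auto)
  also have "\<dots> \<le> 2 * pi * (S * (2 / \<kappa>)) + \<kappa> * (G * (2 / \<kappa>))"
    unfolding XT S_def G_def sum_distrib_right integral_mult_left[symmetric]
  proof (intro add_mono mult_left_mono sum_mono integral_le gbi)
    show "(\<lambda>x. gl \<sigma> x * (2 / \<kappa>)) integrable_on {- X..X}" by (intro integrable_on_mult_left gi)
  qed (use M(2) sg gl_nonneg s k0 in auto)
  also have "\<dots> = 2 / \<kappa> * (2 * pi * S + \<kappa> * G)"
    by (simp only: algebra_simps)
  finally have "\<kappa> / 2 * (2 * (X - T) * lo) \<le> \<kappa> / 2 * (2 / \<kappa> * (2 * pi * S + \<kappa> * G))"
    by (rule mult_left_mono) (use k0 in simp)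
  then have "\<kappa> * ((X - T) * lo) \<le> 2 * pi * S + \<kappa> * G" unfolding half1 half2 .
  also have "\<dots> \<le> 2 * pi * (cosh (\<kappa> * A) * (\<kappa> * (\<Sum>p\<in>zeros \<sigma> X. (Re p - \<sigma>) * mult p))) + cosh (\<kappa> * A) * (\<kappa> * G)"
  proof (intro add_mono mult_left_mono w2)
    have "1 * (\<kappa> * G) \<le> cosh (\<kappa> * A) * (\<kappa> * G)"
      by (rule mult_right_mono) (use k0 G0 cosh_real_ge_1 in auto)
    then show "\<kappa> * G \<le> cosh (\<kappa> * A) * (\<kappa> * G)" by simp
  qed auto
  also have "\<dots> = cosh (\<kappa> * A) * (\<kappa> * W \<sigma> X)" unfolding W by (simp only: algebra_simps)
  also have "\<dots> = \<kappa> * (cosh (\<kappa> * A) * W \<sigma> X)" by (simp only: mult_ac)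
  finally show "(X - T) * (2 * L - pi * \<delta> - 4 * \<kappa>\<^sup>2 / pi * C) \<le> cosh (\<kappa> * A) * W \<sigma> X"
    unfolding lo_def[symmetric] using k0 by simp
qed

text \<open>The choices are made in the order \<delta>, A, T, X0, and none depends on \<sigma>. This
  uniformity allows \<sigma> to be taken in terms of X in \<open>N_count_tendsto\<close>.\<close>

lemma W_asymptotics:
  assumes "\<eta> > 0"
  obtains X0 where "X0 > 0" "\<And>\<sigma> X. 0 < \<sigma> \<Longrightarrow> \<sigma> < 1 \<Longrightarrow> X \<ge> X0 \<Longrightarrow> (\<And>p. p \<in> all_zeros \<Longrightarrow> Re p \<noteq> \<sigma>)
     \<Longrightarrow> \<bar>W \<sigma> X / (2 * X) - L\<bar> \<le> \<eta>"
proof -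
  define \<delta> where "\<delta> = min \<eta> (2 * L) / pi"
  have \<delta>: "\<delta> > 0" "pi * \<delta> \<le> 2 * L" "pi * \<delta> \<le> \<eta>" using assms L_pos by (auto simp: \<delta>_def)
  obtain A where A: "A > 1" "\<And>s. Re s \<ge> A \<Longrightarrow> f s \<noteq> \<xi> \<and> Re (Q s) > 0 \<and> cmod (Ln (Q s)) \<le> \<delta>"
    using Q_near_1[OF \<delta>(1)] by metis
  define C where "C = 2 / pi * ((2 * L + pi * \<delta>) * cosh (pi / 2 * A))"
  define U where "U = (\<lambda>T::real. (2 * L + pi * \<delta>) * cosh (pi / (2 * T) * A))"
  define l where "l = (\<lambda>T::real. (2 * L - pi * \<delta> - 4 * (pi / (2 * T))\<^sup>2 / pi * C) / cosh (pi / (2 * T) * A))"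
  have k: "((\<lambda>T::real. pi / (2 * T)) \<longlongrightarrow> 0) at_top" by real_asymp
  have "((\<lambda>T. (2 * L + pi * \<delta>) * cosh (pi / (2 * T) * A)) \<longlongrightarrow> (2 * L + pi * \<delta>) * cosh (0 * A)) at_top"
    by (intro tendsto_intros k)
  then have U: "(U \<longlongrightarrow> 2 * L + pi * \<delta>) at_top" unfolding U_def by simp
  have "(l \<longlongrightarrow> (2 * L - pi * \<delta> - 4 * 0\<^sup>2 / pi * C) / cosh (0 * A)) at_top"
    unfolding l_def by (intro tendsto_intros k) auto
  then have l: "(l \<longlongrightarrow> 2 * L - pi * \<delta>) at_top" by simp
  have "\<forall>\<^sub>F T in at_top. U T < 2 * L + 2 * \<eta> \<and> l T > 2 * L - 2 * \<eta> \<and> T \<ge> 1"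
    using order_tendstoD(2)[OF U, of "2 * L + 2 * \<eta>"] order_tendstoD(1)[OF l, of "2 * L - 2 * \<eta>"] \<delta> assms
    by (intro eventually_conj eventually_ge_at_top) auto
  then obtain T where T: "U T < 2 * L + 2 * \<eta>" "l T > 2 * L - 2 * \<eta>" "T \<ge> 1"
    unfolding eventually_at_top_linorder by blast
  have "((\<lambda>X. (X + c) * u / (2 * X)) \<longlongrightarrow> u / 2) at_top" for c u :: real
    by real_asymp
  from this[of T "U T"] this[of "- T" "l T"]
  have "((\<lambda>X. (X + T) * U T / (2 * X)) \<longlongrightarrow> U T / 2) at_top" "((\<lambda>X. (X - T) * l T / (2 * X)) \<longlongrightarrow> l T / 2) at_top"
    by simp_all
  then have "\<forall>\<^sub>F X in at_top. (X + T) * U T / (2 * X) < L + \<eta> \<and> (X - T) * l T / (2 * X) > L - \<eta> \<and> X > T"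
    using T by (intro eventually_conj eventually_gt_at_top order_tendstoD) auto
  then obtain X0 where X0: "\<And>X. X \<ge> X0 \<Longrightarrow> (X + T) * U T / (2 * X) < L + \<eta> \<and> (X - T) * l T / (2 * X) > L - \<eta> \<and> X > T"
    unfolding eventually_at_top_linorder by blast
  show ?thesis
  proof (rule that[of "max X0 1"])
    fix \<sigma> X assume s: "0 < \<sigma>" "\<sigma> < 1" and X: "X \<ge> max X0 1" and gen: "\<And>p. p \<in> all_zeros \<Longrightarrow> Re p \<noteq> \<sigma>"
    note X' = X0[of X]
    have b: "W \<sigma> X \<le> (X + T) * U T" "(X - T) * l T \<le> W \<sigma> X"
    proof -
      note W = W_bounds[OF A(2) s(1) _ \<delta>(1,2) T(3) refl gen C_def, of X]
      show "W \<sigma> X \<le> (X + T) * U T" unfolding U_def using W(1) A(1) s X X' by auto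
      have "(X - T) * (2 * L - pi * \<delta> - 4 * (pi / (2 * T))\<^sup>2 / pi * C) \<le> cosh (pi / (2 * T) * A) * W \<sigma> X"
        using W(2) A(1) s X X' by auto
      then show "(X - T) * l T \<le> W \<sigma> X" unfolding l_def by (simp add: divide_le_eq mult.commute)
    qed
    have "W \<sigma> X / (2 * X) \<le> (X + T) * U T / (2 * X)" "(X - T) * l T / (2 * X) \<le> W \<sigma> X / (2 * X)"
      using b X by (auto intro!: divide_right_mono)
    then show "\<bar>W \<sigma> X / (2 * X) - L\<bar> \<le> \<eta>" using X' X by auto
  qed auto
qed

end

subsection \<open>Continuity of sums over zeros\<close>

lemma zorder_zero_nonneg:
  assumes "h holomorphic_on U" "open U" "connected U" "s \<in> U" "\<exists>w\<in>U. h w \<noteq> 0"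
  shows "zorder h s \<ge> 0"
  using zorder_exist_zero[OF assms] by (auto split: if_splits)

text \<open>Rouche's theorem for one circle. The disc of radius 3/2 r serves as its open domain; it
  contains the closed disc of radius r and only finitely many zeros.\<close>

lemma Rouche_sum_zorder:
  assumes hol: "h holomorphic_on U" "k holomorphic_on U" and U: "open U" and r: "0 < r" "cball \<rho> (2 * r) \<subseteq> U"
    and less: "\<And>z. z \<in> sphere \<rho> r \<Longrightarrow> cmod (k z - h z) < cmod (h z)"
  shows "(\<Sum>p\<in>{p \<in> ball \<rho> r. k p = 0}. zorder k p) = (\<Sum>p\<in>{p \<in> ball \<rho> r. h p = 0}. zorder h p)"
    and "finite {p \<in> ball \<rho> r. k p = 0}"
proof -
  have sub: "ball \<rho> (2 * r) \<subseteq> U" using r by (meson ball_subset_cball order_trans)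
  have hnz: "h z \<noteq> 0" if "z \<in> sphere \<rho> r" for z using less[OF that] by auto
  have knz: "k z \<noteq> 0" if "z \<in> sphere \<rho> r" for z using less[OF that] by auto
  have z0: "\<rho> + of_real r \<in> sphere \<rho> r" "\<rho> + of_real r \<in> cball \<rho> r" using r by (auto simp: dist_norm)
  have fin: "finite {p \<in> ball \<rho> r. g p = 0}" "finite {p \<in> ball \<rho> (3 / 2 * r). g p = 0}"
    if g: "g holomorphic_on U" "\<And>z. z \<in> sphere \<rho> r \<Longrightarrow> g z \<noteq> 0" for g
  proof -
    have "\<not> g constant_on ball \<rho> (2 * r) \<or> {p \<in> cball \<rho> (3 / 2 * r). g p = 0} = {}"
    proof (rule disjCI)
      assume ne: "{p \<in> cball \<rho> (3 / 2 * r). g p = 0} \<noteq> {}"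
      then obtain p where "dist \<rho> p \<le> 3 / 2 * r" "g p = 0" by auto
      then have p: "p \<in> ball \<rho> (2 * r)" "g p = 0" using r(1) by auto
      have "\<rho> + of_real r \<in> ball \<rho> (2 * r)" using r by (auto simp: dist_norm)
      then show "\<not> g constant_on ball \<rho> (2 * r)"
        using p g(2)[OF z0(1)] unfolding constant_on_def by metis
    qed
    then have "finite {p \<in> cball \<rho> (3 / 2 * r). g p = 0}"
    proof
      assume "\<not> g constant_on ball \<rho> (2 * r)"
      then show ?thesis
        by (intro holomorphic_compact_finite_zeros[of g "ball \<rho> (2 * r)"] holomorphic_on_subset[OF g(1) sub])
          (use r in auto)
    qed (simp only: finite.emptyI)
    then show "finite {p \<in> ball \<rho> (3 / 2 * r). g p = 0}" by (rule rev_finite_subset) auto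
    then show "finite {p \<in> ball \<rho> r. g p = 0}" by (rule rev_finite_subset) (use r in auto)
  qed
  show "finite {p \<in> ball \<rho> r. k p = 0}" using fin(1)[OF hol(2) knz] .
  define B where "B = ball \<rho> (3 / 2 * r)"
  have BU: "B \<subseteq> U" using sub r by (auto simp: B_def)
  have eq: "(\<lambda>p. h p + (k p - h p)) = k" by auto
  have rouche: "(\<Sum>p\<in>{p \<in> B. h p + (k p - h p) = 0}. winding_number (circlepath \<rho> r) p * zorder (\<lambda>p. h p + (k p - h p)) p)
          = (\<Sum>p\<in>{p \<in> B. h p = 0}. winding_number (circlepath \<rho> r) p * zorder h p)"
  proof (rule Rouche_theorem)
    show "open B" "connected B" by (auto simp: B_def)
    show "finite {p \<in> B. h p + (k p - h p) = 0}" "finite {p \<in> B. h p = 0}"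
      using fin(2)[OF hol(2) knz] fin(2)[OF hol(1) hnz] by (auto simp: B_def)
    show "h holomorphic_on B" "(\<lambda>p. k p - h p) holomorphic_on B"
      using hol BU by (auto intro!: holomorphic_intros intro: holomorphic_on_subset)
    show "path_image (circlepath \<rho> r) \<subseteq> B" "\<forall>z\<in>path_image (circlepath \<rho> r). cmod (k z - h z) < cmod (h z)"
      using r less by (auto simp: B_def)
    show "\<forall>z. z \<notin> B \<longrightarrow> winding_number (circlepath \<rho> r) z = 0"
    proof (intro allI impI)
      fix z assume "z \<notin> B"
      then have "z \<notin> cball \<rho> r" using r by (auto simp: B_def)
      then show "winding_number (circlepath \<rho> r) z = 0"
        by (intro winding_number_zero_outside[of _ "cball \<rho> r"]) (use r in auto)
    qed
  qed auto
  have red: "(\<Sum>p\<in>{p \<in> B. g p = 0}. winding_number (circlepath \<rho> r) p * zorder g p)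
      = of_int (\<Sum>p\<in>{p \<in> ball \<rho> r. g p = 0}. zorder g p)"
    if g: "g holomorphic_on U" "\<And>z. z \<in> sphere \<rho> r \<Longrightarrow> g z \<noteq> 0" for g
    unfolding of_int_sum
  proof (rule sum.mono_neutral_cong_right)
    show "finite {p \<in> B. g p = 0}" using fin(2)[OF g] by (simp add: B_def)
    show "{p \<in> ball \<rho> r. g p = 0} \<subseteq> {p \<in> B. g p = 0}" using r by (auto simp: B_def)
    show "\<forall>i\<in>{p \<in> B. g p = 0} - {p \<in> ball \<rho> r. g p = 0}. winding_number (circlepath \<rho> r) i * (zorder g i) = 0"
    proof
      fix i assume i: "i \<in> {p \<in> B. g p = 0} - {p \<in> ball \<rho> r. g p = 0}"
      then have "i \<notin> sphere \<rho> r" "i \<notin> ball \<rho> r" using g(2) by auto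
      then have "i \<notin> cball \<rho> r" by auto
      then have "winding_number (circlepath \<rho> r) i = 0"
        by (intro winding_number_zero_outside[of _ "cball \<rho> r"]) (use r in auto)
      then show "winding_number (circlepath \<rho> r) i * (zorder g i) = 0" by simp
    qed
    show "winding_number (circlepath \<rho> r) x * (zorder g x) = (zorder g x)" if "x \<in> {p \<in> ball \<rho> r. g p = 0}" for x
      using that winding_number_circlepath[of x \<rho> r] by (simp add: dist_norm norm_minus_commute)
  qed
  have "(\<Sum>p\<in>{p \<in> B. k p = 0}. winding_number (circlepath \<rho> r) p * zorder k p)
          = (\<Sum>p\<in>{p \<in> B. h p = 0}. winding_number (circlepath \<rho> r) p * zorder h p)"
    using rouche unfolding eq by simp
  also have "\<dots> = of_int (\<Sum>p\<in>{p \<in> ball \<rho> r. h p = 0}. zorder h p)" by (rule red) (use hol hnz in auto)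
  finally have "(of_int (\<Sum>p\<in>{p \<in> ball \<rho> r. k p = 0}. zorder k p) :: complex) = of_int (\<Sum>p\<in>{p \<in> ball \<rho> r. h p = 0}. zorder h p)"
    using red[OF hol(2)] knz by simp
  then show "(\<Sum>p\<in>{p \<in> ball \<rho> r. k p = 0}. zorder k p) = (\<Sum>p\<in>{p \<in> ball \<rho> r. h p = 0}. zorder h p)"
    by (simp only: of_int_eq_iff)
qed

text \<open>By Rouche, for w near w0 the zeros of \<open>H w\<close> in K lie in small discs around
  those of \<open>H w0\<close>, with the same total multiplicity in each disc, and \<phi> varies
  little on a disc. Zeros may cross the boundary of K without a jump because \<phi> vanishes outside
  K.\<close>

lemma continuous_on_sum_zeros:
  fixes H :: "'w::metric_space \<Rightarrow> complex \<Rightarrow> complex" and \<phi> :: "complex \<Rightarrow> real"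
  assumes U: "open U" "connected U" and K: "compact K" "K \<subseteq> U"
    and hol: "\<And>w. w \<in> W \<Longrightarrow> H w holomorphic_on U" and nz: "\<And>w. w \<in> W \<Longrightarrow> \<exists>s\<in>U. H w s \<noteq> 0"
    and cont: "continuous_on (W \<times> U) (\<lambda>(w, s). H w s)"
    and \<phi>: "continuous_on UNIV \<phi>" "\<And>s. s \<notin> K \<Longrightarrow> \<phi> s = 0"
  shows "continuous_on W (\<lambda>w. \<Sum>s\<in>{s\<in>K. H w s = 0}. \<phi> s * of_int (zorder (H w) s))"
proof (rule continuous_on_iff[THEN iffD2], intro ballI allI impI)
  fix w0 and \<epsilon> :: real assume w0: "w0 \<in> W" and e: "\<epsilon> > 0"
  have finK: "finite {s\<in>K. H w s = 0}" if "w \<in> W" for w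
  proof (cases "H w constant_on U")
    case True
    then have "{s\<in>K. H w s = 0} = {}" using nz[OF that] K unfolding constant_on_def by auto
    then show ?thesis by (simp only: finite.emptyI)
  next
    case False
    then show ?thesis using holomorphic_compact_finite_zeros[OF hol[OF that] U K] by blast
  qed
  define Z where "Z = {s\<in>K. H w0 s = 0}"
  have finZ: "finite Z" unfolding Z_def using finK w0 by blast
  define n where "n = (\<Sum>\<rho>\<in>Z. real_of_int (zorder (H w0) \<rho>))"
  have zge: "zorder (H w) s \<ge> 0" if "w \<in> W" "s \<in> U" for w s
    using zorder_zero_nonneg hol nz U that by blast
  have n0: "n \<ge> 0" unfolding n_def by (intro sum_nonneg) (use zge w0 K in \<open>auto simp: Z_def\<close>)
  \<comment> \<open>Each of the n zeros, counted with multiplicity, may change the sum by e'; the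
    summand 1 covers n = 0.\<close>
  define e' where "e' = \<epsilon> / (2 * (n + 1))"
  have e': "e' > 0" using e n0 by (simp add: e'_def)
  have "e' * n < e' * (2 * (n + 1))" using e' n0 by (intro mult_strict_left_mono) auto
  also have "\<dots> = \<epsilon>" using n0 by (simp add: e'_def)
  finally have e'n: "e' * n < \<epsilon>" .
  have loc: "\<exists>r>0. \<forall>r'. 0 < r' \<and> r' \<le> r \<longrightarrow> cball \<rho> (2 * r') \<subseteq> U \<and> (\<forall>s\<in>cball \<rho> r'. \<bar>\<phi> s - \<phi> \<rho>\<bar> < e' \<and> (s \<noteq> \<rho> \<longrightarrow> H w0 s \<noteq> 0))
      \<and> (\<forall>\<rho>'\<in>Z. \<rho>' \<noteq> \<rho> \<longrightarrow> dist \<rho> \<rho>' > 2 * r')" if "\<rho> \<in> Z" for \<rho>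
  proof -
    have \<rho>: "\<rho> \<in> U" "H w0 \<rho> = 0" using that K by (auto simp: Z_def)
    obtain r1 where r1: "r1 > 0" "cball \<rho> r1 \<subseteq> U" using U \<rho> open_contains_cball by blast
    obtain r2 where r2: "r2 > 0" "\<And>s. dist s \<rho> < r2 \<Longrightarrow> \<bar>\<phi> s - \<phi> \<rho>\<bar> < e'"
      using \<phi>(1)[unfolded continuous_on_iff] e' unfolding dist_real_def by blast
    have "\<forall>\<^sub>F s in at \<rho>. H w0 s \<noteq> 0 \<and> s \<in> U"
      using nz[OF w0] by (metis \<rho>(1) U hol non_zero_neighbour_alt w0)
    then obtain r3 where r3: "r3 > 0" "\<And>s. s \<noteq> \<rho> \<Longrightarrow> dist s \<rho> < r3 \<Longrightarrow> H w0 s \<noteq> 0"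
      unfolding eventually_at by auto
    obtain r4 where r4: "r4 > 0" "\<And>\<rho>'. \<rho>' \<in> Z \<Longrightarrow> \<rho>' \<noteq> \<rho> \<Longrightarrow> dist \<rho> \<rho>' \<ge> r4"
      using finite_set_avoid[OF finZ, of \<rho>] by auto
    define r where "r = min (min (r1/2) (r2/2)) (min (r3/2) (r4/3))"
    have r: "r > 0" "2 * r \<le> r1" "r < r2" "r < r3" "2 * r < r4" using r1 r2 r3 r4 by (auto simp: r_def min_def)
    have cb: "cball \<rho> (2 * r') \<subseteq> U" if "r' \<le> r" for r' using r1 r that by (auto simp: subset_iff)
    show ?thesis
      using r r2 r3 r4 cb by (intro exI[of _ r]) (fastforce simp: dist_commute)
  qed
  obtain r where r: "r > 0" "\<And>\<rho>. \<rho> \<in> Z \<Longrightarrow> cball \<rho> (2 * r) \<subseteq> U"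
    "\<And>\<rho> s. \<rho> \<in> Z \<Longrightarrow> s \<in> cball \<rho> r \<Longrightarrow> \<bar>\<phi> s - \<phi> \<rho>\<bar> < e'"
    "\<And>\<rho> s. \<rho> \<in> Z \<Longrightarrow> s \<in> cball \<rho> r \<Longrightarrow> s \<noteq> \<rho> \<Longrightarrow> H w0 s \<noteq> 0"
    "\<And>\<rho> \<rho>'. \<rho> \<in> Z \<Longrightarrow> \<rho>' \<in> Z \<Longrightarrow> \<rho>' \<noteq> \<rho> \<Longrightarrow> dist \<rho> \<rho>' > 2 * r"
  proof -
    obtain R where R: "\<And>\<rho>. \<rho> \<in> Z \<Longrightarrow> R \<rho> > 0 \<and> (\<forall>r'. 0 < r' \<and> r' \<le> R \<rho> \<longrightarrow> cball \<rho> (2 * r') \<subseteq> U \<and> (\<forall>s\<in>cball \<rho> r'. \<bar>\<phi> s - \<phi> \<rho>\<bar> < e' \<and> (s \<noteq> \<rho> \<longrightarrow> H w0 s \<noteq> 0))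
      \<and> (\<forall>\<rho>'\<in>Z. \<rho>' \<noteq> \<rho> \<longrightarrow> dist \<rho> \<rho>' > 2 * r'))"
      using loc by metis
    define r where "r = Min (insert 1 (R ` Z))"
    have "r > 0" "\<And>\<rho>. \<rho> \<in> Z \<Longrightarrow> r \<le> R \<rho>" unfolding r_def using finZ R by auto
    then show ?thesis using R that[of r] by blast
  qed
  \<comment> \<open>A compact set free of zeros of \<open>H w0\<close>, so |H w0| has a positive
    minimum there. It contains the circles for Rouche and the part of K in which no new zero may
    appear.\<close>
  define K1 where "K1 = (K - (\<Union>\<rho>\<in>Z. ball \<rho> r)) \<union> (\<Union>\<rho>\<in>Z. sphere \<rho> r)"
  have K1: "compact K1" "K1 \<subseteq> U"
  proof -
    show "compact K1" unfolding K1_def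
      by (intro compact_Un compact_diff compact_UN K finZ open_UN) auto
    have "sphere \<rho> r \<subseteq> cball \<rho> (2 * r)" for \<rho> :: complex using r(1) by auto
    then show "K1 \<subseteq> U" unfolding K1_def using K r(2) by blast
  qed
  have K1nz: "H w0 s \<noteq> 0" if "s \<in> K1" for s
  proof (cases "\<exists>\<rho>\<in>Z. s \<in> sphere \<rho> r")
    case True
    then obtain \<rho> where "\<rho> \<in> Z" "s \<in> sphere \<rho> r" by blast
    moreover have "s \<noteq> \<rho>" "s \<in> cball \<rho> r" using \<open>s \<in> sphere \<rho> r\<close> r(1) by auto
    ultimately show ?thesis using r(4) by blast
  next
    case False
    then have "s \<in> K" "s \<notin> Z" using that r(1) by (auto simp: K1_def)
    then show ?thesis by (simp add: Z_def)
  qed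
  have cw0: "continuous_on K1 (H w0)"
    using hol[OF w0] K1(2) holomorphic_on_imp_continuous_on continuous_on_subset by blast
  obtain m where m: "m > 0" "\<And>s. s \<in> K1 \<Longrightarrow> m \<le> cmod (H w0 s)"
  proof (cases "K1 = {}")
    case False
    then obtain s0 where "s0 \<in> K1" "\<And>s. s \<in> K1 \<Longrightarrow> cmod (H w0 s0) \<le> cmod (H w0 s)"
      using continuous_attains_inf[OF K1(1) False, of "\<lambda>s. cmod (H w0 s)"] cw0 by (auto intro: continuous_on_norm)
    then show ?thesis using that[of "cmod (H w0 s0)"] K1nz by auto
  qed (use that[of 1] in auto)
  have "continuous_on (W \<times> K1) (\<lambda>(w, s). H w s)"
    by (rule continuous_on_subset[OF cont]) (use K1(2) in auto)
  from continuous_on_prod_compactE[OF this K1(1) w0, of "m / 2"] m(1)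
  obtain X0 where X0: "w0 \<in> X0" "open X0" "\<forall>w\<in>X0 \<inter> W. \<forall>s\<in>K1. dist (H w s) (H w0 s) \<le> m / 2"
    by auto
  obtain d where d: "d > 0" "\<And>w. dist w w0 < d \<Longrightarrow> w \<in> X0" 
    using openE[OF X0(2,1)] by (metis dist_commute mem_ball subsetD)
  show "\<exists>d>0. \<forall>w\<in>W. dist w w0 < d \<longrightarrow> dist (\<Sum>s\<in>{s\<in>K. H w s = 0}. \<phi> s * of_int (zorder (H w) s)) (\<Sum>s\<in>{s\<in>K. H w0 s = 0}. \<phi> s * of_int (zorder (H w0) s)) < \<epsilon>"
  proof (intro exI conjI ballI impI)
    fix w assume w: "w \<in> W" "dist w w0 < d"
    have near: "cmod (H w s - H w0 s) < cmod (H w0 s)" if "s \<in> K1" for s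
    proof -
      have "cmod (H w s - H w0 s) \<le> m / 2" using X0(3) d w that by (auto simp: dist_norm)
      then show ?thesis using m(2)[OF that] m(1) by linarith
    qed
    define B where "B = (\<lambda>\<rho>. {p \<in> ball \<rho> r. H w p = 0})"
    have sph: "\<And>z. z \<in> sphere \<rho> r \<Longrightarrow> cmod (H w z - H w0 z) < cmod (H w0 z)" if "\<rho> \<in> Z" for \<rho>
      using near that by (auto simp: K1_def)
    have Bf: "finite (B \<rho>)" and Bs: "(\<Sum>p\<in>B \<rho>. zorder (H w) p) = zorder (H w0) \<rho>" if "\<rho> \<in> Z" for \<rho>
    proof -
      have one: "{p \<in> ball \<rho> r. H w0 p = 0} = {\<rho>}"
      proof -
        have "p = \<rho>" if "p \<in> ball \<rho> r" "H w0 p = 0" for p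
          using r(4)[OF \<open>\<rho> \<in> Z\<close>, of p] that by auto
        then show ?thesis using r(1) \<open>\<rho> \<in> Z\<close> by (auto simp: Z_def)
      qed
      show "finite (B \<rho>)" "(\<Sum>p\<in>B \<rho>. zorder (H w) p) = zorder (H w0) \<rho>"
        using Rouche_sum_zorder[OF hol[OF w0] hol[OF w(1)] U(1) r(1) r(2)[OF that] sph[OF that]]
        unfolding one B_def by auto
    qed
    have disj: "B \<rho> \<inter> B \<rho>' = {}" if "\<rho> \<in> Z" "\<rho>' \<in> Z" "\<rho> \<noteq> \<rho>'" for \<rho> \<rho>'
    proof (rule ccontr)
      assume "B \<rho> \<inter> B \<rho>' \<noteq> {}"
      then obtain p where "dist \<rho> p < r" "dist \<rho>' p < r" by (auto simp: B_def)
      then have "dist \<rho> \<rho>' < 2 * r" using dist_triangle2[of \<rho> \<rho>' p] by linarith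
      then show False using r(5)[of \<rho> \<rho>'] that by auto
    qed
    have BU: "p \<in> U" if "\<rho> \<in> Z" "p \<in> B \<rho>" for \<rho> p
      using r(1) r(2)[OF that(1)] that(2) by (force simp: B_def)
    have "(\<Sum>s\<in>{s\<in>K. H w s = 0}. \<phi> s * of_int (zorder (H w) s)) = (\<Sum>s\<in>(\<Union>\<rho>\<in>Z. B \<rho>). \<phi> s * of_int (zorder (H w) s))"
    proof (rule sum.mono_neutral_left)
      show "finite (\<Union>\<rho>\<in>Z. B \<rho>)" using finZ Bf by blast
      show "{s\<in>K. H w s = 0} \<subseteq> (\<Union>\<rho>\<in>Z. B \<rho>)"
      proof
        fix s assume s: "s \<in> {s\<in>K. H w s = 0}"
        then have "s \<notin> K1" using near[of s] by auto
        then show "s \<in> (\<Union>\<rho>\<in>Z. B \<rho>)" using s by (auto simp: K1_def B_def)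
      qed
      \<comment> \<open>The discs may stick out of K; zeros found there carry weight 0.\<close>
      show "\<forall>i\<in>(\<Union>\<rho>\<in>Z. B \<rho>) - {s\<in>K. H w s = 0}. \<phi> i * of_int (zorder (H w) i) = 0"
        using \<phi>(2) by (auto simp: B_def)
    qed
    also have "\<dots> = (\<Sum>\<rho>\<in>Z. \<Sum>s\<in>B \<rho>. \<phi> s * of_int (zorder (H w) s))"
      by (rule sum.UNION_disjoint) (use finZ Bf disj in auto)
    finally have 1: "(\<Sum>s\<in>{s\<in>K. H w s = 0}. \<phi> s * of_int (zorder (H w) s)) = (\<Sum>\<rho>\<in>Z. \<Sum>s\<in>B \<rho>. \<phi> s * of_int (zorder (H w) s))" .
    have 2: "(\<Sum>s\<in>{s\<in>K. H w0 s = 0}. \<phi> s * of_int (zorder (H w0) s)) = (\<Sum>\<rho>\<in>Z. \<Sum>s\<in>B \<rho>. \<phi> \<rho> * of_int (zorder (H w) s))"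
      unfolding Z_def[symmetric] by (rule sum.cong) (simp_all only: Bs[symmetric] of_int_sum sum_distrib_left)
    have "dist (\<Sum>s\<in>{s\<in>K. H w s = 0}. \<phi> s * of_int (zorder (H w) s)) (\<Sum>s\<in>{s\<in>K. H w0 s = 0}. \<phi> s * of_int (zorder (H w0) s))
       = \<bar>\<Sum>\<rho>\<in>Z. \<Sum>s\<in>B \<rho>. (\<phi> s - \<phi> \<rho>) * of_int (zorder (H w) s)\<bar>"
      unfolding 1 2 dist_real_def left_diff_distrib sum_subtractf ..
    also have "\<dots> \<le> (\<Sum>\<rho>\<in>Z. \<Sum>s\<in>B \<rho>. e' * of_int (zorder (H w) s))"
    proof (intro order_trans[OF sum_abs] sum_mono)
      fix \<rho> s assume "\<rho> \<in> Z" "s \<in> B \<rho>"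
      then have "\<bar>\<phi> s - \<phi> \<rho>\<bar> \<le> e'" "zorder (H w) s \<ge> 0"
        using r(3)[of \<rho> s] zge w BU by (auto simp: B_def)
      then show "\<bar>(\<phi> s - \<phi> \<rho>) * of_int (zorder (H w) s)\<bar> \<le> e' * of_int (zorder (H w) s)"
        by (simp add: abs_mult mult_right_mono)
    qed
    also have "\<dots> = e' * n"
      unfolding n_def sum_distrib_left by (rule sum.cong) (simp_all only: Bs[symmetric] of_int_sum sum_distrib_left)
    also have "\<dots> < \<epsilon>" by (rule e'n)
    finally show "dist (\<Sum>s\<in>{s\<in>K. H w s = 0}. \<phi> s * of_int (zorder (H w) s)) (\<Sum>s\<in>{s\<in>K. H w0 s = 0}. \<phi> s * of_int (zorder (H w0) s)) < \<epsilon>" .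
  qed (use d in auto)
qed

subsection \<open>Almost periodic polynomials on a torus\<close>

definition freq :: "int \<Rightarrow> int \<Rightarrow> real" where "freq a b = of_int a * ln 2 + of_int b * ln 3"

definition monomial :: "int \<Rightarrow> int \<Rightarrow> complex \<times> complex \<Rightarrow> complex \<Rightarrow> complex" where
  "monomial a b w s = fst w powi a * snd w powi b * exp (- of_real (freq a b) * s)"

text \<open>A list of triples \<open>(c, a, b)\<close> stands for the generalised Dirichlet polynomial with terms
  \<open>c * (2 ^ a * 3 ^ b) powr - s\<close>; \<open>w\<close> ranges over the torus on which it is lifted.\<close>
type_synonym laurent = "(complex \<times> int \<times> int) list"

definition ev :: "laurent \<Rightarrow> complex \<times> complex \<Rightarrow> complex \<Rightarrow> complex" where
  "ev l w s = (\<Sum>(c, a, b)\<leftarrow>l. c * monomial a b w s)"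

lemma ev_simps [simp]:
  "ev [] w s = 0" "ev ((c, a, b) # l) w s = c * monomial a b w s + ev l w s" "ev (l @ m) w s = ev l w s + ev m w s"
  by (simp_all add: ev_def)

definition lmult :: "laurent \<Rightarrow> laurent \<Rightarrow> laurent" where
  "lmult l m = concat (map (\<lambda>(c, a, b). map (\<lambda>(c', a', b'). (c * c', a + a', b + b')) m) l)"

text \<open>On the imaginary axis s = - cnj s, so there this is complex conjugation. Squared moduli
  on the axis thus remain generalised Dirichlet polynomials.\<close>

definition lrefl :: "laurent \<Rightarrow> laurent" where
  "lrefl l = map (\<lambda>(c, a, b). (cnj c, - a, - b)) l"

definition torus :: "(complex \<times> complex) set" where
  "torus = sphere 0 1 \<times> sphere 0 1"

text \<open>The Kronecker flow: evaluating at \<open>flow \<tau>\<close> translates s by \<i> \<tau>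
  (\<open>ev_flow\<close>). All vertical translates are therefore parametrised by points of a
  compact set.\<close>

definition flow :: "real \<Rightarrow> complex \<times> complex" where
  "flow \<tau> = (exp (- (\<i> * of_real (\<tau> * ln 2))), exp (- (\<i> * of_real (\<tau> * ln 3))))"

lemma compact_torus: "compact torus"
  unfolding torus_def by (intro compact_Times) auto

lemma flow_in_torus: "flow \<tau> \<in> torus"
  by (simp add: torus_def flow_def)

lemma one_in_torus: "(1, 1) \<in> torus"
  by (simp add: torus_def)

lemma torus_nonzero: "w \<in> torus \<Longrightarrow> fst w \<noteq> 0 \<and> snd w \<noteq> 0"
  by (auto simp: torus_def)

lemma monomial_add: "w \<in> torus \<Longrightarrow> monomial (a + a') (b + b') w s = monomial a b w s * monomial a' b' w s"
  using torus_nonzero[of w]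
  by (simp add: monomial_def power_int_add freq_def ring_distribs exp_add exp_diff divide_inverse exp_minus mult_ac)

lemma ev_map_times:
  assumes "w \<in> torus"
  shows "ev (map (\<lambda>(c', a', b'). (c * c', a + a', b + b')) m) w s = c * monomial a b w s * ev m w s"
  by (induction m) (auto simp: monomial_add[OF assms] algebra_simps)

lemma ev_lmult: "w \<in> torus \<Longrightarrow> ev (lmult l m) w s = ev l w s * ev m w s"
  by (induction l) (auto simp: lmult_def ev_map_times algebra_simps)

lemma power_int_minus_cnj: "cmod z = 1 \<Longrightarrow> z powi (- a) = cnj (z powi a)"
proof -
  assume "cmod z = 1"
  then have "cmod (z powi a) = 1" by (simp add: norm_power_int)
  then have "cnj (z powi a) * z powi a = 1" using complex_norm_square[of "z powi a"] by (simp add: mult.commute del: complex_cnj_power_int)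
  then show ?thesis by (metis inverse_unique mult.commute power_int_minus)
qed

lemma monomial_refl: "w \<in> torus \<Longrightarrow> monomial (- a) (- b) w s = cnj (monomial a b w (- cnj s))"
proof -
  assume w: "w \<in> torus"
  have "freq (- a) (- b) = - freq a b" by (simp add: freq_def)
  moreover have "fst w powi - a = cnj (fst w powi a)" "snd w powi - b = cnj (snd w powi b)"
    using w power_int_minus_cnj[of "fst w" a] power_int_minus_cnj[of "snd w" b]
    by (simp_all add: torus_def mem_Times_iff del: complex_cnj_power_int power_int_minus)
  ultimately show ?thesis by (simp add: monomial_def exp_cnj del: complex_cnj_power_int power_int_minus)
qed

lemma ev_lrefl: "w \<in> torus \<Longrightarrow> ev (lrefl l) w s = cnj (ev l w (- cnj s))"
  by (induction l) (auto simp: lrefl_def monomial_refl)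

lemma monomial_flow: "monomial a b (flow \<tau>) s = monomial a b (1, 1) (s + \<i> * of_real \<tau>)"
proof -
  have "exp (- (\<i> * of_real (\<tau> * ln 2))) powi a = exp (of_int a * (- (\<i> * of_real (\<tau> * ln 2))))"
    "exp (- (\<i> * of_real (\<tau> * ln 3))) powi b = exp (of_int b * (- (\<i> * of_real (\<tau> * ln 3))))"
    by (simp_all only: exp_power_int)
  then show ?thesis by (simp add: monomial_def flow_def freq_def exp_add[symmetric] algebra_simps)
qed

lemma ev_flow: "ev l (flow \<tau>) s = ev l (1, 1) (s + \<i> * of_real \<tau>)"
  by (induction l) (auto simp: monomial_flow)

lemma continuous_on_monomial: "continuous_on (torus \<times> UNIV) (\<lambda>(w, s). monomial a b w s)"
  unfolding monomial_def case_prod_unfold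
  by (intro continuous_intros) (auto dest: torus_nonzero)

lemma continuous_on_ev: "continuous_on (torus \<times> UNIV) (\<lambda>(w, s). ev l w s)"
proof (induction l)
  case (Cons x l)
  obtain c a b where x: "x = (c, a, b)" by (cases x)
  show ?case using Cons continuous_on_monomial[of a b] unfolding x ev_simps case_prod_unfold
    by (intro continuous_intros) auto
qed (simp add: case_prod_unfold)

lemma holomorphic_on_ev: "(\<lambda>s. ev l w s) holomorphic_on X"
proof (induction l)
  case (Cons x l)
  obtain c a b where x: "x = (c, a, b)" by (cases x)
  show ?case using Cons unfolding x ev_simps monomial_def by (intro holomorphic_intros)
qed simp

lemma continuous_on_ev_line: "continuous_on X (\<lambda>\<tau>. ev l (1, 1) (c + \<i> * of_real \<tau>))"
  by (rule continuous_on_compose2[OF holomorphic_on_imp_continuous_on[OF holomorphic_on_ev[of l "(1, 1)" UNIV]]])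
    (auto intro!: continuous_intros)

definition has_mean :: "(real \<Rightarrow> real) \<Rightarrow> real \<Rightarrow> bool" where
  "has_mean g m \<longleftrightarrow> ((\<lambda>T. integral {- T..T} g / (2 * T)) \<longlongrightarrow> m) at_top"

lemma has_mean_const: "has_mean (\<lambda>_. c) c"
  unfolding has_mean_def
  by (rule tendsto_eventually, rule eventually_mono[OF eventually_gt_at_top[of 0]]) auto

lemma integrable_of_continuous:
  fixes g :: "real \<Rightarrow> real"
  assumes "continuous_on UNIV g" shows "g integrable_on {a..b}"
  by (rule integrable_continuous_interval, rule continuous_on_subset[OF assms]) simp

lemma has_mean_add:
  assumes "has_mean g m" "has_mean h n" "continuous_on UNIV g" "continuous_on UNIV h"
  shows "has_mean (\<lambda>t. g t + h t) (m + n)"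
proof -
  have "integral {- T..T} (\<lambda>t. g t + h t) / (2 * T) = integral {- T..T} g / (2 * T) + integral {- T..T} h / (2 * T)" for T
  proof -
    have "g integrable_on {- T..T}" "h integrable_on {- T..T}"
      by (rule integrable_of_continuous[OF assms(3)], rule integrable_of_continuous[OF assms(4)])
    then show ?thesis by (simp add: integral_add add_divide_distrib)
  qed
  then show ?thesis using tendsto_add[of _ m _ _ n] assms(1,2) unfolding has_mean_def by simp
qed

lemma integral_exp_line_bound:
  assumes "\<omega> \<noteq> 0"
  shows "cmod (integral {a..b} (\<lambda>t. c * exp (\<i> * of_real (\<omega> * t)))) \<le> 2 * cmod c / \<bar>\<omega>\<bar>"
proof (cases "a \<le> b")
  case True
  define F where "F = (\<lambda>t::real. c * exp (\<i> * of_real (\<omega> * t)) / (\<i> * of_real \<omega>))"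
  have "((\<lambda>t. c * exp (\<i> * of_real (\<omega> * t))) has_integral F b - F a) {a..b}"
  proof (rule fundamental_theorem_of_calculus[OF True])
    fix x
    have "((\<lambda>z. exp (\<i> * (of_real \<omega> * z))) has_field_derivative exp (\<i> * (of_real \<omega> * of_real x)) * (\<i> * of_real \<omega>)) (at (of_real x))"
      by (auto intro!: derivative_eq_intros)
    from DERIV_cdivide[OF DERIV_cmult[OF this, of c], of "\<i> * of_real \<omega>"]
    have "((\<lambda>z. c * exp (\<i> * (of_real \<omega> * z)) / (\<i> * of_real \<omega>)) has_field_derivative c * exp (\<i> * (of_real \<omega> * of_real x))) (at (of_real x))"
      using assms by simp
    from has_vector_derivative_real_field[OF this]
    show "(F has_vector_derivative c * exp (\<i> * of_real (\<omega> * x))) (at x within {a..b})"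
      unfolding F_def by (simp add: o_def has_vector_derivative_at_within)
  qed
  then have "integral {a..b} (\<lambda>t. c * exp (\<i> * of_real (\<omega> * t))) = F b - F a" by (rule integral_unique)
  moreover have "cmod (F x) = cmod c / \<bar>\<omega>\<bar>" for x by (simp add: F_def norm_divide norm_mult)
  ultimately show ?thesis using norm_triangle_ineq4[of "F b" "F a"] by simp
qed simp

lemma has_mean_exp: "has_mean (\<lambda>t. Re (c * exp (\<i> * of_real (\<omega> * t)))) (if \<omega> = 0 then Re c else 0)"
proof (cases "\<omega> = 0")
  case False
  have "((\<lambda>T. 2 * cmod c / \<bar>\<omega>\<bar> / (2 * T)) \<longlongrightarrow> 0) at_top" by real_asymp
  moreover have "\<forall>\<^sub>F T in at_top. norm (integral {- T..T} (\<lambda>t. Re (c * exp (\<i> * of_real (\<omega> * t)))) / (2 * T)) \<le> 2 * cmod c / \<bar>\<omega>\<bar> / (2 * T)"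
  proof (rule eventually_mono[OF eventually_gt_at_top[of 0]])
    fix T :: real assume T: "T > 0"
    have "(\<lambda>t. c * exp (\<i> * of_real (\<omega> * t))) integrable_on {- T..T}"
      by (intro integrable_continuous_interval continuous_intros)
    then have "integral {- T..T} (\<lambda>t. Re (c * exp (\<i> * of_real (\<omega> * t)))) = Re (integral {- T..T} (\<lambda>t. c * exp (\<i> * of_real (\<omega> * t))))"
      using has_integral_Re integrable_integral integral_unique by blast
    then have "\<bar>integral {- T..T} (\<lambda>t. Re (c * exp (\<i> * of_real (\<omega> * t))))\<bar> \<le> 2 * cmod c / \<bar>\<omega>\<bar>"
      using abs_Re_le_cmod integral_exp_line_bound[OF False] order_trans by metis
    then show "norm (integral {- T..T} (\<lambda>t. Re (c * exp (\<i> * of_real (\<omega> * t)))) / (2 * T)) \<le> 2 * cmod c / \<bar>\<omega>\<bar> / (2 * T)"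
      unfolding real_norm_def abs_divide using T
      by (simp only: abs_mult abs_numeral abs_of_pos) (intro divide_right_mono, auto)
  qed
  ultimately have "((\<lambda>T. integral {- T..T} (\<lambda>t. Re (c * exp (\<i> * of_real (\<omega> * t)))) / (2 * T)) \<longlongrightarrow> 0) at_top"
    by (rule Lim_null_comparison[rotated])
  then show ?thesis using False by (simp add: has_mean_def)
qed (simp add: has_mean_const)

lemma has_mean_ev:
  "has_mean (\<lambda>t. Re (ev l (1, 1) (\<i> * of_real t))) (\<Sum>(c, a, b)\<leftarrow>l. if freq a b = 0 then Re c else 0)"
proof (induction l)
  case (Cons x l)
  obtain c a b where x: "x = (c, a, b)" by (cases x)
  have m: "c * monomial a b (1, 1) (\<i> * of_real t) = c * exp (\<i> * of_real (- freq a b * t))" for t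
    by (simp add: monomial_def mult_ac)
  have "has_mean (\<lambda>t. Re (c * exp (\<i> * of_real (- freq a b * t))) + Re (ev l (1, 1) (\<i> * of_real t)))
     ((if - freq a b = 0 then Re c else 0) + (\<Sum>(c, a, b)\<leftarrow>l. if freq a b = 0 then Re c else 0))"
    by (rule has_mean_add[OF has_mean_exp Cons])
      (use continuous_on_ev_line[of UNIV l 0] in \<open>auto intro!: continuous_intros\<close>)
  then show ?case unfolding x ev_simps m by simp
qed (simp add: has_mean_const)

lemma abs_average_diff_le:
  fixes g h :: "real \<Rightarrow> real"
  assumes "continuous_on UNIV g" "continuous_on UNIV h" "\<And>t. \<bar>g t - h t\<bar> \<le> e" "T > 0"
  shows "\<bar>integral {- T..T} g / (2 * T) - integral {- T..T} h / (2 * T)\<bar> \<le> e"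
proof -
  have "integral {- T..T} g - integral {- T..T} h = integral {- T..T} (\<lambda>t. g t - h t)"
    by (rule integral_diff[symmetric]) (rule integrable_of_continuous[OF assms(1)], rule integrable_of_continuous[OF assms(2)])
  also have "norm \<dots> \<le> e * (T - (- T))"
  proof (rule integral_bound)
    show "continuous_on {- T..T} (\<lambda>t. g t - h t)"
      by (intro continuous_on_diff continuous_on_subset[OF assms(1)] continuous_on_subset[OF assms(2)]) auto
  qed (use assms in auto)
  finally show ?thesis using assms(4) by (simp add: diff_divide_distrib[symmetric] abs_divide divide_le_eq)
qed

text \<open>Averages of uniformly close functions are uniformly close, so the means of the
  approximants form a Cauchy sequence, whose limit is the mean of h.\<close>

lemma has_mean_approx:
  assumes h: "continuous_on UNIV h"
    and app: "\<And>e. e > 0 \<Longrightarrow> \<exists>g m. has_mean g m \<and> continuous_on UNIV g \<and> (\<forall>t. \<bar>g t - h t\<bar> \<le> e)"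
  shows "\<exists>m. has_mean h m"
proof -
  define A where "A = (\<lambda>g T. integral {- T..T} g / (2 * T) :: real)"
  obtain g m where g: "\<And>n. has_mean (g n) (m n)" "\<And>n. continuous_on UNIV (g n)" "\<And>n t. \<bar>g n t - h t\<bar> \<le> inverse (real (Suc n))"
    using app[of "inverse (real (Suc _))"] by (metis inverse_positive_iff_positive of_nat_0_less_iff zero_less_Suc)
  have Ag: "((\<lambda>T. A (g n) T) \<longlongrightarrow> m n) at_top" for n using g(1) by (simp add: has_mean_def A_def)
  have near: "\<bar>A (g n) T - A h T\<bar> \<le> inverse (real (Suc n))" if "T > 0" for n T
    unfolding A_def by (rule abs_average_diff_le) (use g h that in auto)
  have dm: "\<bar>m n - m k\<bar> \<le> inverse (real (Suc n)) + inverse (real (Suc k))" for n k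
  proof (rule tendsto_upperbound)
    show "((\<lambda>T. \<bar>A (g n) T - A (g k) T\<bar>) \<longlongrightarrow> \<bar>m n - m k\<bar>) at_top" by (intro tendsto_intros Ag)
    show "\<forall>\<^sub>F T in at_top. \<bar>A (g n) T - A (g k) T\<bar> \<le> inverse (real (Suc n)) + inverse (real (Suc k))"
    proof (rule eventually_mono[OF eventually_gt_at_top[of 0]])
      fix T :: real assume "T > 0"
      then show "\<bar>A (g n) T - A (g k) T\<bar> \<le> inverse (real (Suc n)) + inverse (real (Suc k))"
        using near[of T n] near[of T k] by linarith
    qed
  qed simp
  have i0: "(\<lambda>n. inverse (real (Suc n))) \<longlonglongrightarrow> 0" by (rule LIMSEQ_inverse_real_of_nat)
  have "Cauchy m"
  proof (rule metric_CauchyI)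
    fix e :: real assume e: "e > 0"
    then obtain M where M: "\<And>n. n \<ge> M \<Longrightarrow> inverse (real (Suc n)) < e / 2"
      using order_tendstoD(2)[OF i0, of "e/2"] by (auto simp: eventually_sequentially)
    have "dist (m n) (m k) < e" if "n \<ge> M" "k \<ge> M" for n k
      using dm[of n k] M[OF that(1)] M[OF that(2)] by (simp add: dist_real_def)
    then show "\<exists>M. \<forall>n\<ge>M. \<forall>k\<ge>M. dist (m n) (m k) < e" by blast
  qed
  then obtain l where l: "m \<longlonglongrightarrow> l" using Cauchy_convergent_iff convergent_def by blast
  have "(A h \<longlongrightarrow> l) at_top"
  proof (rule tendstoI)
    fix e :: real assume e: "e > 0"
    have "\<forall>\<^sub>F n in sequentially. inverse (real (Suc n)) < e / 3 \<and> dist (m n) l < e / 3"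
      using order_tendstoD(2)[OF i0, of "e/3"] tendstoD[OF l, of "e/3"] e by (intro eventually_conj) auto
    then obtain n where n: "inverse (real (Suc n)) < e / 3" "dist (m n) l < e / 3"
      by (auto simp: eventually_sequentially)
    have "\<forall>\<^sub>F T in at_top. dist (A (g n) T) (m n) < e / 3 \<and> T > 0"
      using tendstoD[OF Ag, of "e/3" n] e by (intro eventually_conj eventually_gt_at_top) auto
    then show "\<forall>\<^sub>F T in at_top. dist (A h T) l < e"
    proof (rule eventually_mono)
      fix T assume "dist (A (g n) T) (m n) < e / 3 \<and> 0 < T"
      then show "dist (A h T) l < e" using near[of T n] n unfolding dist_real_def by linarith
    qed
  qed
  then show ?thesis unfolding has_mean_def A_def by blast
qed

lemma continuous_on_flow: "continuous_on X flow"
  unfolding flow_def by (intro continuous_intros)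

text \<open>Real parts of Laurent polynomials are dense by Stone-Weierstrass and have means along
  the flow. This is the source of the limit T -> infinity in the mean counting function.\<close>

lemma has_mean_torus:
  fixes \<Psi> :: "complex \<times> complex \<Rightarrow> real"
  assumes "continuous_on torus \<Psi>"
  shows "\<exists>m. has_mean (\<lambda>\<tau>. \<Psi> (flow \<tau>)) m"
proof (rule has_mean_approx)
  show "continuous_on UNIV (\<lambda>\<tau>. \<Psi> (flow \<tau>))"
    by (rule continuous_on_compose2[OF assms continuous_on_flow]) (use flow_in_torus in auto)
  define R where "R = {g. \<exists>l. \<forall>w\<in>torus. g w = Re (ev l w 0)}"
  interpret function_ring_on R torus
  proof
    show "compact torus" by (rule compact_torus)
    have ce: "continuous_on torus (\<lambda>w. Re (ev l w 0))" for l
      by (rule continuous_on_compose2[OF continuous_on_ev[of l], of _ "\<lambda>w. (w, 0)", simplified, THEN continuous_on_Re])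
        (auto intro!: continuous_intros)
    show "continuous_on torus f" if f: "f \<in> R" for f
    proof -
      obtain l where "\<forall>w\<in>torus. f w = Re (ev l w 0)" using f by (auto simp: R_def)
      then show ?thesis using ce[of l] by (simp cong: continuous_on_cong)
    qed
    show "(\<lambda>_. c) \<in> R" for c
      unfolding R_def by (auto intro!: exI[of _ "[(of_real c, 0, 0)]"] simp: monomial_def freq_def)
    fix f g assume "f \<in> R" "g \<in> R"
    then obtain l m where lm: "\<forall>w\<in>torus. f w = Re (ev l w 0)" "\<forall>w\<in>torus. g w = Re (ev m w 0)" by (auto simp: R_def)
    then show "(\<lambda>w. f w + g w) \<in> R" unfolding R_def by (auto intro!: exI[of _ "l @ m"])
    \<comment> \<open>Re u * Re v = Re (u * (v + cnj v) / 2), and \<open>lrefl\<close> supplies cnj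
      v.\<close>
    have "f w * g w = Re (ev (lmult l (lmult [(1/2, 0, 0)] (m @ lrefl m))) w 0)" if w: "w \<in> torus" for w
    proof -
      have "monomial 0 0 w 0 = 1" by (simp add: monomial_def freq_def)
      moreover have "(1/2) * (ev m w 0 + cnj (ev m w 0)) = of_real (Re (ev m w 0))" by (simp add: complex_add_cnj)
      ultimately show ?thesis using w lm by (simp add: ev_lmult ev_lrefl)
    qed
    then show "(\<lambda>w. f w * g w) \<in> R" unfolding R_def by blast
  next
    fix x y assume xy: "x \<in> torus" "y \<in> torus" "x \<noteq> y"
    have m: "ev [(c, 1, 0)] w 0 = c * fst w" "ev [(c, 0, 1)] w 0 = c * snd w" for c w
      by (simp_all add: monomial_def)
    have in_R: "(\<lambda>w. Re (c * fst w)) \<in> R" "(\<lambda>w. Re (c * snd w)) \<in> R" for c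
      unfolding R_def m[symmetric] by blast+
    \<comment> \<open>c = 1 and c = - \<i> give the real and the imaginary part of each
      coordinate.\<close>
    from xy have "Re (fst x) \<noteq> Re (fst y) \<or> Im (fst x) \<noteq> Im (fst y) \<or> Re (snd x) \<noteq> Re (snd y) \<or> Im (snd x) \<noteq> Im (snd y)"
      by (auto simp: prod_eq_iff complex_eq_iff)
    then show "\<exists>f\<in>R. f x \<noteq> f y"
      using bexI[OF _ in_R(1)[of 1], of "\<lambda>f. f x \<noteq> f y"] bexI[OF _ in_R(1)[of "- \<i>"], of "\<lambda>f. f x \<noteq> f y"]
        bexI[OF _ in_R(2)[of 1], of "\<lambda>f. f x \<noteq> f y"] bexI[OF _ in_R(2)[of "- \<i>"], of "\<lambda>f. f x \<noteq> f y"]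
      by auto
  qed
  fix e :: real assume "e > 0"
  then obtain g where g: "g \<in> R" "\<forall>x\<in>torus. \<bar>\<Psi> x - g x\<bar> < e" using Stone_Weierstrass_basic[OF assms] by blast
  then obtain l where l: "\<forall>w\<in>torus. g w = Re (ev l w 0)" by (auto simp: R_def)
  have "g (flow t) = Re (ev l (1, 1) (\<i> * of_real t))" for t
    using l flow_in_torus by (simp add: ev_flow)
  moreover have "continuous_on UNIV (\<lambda>t. Re (ev l (1, 1) (\<i> * of_real t)))"
    using continuous_on_ev_line[of UNIV l 0] by (auto intro!: continuous_intros)
  moreover have "\<bar>g (flow t) - \<Psi> (flow t)\<bar> \<le> e" for t
    using g(2) flow_in_torus[of t] by (force simp: abs_minus_commute)
  ultimately show "\<exists>g m. has_mean g m \<and> continuous_on UNIV g \<and> (\<forall>t. \<bar>g t - \<Psi> (flow t)\<bar> \<le> e)"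
    using has_mean_ev[of l] by (intro exI[of _ "\<lambda>t. Re (ev l (1, 1) (\<i> * of_real t))"]) auto
qed

subsection \<open>Existence of the mean counting function\<close>

text \<open>H extends the vertical translates of f continuously to the torus.
  \<open>H_vanish\<close> is uniform in w, so the zeros of all functions \<open>H w\<close> - \<xi>
  lie to the left of one common abscissa.\<close>

locale lifted_map = half_plane_map +
  fixes H :: "complex \<times> complex \<Rightarrow> complex \<Rightarrow> complex"
  assumes H_holo: "\<And>w. w \<in> torus \<Longrightarrow> H w holomorphic_on {s. Re s > 0}"
    and H_cont: "continuous_on (torus \<times> {s. Re s > 0}) (\<lambda>(w, s). H w s)"
    and H_vanish: "\<And>\<delta>. \<delta> > 0 \<Longrightarrow> \<exists>A>0. \<forall>w\<in>torus. \<forall>s. Re s \<ge> A \<longrightarrow> cmod (H w s) \<le> \<delta>"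
    and H_flow: "\<And>s \<tau>. Re s > 0 \<Longrightarrow> H (flow \<tau>) s = f (s + \<i> * of_real \<tau>)"

locale lifted_value = lifted_map + half_plane_value
begin

lemma M_trunc_eq: "M_trunc f \<xi> \<sigma> X = pi / X * (\<Sum>p\<in>zeros \<sigma> X. (Re p - \<sigma>) * mult p)"
  unfolding M_trunc_def zeros_def mult_def ..

lemma zorder_H_flow:
  assumes "Re s > 0"
  shows "zorder (\<lambda>z. H (flow \<tau>) z - \<xi>) s = zorder (\<lambda>z. f z - \<xi>) (s + \<i> * of_real \<tau>)"
proof -
  have "\<forall>\<^sub>F z in at s. z \<in> {s. Re s > 0}"
    using halfplane(1) assms eventually_at_in_open' by blast
  then have "\<forall>\<^sub>F z in at s. H (flow \<tau>) z - \<xi> = f (z + \<i> * of_real \<tau>) - \<xi>"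
    by (rule eventually_mono) (simp add: H_flow)
  then have "zorder (\<lambda>z. H (flow \<tau>) z - \<xi>) s = zorder (\<lambda>z. f (z + \<i> * of_real \<tau>) - \<xi>) s"
    by (rule zorder_cong) simp
  also have "\<dots> = zorder (\<lambda>u. f (u + s + \<i> * of_real \<tau>) - \<xi>) 0" by (rule zorder_shift)
  also have "\<dots> = zorder (\<lambda>u. f (u + (s + \<i> * of_real \<tau>)) - \<xi>) 0" by (simp add: add.assoc)
  also have "\<dots> = zorder (\<lambda>z. f z - \<xi>) (s + \<i> * of_real \<tau>)" by (rule zorder_shift[symmetric])
  finally show ?thesis .
qed

text \<open>Up to negligible end terms, \<open>M_trunc\<close> is the average along the flow of a continuous function on the
  torus: the sum over the zeros \<open>s\<close> of \<open>H w - \<xi>\<close>, with a bump function of \<open>Im s\<close> as extra weight.\<close>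
lemma M_trunc_converges:
  assumes s0: "\<sigma> > 0"
  shows "\<exists>l. ((\<lambda>X. M_trunc f \<xi> \<sigma> X) \<longlongrightarrow> l) at_top"
proof -
  obtain A0 where A0: "A0 > 0" "\<And>w s. w \<in> torus \<Longrightarrow> Re s \<ge> A0 \<Longrightarrow> cmod (H w s) \<le> cmod \<xi> / 2"
    using H_vanish[of "cmod \<xi> / 2"] xi by auto
  define A where "A = A0 + \<sigma>"
  have A: "A > 0" "A > \<sigma>" "A \<ge> A0" using A0 s0 by (auto simp: A_def)
  have far: "H w s \<noteq> \<xi>" if "w \<in> torus" "Re s \<ge> A" for w s
  proof
    assume "H w s = \<xi>"
    then have "cmod \<xi> \<le> cmod \<xi> / 2" using A0(2)[OF that(1), of s] that(2) A by auto
    then show False using xi by simp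
  qed
  define K where "K = cbox (Complex \<sigma> (- 1)) (Complex (A + 1) 1)"
  \<comment> \<open>The first factor is the weight of \<open>M_trunc\<close>. The second is 1 for
    \<sigma> <= Re s <= A, where all zeros in K lie, and only makes \<phi> vanish to the right of K.
    The third spreads a zero over the translates that bring it to height less than 1.\<close>
  define \<phi> where "\<phi> = (\<lambda>s. max 0 (Re s - \<sigma>) * max 0 (min 1 (A + 1 - Re s)) * cos_bump 1 (Im s))"
  define \<Psi> where "\<Psi> = (\<lambda>w. \<Sum>s\<in>{s\<in>K. H w s - \<xi> = 0}. \<phi> s * of_int (zorder (\<lambda>z. H w z - \<xi>) s))"
  have \<phi>0: "\<phi> s = 0" if "s \<notin> K" for s
  proof -
    have "Re s < \<sigma> \<or> Re s > A + 1 \<or> \<bar>Im s\<bar> \<ge> 1" using that by (auto simp: K_def in_cbox_complex_iff abs_if)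
    then show ?thesis using cos_bump_outside[of 1 "Im s"] by (auto simp: \<phi>_def)
  qed
  have c\<Psi>: "continuous_on torus \<Psi>"
    unfolding \<Psi>_def
  proof (rule continuous_on_sum_zeros[OF halfplane(1,2)])
    show "compact K" by (simp add: K_def)
    show "K \<subseteq> {s. Re s > 0}" using s0 by (auto simp: K_def in_cbox_complex_iff)
    show "(\<lambda>z. H w z - \<xi>) holomorphic_on {s. Re s > 0}" if "w \<in> torus" for w
      by (intro holomorphic_intros H_holo that)
    show "\<exists>s\<in>{s. Re s > 0}. H w s - \<xi> \<noteq> 0" if "w \<in> torus" for w
      using far[OF that, of "of_real A"] A by (intro bexI[of _ "of_real A"]) auto
    show "continuous_on (torus \<times> {s. Re s > 0}) (\<lambda>(w, s). H w s - \<xi>)"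
      using H_cont unfolding case_prod_unfold by (intro continuous_intros)
    show "continuous_on UNIV \<phi>" unfolding \<phi>_def
      by (intro continuous_intros)
  qed (use \<phi>0 in auto)
  have s\<Psi>: "\<Psi> (flow \<tau>) = (\<Sum>p\<in>zeros \<sigma> (Y + 1). (Re p - \<sigma>) * mult p * cos_bump 1 (Im p - \<tau>))"
    if \<tau>: "\<tau> \<in> {- Y..Y}" for \<tau> Y
    unfolding \<Psi>_def
  \<comment> \<open>Translation by \<i> \<tau> matches the zeros of the lift in K with the zeros of
    f at heights near \<tau>. The sets S' and T' collect the terms outside this bijection; the
    weight is 0 on them.\<close>
  proof (rule sum.reindex_bij_witness_not_neutral
      [where i = "\<lambda>p. p - \<i> * of_real \<tau>" and j = "\<lambda>s. s + \<i> * of_real \<tau>"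
        and S' = "{s \<in> K. H (flow \<tau>) s - \<xi> = 0 \<and> (Re s = \<sigma> \<or> \<bar>Im s\<bar> = 1)}"
        and T' = "{p \<in> zeros \<sigma> (Y + 1). \<bar>Im p - \<tau>\<bar> \<ge> 1}"])
    have KR: "Re s > 0" if "s \<in> K" for s using that s0 by (auto simp: K_def in_cbox_complex_iff)
    have "finite {s \<in> cbox (Complex \<sigma> (\<tau> - 1)) (Complex (A + 1) (\<tau> + 1)). f s = \<xi>}"
      by (rule finite_zeros_cbox[OF s0])
    then have "finite ((\<lambda>p. p - \<i> * of_real \<tau>) ` {s \<in> cbox (Complex \<sigma> (\<tau> - 1)) (Complex (A + 1) (\<tau> + 1)). f s = \<xi>})"
      by (rule finite_imageI)
    then show "finite {s \<in> K. H (flow \<tau>) s - \<xi> = 0 \<and> (Re s = \<sigma> \<or> \<bar>Im s\<bar> = 1)}"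
    proof (rule rev_finite_subset, intro subsetI)
      fix s assume s: "s \<in> {s \<in> K. H (flow \<tau>) s - \<xi> = 0 \<and> (Re s = \<sigma> \<or> \<bar>Im s\<bar> = 1)}"
      then have "f (s + \<i> * of_real \<tau>) = \<xi>" using H_flow KR[of s] by auto
      moreover have "s + \<i> * of_real \<tau> \<in> cbox (Complex \<sigma> (\<tau> - 1)) (Complex (A + 1) (\<tau> + 1))"
        using s by (auto simp: K_def in_cbox_complex_iff)
      ultimately show "s \<in> (\<lambda>p. p - \<i> * of_real \<tau>) ` {s \<in> cbox (Complex \<sigma> (\<tau> - 1)) (Complex (A + 1) (\<tau> + 1)). f s = \<xi>}"
        by (intro image_eqI[of _ _ "s + \<i> * of_real \<tau>"]) auto
    qed
    show "finite {p \<in> zeros \<sigma> (Y + 1). \<bar>Im p - \<tau>\<bar> \<ge> 1}" using finite_zeros[OF s0] by simp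
    fix s assume s: "s \<in> {s \<in> K. H (flow \<tau>) s - \<xi> = 0} - {s \<in> K. H (flow \<tau>) s - \<xi> = 0 \<and> (Re s = \<sigma> \<or> \<bar>Im s\<bar> = 1)}"
    then show "s + \<i> * of_real \<tau> - \<i> * of_real \<tau> = s" by simp
    have fs: "f (s + \<i> * of_real \<tau>) = \<xi>" using s KR[of s] by (auto simp: H_flow)
    show "s + \<i> * of_real \<tau> \<in> zeros \<sigma> (Y + 1) - {p \<in> zeros \<sigma> (Y + 1). \<bar>Im p - \<tau>\<bar> \<ge> 1}"
      using s fs \<tau> by (auto simp: zeros_def K_def in_cbox_complex_iff abs_if split: if_splits)
  next
    fix p assume p: "p \<in> zeros \<sigma> (Y + 1) - {p \<in> zeros \<sigma> (Y + 1). \<bar>Im p - \<tau>\<bar> \<ge> 1}"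
    then show "p - \<i> * of_real \<tau> + \<i> * of_real \<tau> = p" by simp
    have Hp: "H (flow \<tau>) (p - \<i> * of_real \<tau>) = \<xi>" using p s0 by (auto simp: H_flow zeros_def)
    then have "Re p < A" using far[OF flow_in_torus, of "p - \<i> * of_real \<tau>" \<tau>] by force
    then show "p - \<i> * of_real \<tau> \<in> {s \<in> K. H (flow \<tau>) s - \<xi> = 0} - {s \<in> K. H (flow \<tau>) s - \<xi> = 0 \<and> (Re s = \<sigma> \<or> \<bar>Im s\<bar> = 1)}"
      using p Hp by (auto simp: zeros_def K_def in_cbox_complex_iff abs_if split: if_splits)
  next
    fix s assume "s \<in> {s \<in> K. H (flow \<tau>) s - \<xi> = 0 \<and> (Re s = \<sigma> \<or> \<bar>Im s\<bar> = 1)}"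
    then have "max 0 (Re s - \<sigma>) = 0 \<or> cos_bump 1 (Im s) = 0" using cos_bump_outside[of 1 "Im s"] by auto
    then show "\<phi> s * of_int (zorder (\<lambda>z. H (flow \<tau>) z - \<xi>) s) = 0" by (auto simp: \<phi>_def)
  next
    fix p assume "p \<in> {p \<in> zeros \<sigma> (Y + 1). \<bar>Im p - \<tau>\<bar> \<ge> 1}"
    then show "(Re p - \<sigma>) * mult p * cos_bump 1 (Im p - \<tau>) = 0" using cos_bump_outside[of 1 "Im p - \<tau>"] by simp
  next
    fix s assume s: "s \<in> {s \<in> K. H (flow \<tau>) s - \<xi> = 0}"
    then have sr: "Re s > 0" "Re s \<ge> \<sigma>" using s0 by (auto simp: K_def in_cbox_complex_iff)
    have "Re s < A" using s far[OF flow_in_torus, of s \<tau>] by force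
    then have "\<phi> s = (Re s - \<sigma>) * cos_bump 1 (Im s)" using sr by (simp add: \<phi>_def)
    then show "(Re (s + \<i> * of_real \<tau>) - \<sigma>) * mult (s + \<i> * of_real \<tau>) * cos_bump 1 (Im (s + \<i> * of_real \<tau>) - \<tau>)
        = \<phi> s * of_int (zorder (\<lambda>z. H (flow \<tau>) z - \<xi>) s)"
      by (simp add: mult_def zorder_H_flow[OF sr(1)])
  qed
  define I where "I = (\<lambda>Y. integral {- Y..Y} (\<lambda>\<tau>. \<Psi> (flow \<tau>)))"
  define V where "V = (\<lambda>X. \<Sum>p\<in>zeros \<sigma> X. (Re p - \<sigma>) * mult p)"
  have I: "I Y = (\<Sum>p\<in>zeros \<sigma> (Y + 1). (Re p - \<sigma>) * mult p * bump_mass 1 Y (Im p))" for Y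
  proof -
    have "I Y = integral {- Y..Y} (\<lambda>\<tau>. \<Sum>p\<in>zeros \<sigma> (Y + 1). (Re p - \<sigma>) * mult p * cos_bump 1 (Im p - \<tau>))"
      unfolding I_def by (rule integral_cong) (use s\<Psi> in auto)
    also have "\<dots> = (\<Sum>p\<in>zeros \<sigma> (Y + 1). (Re p - \<sigma>) * mult p * bump_mass 1 Y (Im p))"
      unfolding bump_mass_def
      by (subst integral_sum[OF finite_zeros[OF s0]])
        (auto intro!: integrable_continuous_interval continuous_intros)
    finally show ?thesis .
  qed
  have M: "0 \<le> bump_mass 1 Y t" "bump_mass 1 Y t \<le> 4 / pi" "\<bar>t\<bar> \<le> Y - 1 \<Longrightarrow> bump_mass 1 Y t = 4 / pi" for Y t
    using bump_mass_bounds(1,2)[of 1 Y t] bump_mass_bounds(3)[of 1 t Y] by auto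
  have mg: "(Re p - \<sigma>) * mult p \<ge> 0" if "p \<in> zeros \<sigma> Y" for p Y
    using that s0 mult_ge_0[of p] by (auto simp: zeros_def)
  \<comment> \<open>4 / \<pi> is the mass of the bump of half-width 1. Enlarging the window by 1
    gives every zero below height X this full mass; shrinking it by 1, as in \<open>lo\<close>,
    involves no other zeros.\<close>
  have up: "4 / pi * V X \<le> I (X + 1)" for X
  proof -
    have "4 / pi * V X = (\<Sum>p\<in>zeros \<sigma> X. (Re p - \<sigma>) * mult p * bump_mass 1 (X + 1) (Im p))"
      unfolding V_def sum_distrib_left by (rule sum.cong) (use M(3) in \<open>auto simp: zeros_def\<close>)
    also have "\<dots> \<le> I (X + 1)" unfolding I
    proof (rule sum_mono2)
      show "finite (zeros \<sigma> (X + 1 + 1))" by (rule finite_zeros[OF s0])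
      show "zeros \<sigma> X \<subseteq> zeros \<sigma> (X + 1 + 1)" by (auto simp: zeros_def)
      show "0 \<le> (Re p - \<sigma>) * mult p * bump_mass 1 (X + 1) (Im p)" if "p \<in> zeros \<sigma> (X + 1 + 1) - zeros \<sigma> X" for p
        by (rule mult_nonneg_nonneg[OF mg M(1)]) (use that in auto)
    qed
    finally show ?thesis .
  qed
  have lo: "I (X - 1) \<le> 4 / pi * V X" for X
  proof -
    have "I (X - 1) = (\<Sum>p\<in>zeros \<sigma> X. (Re p - \<sigma>) * mult p * bump_mass 1 (X - 1) (Im p))"
      unfolding I by simp
    also have "\<dots> \<le> (\<Sum>p\<in>zeros \<sigma> X. (Re p - \<sigma>) * mult p * (4 / pi))"
      by (intro sum_mono mult_left_mono M(2) mg)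
    also have "\<dots> = 4 / pi * V X" unfolding V_def by (simp add: sum_distrib_left mult.commute)
    finally show ?thesis .
  qed
  obtain m where "has_mean (\<lambda>\<tau>. \<Psi> (flow \<tau>)) m" using has_mean_torus[OF c\<Psi>] by blast
  then have m: "((\<lambda>Y. I Y / (2 * Y)) \<longlongrightarrow> m) at_top" by (simp add: has_mean_def I_def)
  have shift: "((\<lambda>X. I (X + c) / (2 * X)) \<longlongrightarrow> m) at_top" for c
  proof -
    have "filterlim (\<lambda>X. X + c) at_top at_top" by real_asymp
    from filterlim_compose[OF m this] have "((\<lambda>X. I (X + c) / (2 * (X + c))) \<longlongrightarrow> m) at_top" .
    moreover have "((\<lambda>X. (X + c) / X) \<longlongrightarrow> 1) at_top" by real_asymp
    ultimately have "((\<lambda>X. I (X + c) / (2 * (X + c)) * ((X + c) / X)) \<longlongrightarrow> m * 1) at_top" by (rule tendsto_mult)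
    moreover have "\<forall>\<^sub>F X in at_top. I (X + c) / (2 * (X + c)) * ((X + c) / X) = I (X + c) / (2 * X)"
    proof (rule eventually_mono[OF eventually_gt_at_top[of "max 0 (- c)"]])
      fix X assume "max 0 (- c) < X"
      then have nz: "X + c \<noteq> 0" by simp
      have "a / (2 * y) * (y / X) = a / (2 * X)" if "y \<noteq> 0" for a y using that by simp
      from this[OF nz] show "I (X + c) / (2 * (X + c)) * ((X + c) / X) = I (X + c) / (2 * X)" .
    qed
    ultimately show ?thesis by (simp add: tendsto_cong)
  qed
  have "((\<lambda>X. 4 / pi * V X / (2 * X)) \<longlongrightarrow> m) at_top"
  proof (rule tendsto_sandwich)
    show "((\<lambda>X. I (X - 1) / (2 * X)) \<longlongrightarrow> m) at_top" using shift[of "- 1"] by simp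
    show "((\<lambda>X. I (X + 1) / (2 * X)) \<longlongrightarrow> m) at_top" by (rule shift)
    show "\<forall>\<^sub>F X in at_top. I (X - 1) / (2 * X) \<le> 4 / pi * V X / (2 * X)"
      by (rule eventually_mono[OF eventually_gt_at_top[of 0]]) (intro divide_right_mono lo, simp)
    show "\<forall>\<^sub>F X in at_top. 4 / pi * V X / (2 * X) \<le> I (X + 1) / (2 * X)"
      by (rule eventually_mono[OF eventually_gt_at_top[of 0]]) (intro divide_right_mono up, simp)
  qed
  \<comment> \<open>The factor converts 4 / \<pi> divided by 2 X into the normalisation \<pi> / X of
    \<open>M_trunc\<close>.\<close>
  then have "((\<lambda>X. pi\<^sup>2 / 2 * (4 / pi * V X / (2 * X))) \<longlongrightarrow> pi\<^sup>2 / 2 * m) at_top" by (intro tendsto_intros)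
  moreover have "pi\<^sup>2 / 2 * (4 / pi * V X / (2 * X)) = M_trunc f \<xi> \<sigma> X" for X
    unfolding M_trunc_eq V_def by (simp add: power2_eq_square)
  ultimately show ?thesis by auto
qed

end

subsection \<open>The unweighted counting function\<close>

text \<open>With u the squared pseudo-hyperbolic distance, green = - ln u / 2 >= (1 - u) / 2. At w =
  0 the bound is (1 - |\<xi>|^2) / 2, the quantity in the theorem; the loss is linear in |w|, so it
  can be averaged.\<close>

lemma green_lower_bound:
  assumes "cmod \<xi> < 1" "cmod w < 1" "w \<noteq> \<xi>"
  shows "(1 - (cmod \<xi>)\<^sup>2) / 2 * (1 - 2 * cmod w) \<le> green \<xi> w"
proof -
  define a b where "a = cmod (1 - cnj \<xi> * w)" and "b = cmod (\<xi> - w)"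
  have pos: "a > 0" "b > 0" using one_minus_cnj_mult_nonzero[of \<xi> w] assms by (auto simp: a_def b_def)
  have id: "a\<^sup>2 - b\<^sup>2 = (1 - (cmod \<xi>)\<^sup>2) * (1 - (cmod w)\<^sup>2)"
    unfolding a_def b_def by (rule pseudo_hyperbolic_identity)
  have x1: "0 \<le> 1 - (cmod \<xi>)\<^sup>2" using assms by (simp add: abs_square_le_1)
  have "a \<le> 1 + cmod (cnj \<xi> * w)" unfolding a_def using norm_triangle_ineq4[of 1 "cnj \<xi> * w"] by simp
  also have "cmod (cnj \<xi> * w) \<le> 1 * cmod w" unfolding norm_mult using assms by (intro mult_right_mono) auto
  finally have a: "a \<le> 1 + cmod w" by simp
  have "ln ((b / a)\<^sup>2) = 2 * (ln b - ln a)" using pos by (simp add: ln_div ln_realpow)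
  then have "green \<xi> w = - (ln ((b / a)\<^sup>2) / 2)"
    unfolding green_def a_def[symmetric] b_def[symmetric] using pos by (simp add: ln_div diff_divide_distrib)
  moreover have "ln ((b / a)\<^sup>2) \<le> (b / a)\<^sup>2 - 1" using pos by (intro ln_le_minus_one) auto
  ultimately have "green \<xi> w \<ge> (1 - (b / a)\<^sup>2) / 2" by simp
  moreover have "1 - (b / a)\<^sup>2 = (1 - (cmod \<xi>)\<^sup>2) * (1 - (cmod w)\<^sup>2) / a\<^sup>2"
    unfolding id[symmetric] using pos by (simp add: power_divide diff_divide_distrib)
  moreover have "(1 - (cmod \<xi>)\<^sup>2) * (1 - 2 * cmod w) \<le> (1 - (cmod \<xi>)\<^sup>2) * (1 - (cmod w)\<^sup>2) / a\<^sup>2"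
  proof -
    have "(1 - 2 * cmod w) * a\<^sup>2 \<le> 1 - (cmod w)\<^sup>2"
    proof (cases "1 - 2 * cmod w \<ge> 0")
      case True
      have "(1 - 2 * cmod w) * a\<^sup>2 \<le> (1 - 2 * cmod w) * (1 + cmod w)\<^sup>2"
        using True a pos by (intro mult_left_mono power_mono) auto
      also have "\<dots> = 1 - (cmod w)\<^sup>2 - 2 * (cmod w)\<^sup>2 * (1 + cmod w)"
        by (simp add: power2_eq_square algebra_simps)
      also have "\<dots> \<le> 1 - (cmod w)\<^sup>2" by simp
      finally show ?thesis .
    next
      case False
      then have "(1 - 2 * cmod w) * a\<^sup>2 \<le> 0" by (intro mult_nonpos_nonneg) auto
      also have "0 \<le> 1 - (cmod w)\<^sup>2" using assms by (simp add: abs_square_le_1)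
      finally show ?thesis .
    qed
    then have "1 - 2 * cmod w \<le> (1 - (cmod w)\<^sup>2) / a\<^sup>2" using pos by (simp add: pos_le_divide_eq)
    from mult_left_mono[OF this x1] show ?thesis by simp
  qed
  ultimately show ?thesis by (simp add: algebra_simps)
qed

context half_plane_value begin

lemma M_trunc_W: "X > 0 \<Longrightarrow> M_trunc f \<xi> \<sigma> X = W \<sigma> X / (2 * X) - integral {- X..X} (gl \<sigma>) / (2 * X)"
  unfolding W_def M_trunc_def zeros_def mult_def by (simp add: add_divide_distrib)

lemma generic_abscissa:
  assumes "a < b" obtains \<sigma> where "a < \<sigma>" "\<sigma> < b" "\<And>p. p \<in> all_zeros \<Longrightarrow> Re p \<noteq> \<sigma>"
proof -
  have "\<not> {a<..<b} \<subseteq> Re ` all_zeros"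
    using countable_subset[OF _ countable_image[OF countable_all_zeros]] uncountable_open_interval[of a b] assms by blast
  then obtain \<sigma> where "\<sigma> \<in> {a<..<b}" "\<sigma> \<notin> Re ` all_zeros" by blast
  then show ?thesis using that[of \<sigma>] by auto
qed

lemma N_count_ge_M_trunc:
  assumes "\<sigma> > 0" "X > 0" shows "ennreal (M_trunc f \<xi> \<sigma> X) \<le> N_count f \<xi> X"
proof -
  have fin: "finite (zeros \<sigma> X)" by (rule finite_zeros[OF assms(1)])
  have "ennreal (\<Sum>p\<in>zeros \<sigma> X. (Re p - \<sigma>) * mult p) \<le> (\<Sum>p\<in>zeros \<sigma> X. ennreal (Re p * mult p))"
  proof (subst sum_ennreal[symmetric])
    show "(Re p - \<sigma>) * mult p \<ge> 0" if "p \<in> zeros \<sigma> X" for p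
      using that assms mult_ge_0[of p] by (auto simp: zeros_def)
    show "(\<Sum>p\<in>zeros \<sigma> X. ennreal ((Re p - \<sigma>) * mult p)) \<le> (\<Sum>p\<in>zeros \<sigma> X. ennreal (Re p * mult p))"
      using assms mult_ge_0 by (intro sum_mono ennreal_leI mult_right_mono) (auto simp: zeros_def)
  qed
  also have "\<dots> = (\<integral>\<^sup>+ p. ennreal (Re p * mult p) \<partial>count_space (zeros \<sigma> X))"
    using fin by (rule nn_integral_count_space_finite[symmetric])
  also have "\<dots> = (\<integral>\<^sup>+ p. ennreal (Re p * mult p) * indicator (zeros \<sigma> X) p \<partial>count_space UNIV)"
    by (rule nn_integral_count_space_indicator) auto
  also have "\<dots> \<le> (\<integral>\<^sup>+ p. ennreal (Re p * mult p) * indicator (zeros 0 X) p \<partial>count_space UNIV)"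
    using assms by (intro nn_integral_mono) (auto simp: zeros_def split: split_indicator)
  also have "\<dots> = (\<integral>\<^sup>+ p. ennreal (Re p * mult p) \<partial>count_space (zeros 0 X))"
    by (rule nn_integral_count_space_indicator[symmetric]) auto
  finally have "ennreal (pi / X) * ennreal (\<Sum>p\<in>zeros \<sigma> X. (Re p - \<sigma>) * mult p)
     \<le> ennreal (pi / X) * (\<integral>\<^sup>+ p. ennreal (Re p * mult p) \<partial>count_space (zeros 0 X))"
    by (rule mult_left_mono) simp
  then show ?thesis unfolding M_trunc_def N_count_def zeros_def mult_def using assms
    by (simp add: ennreal_mult'[symmetric])
qed

text \<open>Fatou's lemma along generic abscissae decreasing to 0. It also covers the case that
  infinitely many zeros accumulate at the imaginary axis.\<close>

lemma N_count_le:
  assumes X: "X > 0" and c: "\<And>\<sigma>. 0 < \<sigma> \<Longrightarrow> \<sigma> < 1 \<Longrightarrow> (\<And>p. p \<in> all_zeros \<Longrightarrow> Re p \<noteq> \<sigma>) \<Longrightarrow> M_trunc f \<xi> \<sigma> X \<le> c"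
  shows "N_count f \<xi> X \<le> ennreal c"
proof -
  have "\<exists>\<sigma>. 0 < \<sigma> \<and> \<sigma> < inverse (real (Suc k)) \<and> (\<forall>p\<in>all_zeros. Re p \<noteq> \<sigma>)" for k
    by (rule generic_abscissa[of 0 "inverse (real (Suc k))"]) auto
  then obtain \<sigma> where \<sigma>: "\<And>k. 0 < \<sigma> k" "\<And>k. \<sigma> k < inverse (real (Suc k))" "\<And>k p. p \<in> all_zeros \<Longrightarrow> Re p \<noteq> \<sigma> k"
    by metis
  have \<sigma>0: "\<sigma> \<longlonglongrightarrow> 0"
    by (rule tendsto_sandwich[OF _ _ tendsto_const LIMSEQ_inverse_real_of_nat])
      (use \<sigma> in \<open>auto intro!: always_eventually less_imp_le\<close>)
  have \<sigma>1: "\<sigma> k < 1" for k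
  proof -
    have "inverse (real (Suc k)) \<le> 1" by (simp add: field_simps)
    then show ?thesis using \<sigma>(2)[of k] by linarith
  qed
  define g where "g = (\<lambda>k p. ennreal (pi / X * (max 0 (Re p - \<sigma> k) * mult p)))"
  have "(\<integral>\<^sup>+ p. ennreal (pi / X * (Re p * mult p)) \<partial>count_space (zeros 0 X)) = (\<integral>\<^sup>+ p. liminf (\<lambda>k. g k p) \<partial>count_space (zeros 0 X))"
  proof (rule nn_integral_cong)
    fix p assume "p \<in> space (count_space (zeros 0 X))"
    then have p: "Re p > 0" by (simp add: zeros_def)
    have "(\<lambda>k. pi / X * (max 0 (Re p - \<sigma> k) * mult p)) \<longlonglongrightarrow> pi / X * (max 0 (Re p - 0) * mult p)"
      by (intro tendsto_intros \<sigma>0)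
    then have "(\<lambda>k. g k p) \<longlonglongrightarrow> ennreal (pi / X * (Re p * mult p))"
      unfolding g_def using p by (intro tendsto_ennrealI) (simp add: max_def)
    then show "ennreal (pi / X * (Re p * mult p)) = liminf (\<lambda>k. g k p)"
      by (metis lim_imp_Liminf sequentially_bot)
  qed
  also have "\<dots> \<le> liminf (\<lambda>k. \<integral>\<^sup>+ p. g k p \<partial>count_space (zeros 0 X))"
    by (rule nn_integral_liminf) auto
  also have "\<dots> \<le> ennreal c"
  proof -
    have "(\<integral>\<^sup>+ p. g k p \<partial>count_space (zeros 0 X)) \<le> ennreal c" for k
    proof -
      have "(\<integral>\<^sup>+ p. g k p \<partial>count_space (zeros 0 X)) = (\<integral>\<^sup>+ p. g k p * indicator (zeros 0 X) p \<partial>count_space UNIV)"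
        by (rule nn_integral_count_space_indicator) auto
      also have "\<dots> = (\<integral>\<^sup>+ p. g k p * indicator (zeros (\<sigma> k) X) p \<partial>count_space UNIV)"
        using \<sigma>(1)[of k] by (intro nn_integral_cong) (auto simp: g_def zeros_def split: split_indicator)
      also have "\<dots> = (\<integral>\<^sup>+ p. g k p \<partial>count_space (zeros (\<sigma> k) X))"
        by (rule nn_integral_count_space_indicator[symmetric]) auto
      also have "\<dots> = (\<Sum>p\<in>zeros (\<sigma> k) X. g k p)"
        by (rule nn_integral_count_space_finite[OF finite_zeros[OF \<sigma>(1)]])
      also have "\<dots> = ennreal (\<Sum>p\<in>zeros (\<sigma> k) X. pi / X * (max 0 (Re p - \<sigma> k) * mult p))"
        unfolding g_def
      proof (rule sum_ennreal)
        fix p assume "p \<in> zeros (\<sigma> k) X"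
        then have "mult p \<ge> 0" using mult_ge_0[of p] \<sigma>(1)[of k] by (auto simp: zeros_def)
        then show "0 \<le> pi / X * (max 0 (Re p - \<sigma> k) * mult p)" using X by simp
      qed
      also have "(\<Sum>p\<in>zeros (\<sigma> k) X. pi / X * (max 0 (Re p - \<sigma> k) * mult p)) = M_trunc f \<xi> (\<sigma> k) X"
        unfolding M_trunc_def zeros_def[symmetric] mult_def[symmetric] sum_distrib_left
        by (rule sum.cong) (auto simp: zeros_def)
      also have "ennreal \<dots> \<le> ennreal c" by (intro ennreal_leI c \<sigma> \<sigma>1)
      finally show ?thesis .
    qed
    then have "liminf (\<lambda>k. \<integral>\<^sup>+ p. g k p \<partial>count_space (zeros 0 X)) \<le> liminf (\<lambda>k. ennreal c)"
      by (intro Liminf_mono always_eventually) auto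
    then show ?thesis by (simp add: Liminf_const)
  qed
  finally have "(\<integral>\<^sup>+ p. ennreal (pi / X * (Re p * mult p)) \<partial>count_space (zeros 0 X)) \<le> ennreal c" .
  moreover have "(\<integral>\<^sup>+ p. ennreal (pi / X * (Re p * mult p)) \<partial>count_space (zeros 0 X))
     = ennreal (pi / X) * (\<integral>\<^sup>+ p. ennreal (Re p * mult p) \<partial>count_space (zeros 0 X))"
  proof (subst nn_integral_cmult[symmetric])
    show "(\<integral>\<^sup>+ p. ennreal (pi / X * (Re p * mult p)) \<partial>count_space (zeros 0 X)) = (\<integral>\<^sup>+ p. ennreal (pi / X) * ennreal (Re p * mult p) \<partial>count_space (zeros 0 X))"
      by (intro nn_integral_cong ennreal_mult') (use X in simp)
  qed simp
  ultimately show ?thesis unfolding N_count_def zeros_def mult_def by simp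
qed

text \<open>Upper bound: the Green mean is nonnegative on every generic line, and \<sigma> tends to
  0. Lower bound: for each X one line with small Green integral is enough, and it may depend on X
  because \<open>W_asymptotics\<close> is uniform in \<sigma>.\<close>

lemma N_count_tendsto:
  assumes small: "\<And>\<delta> X \<sigma>0. \<delta> > 0 \<Longrightarrow> X > 0 \<Longrightarrow> \<sigma>0 > 0 \<Longrightarrow>
     \<exists>\<sigma>>0. \<sigma> < \<sigma>0 \<and> (\<forall>p\<in>all_zeros. Re p \<noteq> \<sigma>) \<and> integral {- X..X} (gl \<sigma>) < \<delta>"
  shows "((\<lambda>X. N_count f \<xi> X) \<longlongrightarrow> ennreal L) at_top"
proof -
  have bounds: "\<forall>\<^sub>F X in at_top. ennreal (L - 2 * \<eta>) \<le> N_count f \<xi> X \<and> N_count f \<xi> X \<le> ennreal (L + \<eta>)" if \<eta>: "\<eta> > 0" for \<eta>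
  proof -
    obtain X0 where X0: "X0 > 0" "\<And>\<sigma> X. 0 < \<sigma> \<Longrightarrow> \<sigma> < 1 \<Longrightarrow> X \<ge> X0 \<Longrightarrow> (\<And>p. p \<in> all_zeros \<Longrightarrow> Re p \<noteq> \<sigma>)
       \<Longrightarrow> \<bar>W \<sigma> X / (2 * X) - L\<bar> \<le> \<eta>" using W_asymptotics[OF \<eta>] by metis
    show ?thesis
    proof (rule eventually_mono[OF eventually_ge_at_top[of X0]])
      fix X assume X: "X0 \<le> X"
      then have Xp: "X > 0" using X0 by simp
      have "N_count f \<xi> X \<le> ennreal (L + \<eta>)"
      proof (rule N_count_le[OF Xp])
        fix \<sigma> assume s: "0 < \<sigma>" "\<sigma> < 1" and g: "\<And>p. p \<in> all_zeros \<Longrightarrow> Re p \<noteq> \<sigma>"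
        have "integral {- X..X} (gl \<sigma>) \<ge> 0"
          by (rule integral_nonneg) (use s g gl_nonneg in \<open>auto intro!: integrable_continuous_interval continuous_on_gl_vertical\<close>)
        then have "integral {- X..X} (gl \<sigma>) / (2 * X) \<ge> 0" using Xp by simp
        then show "M_trunc f \<xi> \<sigma> X \<le> L + \<eta>" using X0(2)[OF s X g] unfolding M_trunc_W[OF Xp] by linarith
      qed
      moreover have "ennreal (L - 2 * \<eta>) \<le> N_count f \<xi> X"
      proof -
        obtain \<sigma> where s: "0 < \<sigma>" "\<sigma> < 1" "\<And>p. p \<in> all_zeros \<Longrightarrow> Re p \<noteq> \<sigma>" "integral {- X..X} (gl \<sigma>) < 2 * X * \<eta>"
          using small[of "2 * X * \<eta>" X 1] Xp \<eta> by auto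
        then have "integral {- X..X} (gl \<sigma>) / (2 * X) \<le> \<eta>" using Xp by (simp add: divide_le_eq mult_ac)
        then have "L - 2 * \<eta> \<le> M_trunc f \<xi> \<sigma> X"
          using X0(2)[OF s(1,2) X s(3)] unfolding M_trunc_W[OF Xp] by linarith
        then show ?thesis using N_count_ge_M_trunc[OF s(1) Xp] ennreal_leI order_trans by blast
      qed
      ultimately show "ennreal (L - 2 * \<eta>) \<le> N_count f \<xi> X \<and> N_count f \<xi> X \<le> ennreal (L + \<eta>)" by blast
    qed
  qed
  have "((\<lambda>X. enn2real (N_count f \<xi> X)) \<longlongrightarrow> L) at_top"
  proof (rule tendstoI)
    fix e :: real assume e: "e > 0"
    \<comment> \<open>Keeping 2 \<eta> below L ensures that \<open>ennreal (L - 2 * \<eta>)\<close>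
      is not truncated to 0.\<close>
    define \<eta> where "\<eta> = min (e / 4) (L / 4)"
    have \<eta>: "\<eta> > 0" "2 * \<eta> < e" "2 * \<eta> < L" using e L_pos by (auto simp: \<eta>_def)
    show "\<forall>\<^sub>F X in at_top. dist (enn2real (N_count f \<xi> X)) L < e"
    proof (rule eventually_mono[OF bounds[OF \<eta>(1)]])
      fix X assume N: "ennreal (L - 2 * \<eta>) \<le> N_count f \<xi> X \<and> N_count f \<xi> X \<le> ennreal (L + \<eta>)"
      then have fin: "N_count f \<xi> X < \<infinity>" by (metis ennreal_less_top infinity_ennreal_def le_less_trans)
      have "enn2real (ennreal (L - 2 * \<eta>)) \<le> enn2real (N_count f \<xi> X)" "enn2real (N_count f \<xi> X) \<le> enn2real (ennreal (L + \<eta>))"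
        using N fin by (auto intro!: enn2real_mono simp: less_top)
      moreover have "enn2real (ennreal (L - 2 * \<eta>)) = L - 2 * \<eta>" "enn2real (ennreal (L + \<eta>)) = L + \<eta>"
        using \<eta> by (intro enn2real_ennreal; simp)+
      ultimately have "L - 2 * \<eta> \<le> enn2real (N_count f \<xi> X)" "enn2real (N_count f \<xi> X) \<le> L + \<eta>" by (simp_all only:)
      then show "dist (enn2real (N_count f \<xi> X)) L < e" using \<eta> unfolding dist_real_def by linarith
    qed
  qed
  then have "((\<lambda>X. ennreal (enn2real (N_count f \<xi> X))) \<longlongrightarrow> ennreal L) at_top" by (rule tendsto_ennrealI)
  moreover have "\<forall>\<^sub>F X in at_top. ennreal (enn2real (N_count f \<xi> X)) = N_count f \<xi> X"
  proof (rule eventually_mono[OF bounds[OF zero_less_one]])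
    fix X assume "ennreal (L - 2 * 1) \<le> N_count f \<xi> X \<and> N_count f \<xi> X \<le> ennreal (L + 1)"
    then have "N_count f \<xi> X < top" by (metis ennreal_less_top le_less_trans)
    then show "ennreal (enn2real (N_count f \<xi> X)) = N_count f \<xi> X" by simp
  qed
  ultimately show ?thesis by (rule Lim_transform_eventually)
qed

end

section \<open>Upper bound for the mean counting function\<close>

context lifted_value begin

lemma M_trunc_antimono:
  assumes "0 < \<sigma>" "\<sigma> \<le> \<sigma>'" "X > 0" shows "M_trunc f \<xi> \<sigma>' X \<le> M_trunc f \<xi> \<sigma> X"
proof -
  have "(\<Sum>p\<in>zeros \<sigma>' X. (Re p - \<sigma>') * mult p) \<le> (\<Sum>p\<in>zeros \<sigma>' X. (Re p - \<sigma>) * mult p)"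
    using assms mult_ge_0 by (intro sum_mono mult_right_mono) (auto simp: zeros_def)
  also have "\<dots> \<le> (\<Sum>p\<in>zeros \<sigma> X. (Re p - \<sigma>) * mult p)"
    using assms mult_ge_0 by (intro sum_mono2 finite_zeros) (auto simp: zeros_def)
  finally show ?thesis unfolding M_trunc_eq using assms by (intro mult_left_mono) auto
qed

text \<open>Since \<open>Lim\<close> has a meaning only for convergent functions, both limits have
  to be established. The outer one exists because the inner limit m is antitone in \<sigma> and
  bounded. The bound is proved on generic lines, to which monotonicity reduces the others.\<close>

lemma mean_counting_le:
  assumes mean: "\<And>\<sigma>. \<sigma> > 0 \<Longrightarrow> \<forall>\<^sub>F X in at_top. integral {- X..X} (\<lambda>t. cmod (f (Complex \<sigma> t))) / (2 * X) \<le> \<epsilon> / 2"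
  shows "mean_counting f \<xi> \<le> L - (1 - \<epsilon>) * (1 - (cmod \<xi>)\<^sup>2) / 2"
proof -
  define B where "B = L - (1 - \<epsilon>) * (1 - (cmod \<xi>)\<^sup>2) / 2"
  define m where "m = (\<lambda>\<sigma>. Lim at_top (\<lambda>X. M_trunc f \<xi> \<sigma> X))"
  have m: "((\<lambda>X. M_trunc f \<xi> \<sigma> X) \<longlongrightarrow> m \<sigma>) at_top" if "\<sigma> > 0" for \<sigma>
    using M_trunc_converges[OF that] unfolding m_def by (metis tendsto_Lim trivial_limit_at_top_linorder)
  have anti: "m \<sigma>' \<le> m \<sigma>" if "0 < \<sigma>" "\<sigma> \<le> \<sigma>'" for \<sigma> \<sigma>'
  proof (rule tendsto_le[OF _ m m])
    show "\<forall>\<^sub>F X in at_top. M_trunc f \<xi> \<sigma>' X \<le> M_trunc f \<xi> \<sigma> X"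
      by (rule eventually_mono[OF eventually_gt_at_top[of 0]]) (use M_trunc_antimono that in auto)
  qed (use that in auto)
  have gen: "m \<sigma> \<le> B" if s: "0 < \<sigma>" "\<sigma> < 1" and g: "\<And>p. p \<in> all_zeros \<Longrightarrow> Re p \<noteq> \<sigma>" for \<sigma>
  proof (rule field_le_epsilon)
    fix \<eta> :: real assume \<eta>: "\<eta> > 0"
    obtain X0 where X0: "X0 > 0" "\<And>\<sigma> X. 0 < \<sigma> \<Longrightarrow> \<sigma> < 1 \<Longrightarrow> X \<ge> X0 \<Longrightarrow> (\<And>p. p \<in> all_zeros \<Longrightarrow> Re p \<noteq> \<sigma>)
       \<Longrightarrow> \<bar>W \<sigma> X / (2 * X) - L\<bar> \<le> \<eta>" using W_asymptotics[OF \<eta>] by metis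
    show "m \<sigma> \<le> B + \<eta>"
    proof (rule tendsto_upperbound[OF m[OF s(1)]])
      show "\<forall>\<^sub>F X in at_top. M_trunc f \<xi> \<sigma> X \<le> B + \<eta>"
        using mean[OF s(1)] eventually_ge_at_top[of X0]
      proof eventually_elim
        case (elim X)
        then have X: "X > 0" using X0(1) by simp
        define c where "c = (1 - (cmod \<xi>)\<^sup>2) / 2"
        have c: "c \<ge> 0" using xi unfolding c_def by (simp add: abs_square_le_1)
        have cf: "continuous_on {- X..X} (\<lambda>t. cmod (f (Complex \<sigma> t)))"
          by (intro continuous_on_norm continuous_on_compose2[OF holomorphic_on_imp_continuous_on[OF holo]])
            (use s in \<open>auto simp: Complex_eq intro!: continuous_intros\<close>)
        have "integral {- X..X} (\<lambda>t. c * (1 - 2 * cmod (f (Complex \<sigma> t)))) \<le> integral {- X..X} (gl \<sigma>)"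
        proof (rule integral_le)
          show "(\<lambda>t. c * (1 - 2 * cmod (f (Complex \<sigma> t)))) integrable_on {- X..X}"
            by (intro integrable_continuous_interval continuous_intros cf)
          show "gl \<sigma> integrable_on {- X..X}"
            by (intro integrable_continuous_interval continuous_on_gl_vertical s g)
          show "c * (1 - 2 * cmod (f (Complex \<sigma> t))) \<le> gl \<sigma> t" for t
            unfolding c_def gl_def using s xi disc g[of "Complex \<sigma> t"]
            by (intro green_lower_bound) (auto simp: all_zeros_def)
        qed
        also have "integral {- X..X} (\<lambda>t. c * (1 - 2 * cmod (f (Complex \<sigma> t))))
            = c * (2 * X - 2 * integral {- X..X} (\<lambda>t. cmod (f (Complex \<sigma> t))))"
        proof -
          have "(\<lambda>t. cmod (f (Complex \<sigma> t))) integrable_on {- X..X}" by (rule integrable_continuous_interval[OF cf])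
          then have "integral {- X..X} (\<lambda>t. 1 - 2 * cmod (f (Complex \<sigma> t))) = integral {- X..X} (\<lambda>t. 1) - integral {- X..X} (\<lambda>t. 2 * cmod (f (Complex \<sigma> t)))"
            by (intro integral_diff integrable_on_mult_right) auto
          then show ?thesis using X by simp
        qed
        finally have "c * (2 * X - 2 * integral {- X..X} (\<lambda>t. cmod (f (Complex \<sigma> t)))) / (2 * X) \<le> integral {- X..X} (gl \<sigma>) / (2 * X)"
          using X by (intro divide_right_mono) auto
        moreover have "c * (2 * X - 2 * integral {- X..X} (\<lambda>t. cmod (f (Complex \<sigma> t)))) / (2 * X)
           = c * (1 - 2 * (integral {- X..X} (\<lambda>t. cmod (f (Complex \<sigma> t))) / (2 * X)))"
          using X by (simp add: field_simps)
        moreover have "c * (1 - 2 * (\<epsilon> / 2)) \<le> c * (1 - 2 * (integral {- X..X} (\<lambda>t. cmod (f (Complex \<sigma> t))) / (2 * X)))"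
          using elim c by (intro mult_left_mono) auto
        ultimately have "c * (1 - \<epsilon>) \<le> integral {- X..X} (gl \<sigma>) / (2 * X)" by simp
        moreover have "\<bar>W \<sigma> X / (2 * X) - L\<bar> \<le> \<eta>" by (rule X0(2)[OF s elim(2) g])
        moreover have "B = L - c * (1 - \<epsilon>)" unfolding B_def c_def by (simp add: mult.commute)
        ultimately show ?case unfolding M_trunc_W[OF X] by linarith
      qed
    qed simp
  qed
  have mB: "m \<sigma> \<le> B" if \<sigma>: "0 < \<sigma>" for \<sigma>
  proof -
    obtain \<sigma>' where "0 < \<sigma>'" "\<sigma>' < min \<sigma> 1" "\<And>p. p \<in> all_zeros \<Longrightarrow> Re p \<noteq> \<sigma>'"
      using generic_abscissa[of 0 "min \<sigma> 1"] \<sigma> by auto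
    then show ?thesis using gen[of \<sigma>'] anti[of \<sigma>' \<sigma>] by auto
  qed
  define l where "l = (SUP \<sigma>\<in>{0<..}. m \<sigma>)"
  have bdd: "bdd_above (m ` {0<..})" using mB by (auto intro!: bdd_aboveI2)
  have "(m \<longlongrightarrow> l) (at_right 0)"
  proof (rule order_tendstoI)
    fix a assume "a < l"
    then obtain \<sigma> where \<sigma>: "\<sigma> > 0" "a < m \<sigma>" unfolding l_def using less_cSUP_iff[OF _ bdd, of a] by auto
    have "\<forall>\<^sub>F x in at_right 0. x \<in> {0<..<\<sigma>}" by (rule eventually_at_right_real[OF \<sigma>(1)])
    then show "\<forall>\<^sub>F x in at_right 0. a < m x"
      by (rule eventually_mono) (use \<sigma> anti in \<open>fastforce intro: less_le_trans\<close>)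
  next
    fix a assume a: "l < a"
    have "\<forall>\<^sub>F x in at_right 0. x \<in> {0<..<(1::real)}" by (rule eventually_at_right_real) simp
    then show "\<forall>\<^sub>F x in at_right 0. m x < a"
    proof (rule eventually_mono)
      fix x :: real assume "x \<in> {0<..<1}"
      then have "m x \<le> l" unfolding l_def by (intro cSUP_upper bdd) auto
      then show "m x < a" using a by simp
    qed
  qed
  then have "mean_counting f \<xi> = l"
    unfolding mean_counting_def m_def[symmetric] by (intro tendsto_Lim) (auto simp: trivial_limit_at_right_real)
  also have "l \<le> B" unfolding l_def by (rule cSUP_least) (use mB in auto)
  finally show ?thesis by (simp add: B_def)
qed

end

subsection \<open>The exceptional set\<close>

lemma measurable_log_kernel_pos:
  "(\<lambda>x. log_kernel_pos (fst x) (snd x)) \<in> borel_measurable (borel \<Otimes>\<^sub>M borel)"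
  unfolding log_kernel_pos_def by measurable

text \<open>Carries a bound for a potential from a compact set F to the whole plane: for w' a point
  of F nearest to w, dist w' \<zeta> <= 2 dist w \<zeta> for all \<zeta> in F, at the price of ln 2
  in the kernel. The second premise covers the infinite diagonal value.\<close>

lemma log_kernel_pos_le_nearest:
  assumes "dist w' \<zeta> \<le> 2 * dist w \<zeta>" "w = \<zeta> \<Longrightarrow> w' = \<zeta>"
  shows "log_kernel_pos w \<zeta> \<le> log_kernel_pos w' \<zeta> + ennreal (ln 2)"
proof (cases "w' = \<zeta>")
  case False
  then have ne: "w \<noteq> \<zeta>" using assms(2) by blast
  have "ln (cmod (w' - \<zeta>)) \<le> ln (2 * cmod (w - \<zeta>))"
    using False ne assms(1) by (subst ln_le_cancel_iff) (auto simp: dist_norm)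
  also have "\<dots> = ln 2 + ln (cmod (w - \<zeta>))" using ne by (simp add: ln_mult)
  finally have "max 0 (- ln (cmod (w - \<zeta>))) \<le> max 0 (- ln (cmod (w' - \<zeta>))) + ln 2" by (simp add: max_def)
  then have "ennreal (max 0 (- ln (cmod (w - \<zeta>)))) \<le> ennreal (max 0 (- ln (cmod (w' - \<zeta>))) + ln 2)" by (rule ennreal_leI)
  then show ?thesis using False ne by (simp add: log_kernel_pos_def)
qed (simp add: log_kernel_pos_def)

lemma green_le_log_kernel_pos:
  assumes "cmod \<xi> < 1" "cmod w < 1" shows "ennreal (green \<xi> w) \<le> log_kernel_pos w \<xi> + ennreal (ln 2)"
proof (cases "w = \<xi>")
  case False
  have a: "cmod (1 - cnj \<xi> * w) > 0" using one_minus_cnj_mult_nonzero[OF assms] by simp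
  have "cmod (1 - cnj \<xi> * w) \<le> 1 + cmod (cnj \<xi> * w)" using norm_triangle_ineq4[of 1 "cnj \<xi> * w"] by simp
  also have "cmod (cnj \<xi> * w) \<le> 1 * 1" unfolding norm_mult using assms by (intro mult_mono) auto
  finally have "ln (cmod (1 - cnj \<xi> * w)) \<le> ln 2" using a by simp
  moreover have "green \<xi> w = ln (cmod (1 - cnj \<xi> * w)) - ln (cmod (w - \<xi>))"
    using a False unfolding green_def norm_minus_commute[of \<xi> w] by (simp add: ln_div)
  ultimately have "green \<xi> w \<le> max 0 (- ln (cmod (w - \<xi>))) + ln 2" by linarith
  then have "ennreal (green \<xi> w) \<le> ennreal (max 0 (- ln (cmod (w - \<xi>))) + ln 2)" by (rule ennreal_leI)
  then show ?thesis using False by (simp add: log_kernel_pos_def)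
qed (simp add: log_kernel_pos_def)

text \<open>ln u <= u - 1 for the inverse u of the squared pseudo-hyperbolic distance, whose
  denominator stays away from 0 because |\<xi> - w| >= (1 - r) / 2.\<close>

lemma green_le_near_circle:
  assumes "cmod \<xi> \<le> r" "r < 1" "(1 + r) / 2 \<le> cmod w" "cmod w < 1"
  shows "green \<xi> w \<le> 4 / (1 - r)\<^sup>2 * (1 - cmod w)"
proof -
  define a b where "a = cmod (1 - cnj \<xi> * w)" and "b = cmod (\<xi> - w)"
  have r0: "r \<ge> 0" using assms(1) norm_ge_zero order_trans by blast
  have b: "b \<ge> (1 - r) / 2"
    using norm_triangle_ineq2[of w \<xi>] assms unfolding b_def by (simp add: norm_minus_commute field_simps)
  then have b0: "b > 0" using assms(2) by simp
  have a0: "a > 0" using one_minus_cnj_mult_nonzero[of \<xi> w] assms by (simp add: a_def)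
  have id: "a\<^sup>2 - b\<^sup>2 = (1 - (cmod \<xi>)\<^sup>2) * (1 - (cmod w)\<^sup>2)"
    unfolding a_def b_def by (rule pseudo_hyperbolic_identity)
  have "ln ((a / b)\<^sup>2) = 2 * (ln a - ln b)" using a0 b0 by (simp add: ln_div ln_realpow)
  then have "green \<xi> w = ln ((a / b)\<^sup>2) / 2"
    unfolding green_def a_def[symmetric] b_def[symmetric] using a0 b0 by (simp add: ln_div diff_divide_distrib)
  also have "\<dots> \<le> ((a / b)\<^sup>2 - 1) / 2" using a0 b0 by (intro divide_right_mono ln_le_minus_one) auto
  also have "(a / b)\<^sup>2 - 1 = (1 - (cmod \<xi>)\<^sup>2) * (1 - (cmod w)\<^sup>2) / b\<^sup>2"
    unfolding id[symmetric] using b0 by (simp add: power_divide diff_divide_distrib)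
  also have "\<dots> \<le> 1 * (2 * (1 - cmod w)) / ((1 - r) / 2)\<^sup>2"
  proof (rule frac_le)
    have "(1 - (cmod w)\<^sup>2) = (1 + cmod w) * (1 - cmod w)" by (simp add: power2_eq_square algebra_simps)
    also have "\<dots> \<le> 2 * (1 - cmod w)" using assms by (intro mult_right_mono) auto
    finally show "(1 - (cmod \<xi>)\<^sup>2) * (1 - (cmod w)\<^sup>2) \<le> 1 * (2 * (1 - cmod w))"
      using assms by (intro mult_mono) (auto simp: abs_square_le_1)
    show "((1 - r) / 2)\<^sup>2 \<le> b\<^sup>2" using b assms by (intro power_mono) auto
  qed (use assms in auto)
  finally have "green \<xi> w \<le> 1 * (2 * (1 - cmod w)) / ((1 - r) / 2)\<^sup>2 / 2" by (simp add: divide_right_mono)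
  moreover have "1 * (2 * y) / (Z / 4) / 2 = 4 / Z * y" for y Z :: real by simp
  moreover have "((1 - r) / 2)\<^sup>2 = (1 - r)\<^sup>2 / 4" by (simp add: power_divide)
  ultimately show ?thesis by metis
qed

text \<open>A measure of finite energy has a nonzero restriction to a compact set on which the potential is
  bounded; the Green potential of that restriction is then bounded and vanishes linearly on the unit circle.\<close>
lemma finite_energy_green_potential:
  fixes \<mu> :: "complex measure"
  assumes K: "compact K" "K \<subseteq> ball 0 1" and sets: "sets \<mu> = sets borel" and fin: "finite_measure \<mu>"
    and conc: "emeasure \<mu> (space \<mu> - K) = 0" and nz: "emeasure \<mu> (space \<mu>) \<noteq> 0"
    and energy: "(\<integral>\<^sup>+ z. (\<integral>\<^sup>+ w. log_kernel_pos z w \<partial>\<mu>) \<partial>\<mu>) \<noteq> \<infinity>"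
  obtains F D where "compact F" "F \<subseteq> K" "emeasure \<mu> F > 0" "D \<ge> 0"
    "\<And>w. cmod w < 1 \<Longrightarrow> (\<integral>\<^sup>+ \<xi>. ennreal (green \<xi> w) * indicator F \<xi> \<partial>\<mu>) \<le> ennreal (D * (1 - cmod w))"
proof -
  interpret finite_measure \<mu> by (rule fin)
  have sp: "space \<mu> = UNIV" using sets sets_eq_imp_space_eq by fastforce
  define U where "U = (\<lambda>z. \<integral>\<^sup>+ w. log_kernel_pos z w \<partial>\<mu>)"
  have mk: "(\<lambda>x. log_kernel_pos (fst x) (snd x)) \<in> borel_measurable (borel \<Otimes>\<^sub>M \<mu>)"
    using measurable_log_kernel_pos measurable_cong_sets[OF sets_pair_measure_cong[OF refl sets]] by blast
  have mU: "U \<in> borel_measurable borel"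
    unfolding U_def by (rule borel_measurable_nn_integral) (use mk in \<open>simp add: case_prod_unfold\<close>)
  have mk1: "(\<lambda>w. log_kernel_pos z w) \<in> borel_measurable \<mu>" for z
    unfolding log_kernel_pos_def by (subst measurable_cong_sets[OF sets refl]) measurable
  have Kb: "K \<in> sets borel" using K(1) by (simp add: borel_closed compact_imp_closed)
  have mU': "U \<in> borel_measurable \<mu>" using mU measurable_cong_sets[OF sets refl] by blast
  have "(\<integral>\<^sup>+ z. U z \<partial>\<mu>) \<noteq> \<infinity>" using energy unfolding U_def .
  with mU' have "AE z in \<mu>. U z \<noteq> \<infinity>" by (rule nn_integral_PInf_AE)
  moreover have "AE z in \<mu>. z \<in> K"
  proof (rule AE_I[of _ _ "space \<mu> - K"])
    show "space \<mu> - K \<in> sets \<mu>" using Kb sets sp by auto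
  qed (use conc in auto)
  \<comment> \<open>The potential is finite almost everywhere, so its sublevel sets exhaust K up to
    a null set and one of them has positive measure.\<close>
  ultimately have AEU: "AE z in \<mu>. z \<in> (\<Union>n. {z \<in> K. U z \<le> of_nat n})"
  proof eventually_elim
    case (elim z)
    then obtain n where "U z < of_nat n" using ennreal_Ex_less_of_nat[of "U z"] by (auto simp: top.not_eq_extremum)
    then show ?case using elim by (auto intro!: exI[of _ n] less_imp_le)
  qed
  have ms: "{z \<in> K. U z \<le> of_nat n} \<in> sets \<mu>" for n
  proof -
    have "{z \<in> K. U z \<le> of_nat n} = K \<inter> {z \<in> space borel. U z \<le> of_nat n}" by auto
    also have "\<dots> \<in> sets borel" using Kb mU by (intro sets.Int borel_measurable_le) auto
    finally show ?thesis by (simp add: sets)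
  qed
  have "\<exists>n. emeasure \<mu> {z \<in> K. U z \<le> of_nat n} \<noteq> 0"
  proof (rule ccontr)
    assume "\<nexists>n. emeasure \<mu> {z \<in> K. U z \<le> of_nat n} \<noteq> 0"
    then have "(\<Union>n. {z \<in> K. U z \<le> of_nat n}) \<in> null_sets \<mu>" using ms by (intro null_sets_UN) (auto simp: null_sets_def)
    then have "AE z in \<mu>. z \<notin> (\<Union>n. {z \<in> K. U z \<le> of_nat n})" by (rule AE_not_in)
    with AEU have "AE z in \<mu>. False" by eventually_elim auto
    then have "space \<mu> \<in> null_sets \<mu>" by (simp add: AE_iff_null_sets[symmetric] AE_iff_null)
    then show False using nz by (simp add: null_sets_def)
  qed
  then obtain n where n: "emeasure \<mu> {z \<in> K. U z \<le> of_nat n} \<noteq> 0" by blast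
  \<comment> \<open>Inner regularity replaces the sublevel set by a compact F, on which nearest
    points and the largest modulus are attained.\<close>
  have "emeasure \<mu> {z \<in> K. U z \<le> of_nat n} = (SUP F\<in>{F. F \<subseteq> {z \<in> K. U z \<le> of_nat n} \<and> compact F}. emeasure \<mu> F)"
    by (rule inner_regular) (use sets ms emeasure_finite in auto)
  with n obtain F where F: "F \<subseteq> {z \<in> K. U z \<le> of_nat n}" "compact F" "emeasure \<mu> F > 0"
    by (metis (mono_tags, lifting) SUP_least le_zero_eq mem_Collect_eq not_gr_zero)
  have Fb: "F \<in> sets \<mu>" using F(2) sets by (simp add: borel_closed compact_imp_closed)
  have Fne: "F \<noteq> {}" using F(3) by auto
  have FK: "F \<subseteq> K" using F by auto
  define c where "c = measure \<mu> F"
  have c: "emeasure \<mu> F = ennreal c" unfolding c_def by (rule emeasure_eq_measure)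
  \<comment> \<open>One ln 2 comes from passing to a nearest point of F, the other from comparing
    the Green function with the logarithmic kernel.\<close>
  define M where "M = real n + 2 * ln 2 * c"
  have c0: "c \<ge> 0" by (simp add: c_def)
  have M0: "M \<ge> 0" using c0 by (simp add: M_def)
  have near: "(\<integral>\<^sup>+ \<xi>. log_kernel_pos w \<xi> * indicator F \<xi> \<partial>\<mu>) \<le> ennreal (real n) + ennreal (ln 2) * ennreal c" for w
  proof -
    obtain w' where w': "w' \<in> F" "\<And>\<zeta>. \<zeta> \<in> F \<Longrightarrow> dist w w' \<le> dist w \<zeta>"
      using distance_attains_inf[OF compact_imp_closed[OF F(2)] Fne] by blast
    have "(\<integral>\<^sup>+ \<xi>. log_kernel_pos w \<xi> * indicator F \<xi> \<partial>\<mu>) \<le> (\<integral>\<^sup>+ \<xi>. log_kernel_pos w' \<xi> + ennreal (ln 2) * indicator F \<xi> \<partial>\<mu>)"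
    proof (rule nn_integral_mono)
      fix \<xi>
      show "log_kernel_pos w \<xi> * indicator F \<xi> \<le> log_kernel_pos w' \<xi> + ennreal (ln 2) * indicator F \<xi>"
      proof (cases "\<xi> \<in> F")
        case True
        have "dist w' \<xi> \<le> 2 * dist w \<xi>" using w'(2)[OF True] dist_triangle[of w' \<xi> w] by (simp add: dist_commute)
        moreover have "w = \<xi> \<Longrightarrow> w' = \<xi>" using w'(2)[OF True] by simp
        ultimately show ?thesis using log_kernel_pos_le_nearest[of w' \<xi> w] True by simp
      qed simp
    qed
    also have "\<dots> = U w' + (\<integral>\<^sup>+ \<xi>. ennreal (ln 2) * indicator F \<xi> \<partial>\<mu>)"
      unfolding U_def using Fb by (intro nn_integral_add mk1) auto
    also have "\<dots> = U w' + ennreal (ln 2) * ennreal c"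
      using Fb by (simp add: nn_integral_cmult_indicator c)
    also have "U w' \<le> ennreal (real n)" using w'(1) F(1) by (auto simp: ennreal_of_nat_eq_real_of_nat)
    finally show ?thesis by (simp add: add_right_mono)
  qed
  have bound1: "(\<integral>\<^sup>+ \<xi>. ennreal (green \<xi> w) * indicator F \<xi> \<partial>\<mu>) \<le> ennreal M" if w: "cmod w < 1" for w
  proof -
    have "(\<integral>\<^sup>+ \<xi>. ennreal (green \<xi> w) * indicator F \<xi> \<partial>\<mu>) \<le> (\<integral>\<^sup>+ \<xi>. log_kernel_pos w \<xi> * indicator F \<xi> + ennreal (ln 2) * indicator F \<xi> \<partial>\<mu>)"
      using FK K(2) green_le_log_kernel_pos[OF _ w]
      by (intro nn_integral_mono) (fastforce split: split_indicator)
    also have "\<dots> = (\<integral>\<^sup>+ \<xi>. log_kernel_pos w \<xi> * indicator F \<xi> \<partial>\<mu>) + ennreal (ln 2) * ennreal c"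
      using Fb by (subst nn_integral_add) (auto simp: nn_integral_cmult_indicator c intro!: borel_measurable_times_ennreal mk1)
    also have "\<dots> \<le> (ennreal (real n) + ennreal (ln 2) * ennreal c) + ennreal (ln 2) * ennreal c"
      by (intro add_right_mono near)
    also have "\<dots> = ennreal M" unfolding M_def using c0 by (simp add: ennreal_mult'[symmetric] ennreal_plus[symmetric] del: ennreal_plus)
    finally show ?thesis .
  qed
  obtain x where x: "x \<in> F" "\<And>y. y \<in> F \<Longrightarrow> cmod y \<le> cmod x"
    using continuous_attains_sup[OF F(2) Fne, of cmod] by (auto intro: continuous_intros)
  define r where "r = cmod x"
  have r: "0 \<le> r" "r < 1" using x(1) FK K(2) by (auto simp: r_def)
  have bound2: "(\<integral>\<^sup>+ \<xi>. ennreal (green \<xi> w) * indicator F \<xi> \<partial>\<mu>) \<le> ennreal (4 / (1 - r)\<^sup>2 * (1 - cmod w) * c)"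
    if w: "(1 + r) / 2 \<le> cmod w" "cmod w < 1" for w
  proof -
    have "(\<integral>\<^sup>+ \<xi>. ennreal (green \<xi> w) * indicator F \<xi> \<partial>\<mu>) \<le> (\<integral>\<^sup>+ \<xi>. ennreal (4 / (1 - r)\<^sup>2 * (1 - cmod w)) * indicator F \<xi> \<partial>\<mu>)"
    proof (rule nn_integral_mono)
      fix \<xi>
      have "ennreal (green \<xi> w) \<le> ennreal (4 / (1 - r)\<^sup>2 * (1 - cmod w))" if "\<xi> \<in> F"
        by (intro ennreal_leI green_le_near_circle[OF _ r(2) w]) (use x that in \<open>auto simp: r_def\<close>)
      then show "ennreal (green \<xi> w) * indicator F \<xi> \<le> ennreal (4 / (1 - r)\<^sup>2 * (1 - cmod w)) * indicator F \<xi>"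
        by (auto split: split_indicator)
    qed
    also have "\<dots> = ennreal (4 / (1 - r)\<^sup>2 * (1 - cmod w)) * ennreal c"
      using Fb by (simp add: nn_integral_cmult_indicator c)
    also have "\<dots> = ennreal (4 / (1 - r)\<^sup>2 * (1 - cmod w) * c)" by (rule ennreal_mult''[OF c0, symmetric])
    finally show ?thesis .
  qed
  \<comment> \<open>The second summand serves w near the circle. Elsewhere 1 - |w| > (1 - r) / 2, so
    the constant bound M is at most the first summand times 1 - |w|.\<close>
  define D where "D = M * (2 / (1 - r)) + 4 / (1 - r)\<^sup>2 * c"
  have D1: "0 \<le> M * (2 / (1 - r))" "0 \<le> 4 / (1 - r)\<^sup>2 * c" using M0 r c0 by simp_all
  show ?thesis
  proof (rule that[OF F(2) FK F(3), of D])
    show "D \<ge> 0" using D1 by (simp add: D_def)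
    fix w :: complex assume w: "cmod w < 1"
    show "(\<integral>\<^sup>+ \<xi>. ennreal (green \<xi> w) * indicator F \<xi> \<partial>\<mu>) \<le> ennreal (D * (1 - cmod w))"
    proof (cases "(1 + r) / 2 \<le> cmod w")
      case True
      have "4 / (1 - r)\<^sup>2 * (1 - cmod w) * c \<le> D * (1 - cmod w)"
        using mult_right_mono[of "4 / (1 - r)\<^sup>2 * c" D "1 - cmod w"] D1 w unfolding D_def by (simp add: mult_ac)
      then show ?thesis using bound2[OF True w] ennreal_leI order_trans by blast
    next
      case False
      have "M * 1 \<le> M * (2 / (1 - r) * (1 - cmod w))"
        using False r M0 by (intro mult_left_mono) (auto simp: field_simps)
      also have "\<dots> \<le> D * (1 - cmod w)"
        using mult_right_mono[of "M * (2 / (1 - r))" D "1 - cmod w"] D1 w unfolding D_def by (simp add: mult_ac)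
      finally show ?thesis using bound1[OF w] ennreal_leI order_trans by (metis mult.right_neutral)
    qed
  qed
qed

section \<open>A Frostman theorem for the unweighted counting function\<close>

context half_plane_map begin

text \<open>A measure of finite energy on K gives a compact F of positive measure with Green
  potential O(1 - |w|). Integrated over \<xi> in F, the Green integrals of f on the given lines tend
  to 0. Fatou yields a \<xi> in F along which their liminf is 0, and \<open>N_count_tendsto\<close>
  contradicts that \<xi> is exceptional. The abscissa is averaged over [s / 2, s] because the lines
  to be avoided depend on \<xi>.\<close>

lemma exceptional_set_capacity_zero:
  assumes inner: "\<And>n::nat. \<exists>s>0. s \<le> 1 / (real n + 1) \<and>
     (\<forall>\<sigma>\<in>{s / 2..s}. integral {- real n..real n} (\<lambda>t. 1 - cmod (f (Complex \<sigma> t))) \<le> 1 / (real n + 1))"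
  shows "log_capacity_zero {\<xi> \<in> ball 0 1 - {0}. \<not> ((\<lambda>T. N_count f \<xi> T) \<longlongrightarrow> ennreal (ln (1 / cmod \<xi>))) at_top}"
    (is "log_capacity_zero ?E")
  unfolding log_capacity_zero_def
proof (intro allI impI, elim conjE)
  fix \<mu> :: "complex measure" and K
  assume K: "compact K" "K \<subseteq> ?E" and sets: "sets \<mu> = sets borel" and fin: "finite_measure \<mu>"
    and conc: "emeasure \<mu> (space \<mu> - K) = 0" and nz: "emeasure \<mu> (space \<mu>) \<noteq> 0"
  show "(\<integral>\<^sup>+ z. (\<integral>\<^sup>+ w. log_kernel_pos z w \<partial>\<mu>) \<partial>\<mu>) = \<infinity>"
  proof (rule ccontr)
    assume energy: "(\<integral>\<^sup>+ z. (\<integral>\<^sup>+ w. log_kernel_pos z w \<partial>\<mu>) \<partial>\<mu>) \<noteq> \<infinity>"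
    have Kb: "K \<subseteq> ball 0 1" using K(2) by auto
    obtain F D where F: "compact F" "F \<subseteq> K" "emeasure \<mu> F > 0" and D: "D \<ge> 0"
      "\<And>w. cmod w < 1 \<Longrightarrow> (\<integral>\<^sup>+ \<xi>. ennreal (green \<xi> w) * indicator F \<xi> \<partial>\<mu>) \<le> ennreal (D * (1 - cmod w))"
      using finite_energy_green_potential[OF K(1) Kb sets fin conc nz energy] by metis
    obtain s where s: "\<And>n. s n > 0" "\<And>n. s n \<le> 1 / (real n + 1)"
      "\<And>n \<sigma>. \<sigma> \<in> {s n / 2..s n} \<Longrightarrow> integral {- real n..real n} (\<lambda>t. 1 - cmod (f (Complex \<sigma> t))) \<le> 1 / (real n + 1)"
      using inner by metis
    interpret \<mu>: finite_measure \<mu> by (rule fin)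
    interpret pair_sigma_finite \<mu> "lborel :: (real \<times> real) measure"
      by (rule pair_sigma_finite.intro) (rule \<mu>.sigma_finite_measure_axioms, rule lborel.sigma_finite_measure_axioms)
    \<comment> \<open>Extension by 0, to have a Borel function with values in the disc on the whole
      plane.\<close>
    define f' where "f' = (\<lambda>z. if z \<in> {z. Re z > 0} then f z else 0)"
    have f'disc: "cmod (f' z) < 1" for z using disc by (simp add: f'_def)
    have mf'[measurable]: "f' \<in> borel_measurable borel"
      unfolding f'_def
      by (rule borel_measurable_continuous_on_if)
        (auto simp: holo holomorphic_on_imp_continuous_on open_halfspace_Re_gt)
    have mC[measurable]: "(\<lambda>p. Complex (fst p) (snd p)) \<in> borel_measurable borel"
      unfolding Complex_eq by (intro borel_measurable_continuous_onI continuous_intros)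
    have em3: "ennreal a * (ennreal b * ennreal c) = ennreal (a * (b * c))" if "0 \<le> a" "0 \<le> b" "0 \<le> c" for a b c
      using that by (simp add: ennreal_mult)
    define R where "R = (\<lambda>n. {s n / 2..s n} \<times> {- real n..real n})"
    have R[measurable]: "R n \<in> sets borel" for n
      unfolding R_def by (intro borel_closed closed_Times) auto
    define h where "h = (\<lambda>n \<xi> p. ennreal (green \<xi> (f' (Complex (fst p) (snd p)))) * indicator (R n) p)"
    have mg: "(\<lambda>x. green (fst x) (snd x)) \<in> borel_measurable (borel \<Otimes>\<^sub>M borel)"
      unfolding green_def borel_prod
      by (intro borel_measurable_ln borel_measurable_divide borel_measurable_continuous_onI continuous_intros)
    have mh: "(\<lambda>x. h n (fst x) (snd x)) \<in> borel_measurable (\<mu> \<Otimes>\<^sub>M lborel)" for n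
    proof -
      have "(\<lambda>x. h n (fst x) (snd x)) \<in> borel_measurable (borel \<Otimes>\<^sub>M borel)"
        unfolding h_def
      proof (intro borel_measurable_times_ennreal)
        have "(\<lambda>x. (fst x, f' (Complex (fst (snd x)) (snd (snd x))))) \<in> borel \<Otimes>\<^sub>M borel \<rightarrow>\<^sub>M borel \<Otimes>\<^sub>M borel"
          by (intro measurable_Pair measurable_fst measurable_compose[OF measurable_compose[OF measurable_snd mC] mf'])
        from measurable_compose[OF measurable_compose[OF this mg] measurable_ennreal]
        show "(\<lambda>x. ennreal (green (fst x) (f' (Complex (fst (snd x)) (snd (snd x)))))) \<in> borel_measurable (borel \<Otimes>\<^sub>M borel)" by simp
        show "(\<lambda>x. indicator (R n) (snd x)) \<in> borel_measurable (borel \<Otimes>\<^sub>M borel)"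
          by (rule measurable_compose[OF measurable_snd borel_measurable_indicator[OF R]])
      qed
      then show ?thesis
        using measurable_cong_sets[OF sets_pair_measure_cong[OF sets sets_lborel] refl] by blast
    qed
    have Fb[measurable]: "F \<in> sets \<mu>" using F(1) sets by (simp add: borel_closed compact_imp_closed)
    have mhF: "(\<lambda>x. h n (fst x) (snd x) * indicator F (fst x)) \<in> borel_measurable (\<mu> \<Otimes>\<^sub>M lborel)" for n
      using mh by (intro borel_measurable_times_ennreal) auto
    have cf: "continuous_on X (\<lambda>t. f (Complex \<sigma> t))" if "\<sigma> > 0" for X \<sigma>
      by (rule continuous_on_compose2[OF holomorphic_on_imp_continuous_on[OF holo]])
        (use that in \<open>auto simp: Complex_eq intro!: continuous_intros\<close>)
    \<comment> \<open>The mean over the abscissae in [s n / 2, s n], an interval of length s n / 2,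
      of the Green integral over |t| <= n.\<close>
    define J where "J = (\<lambda>n \<xi>. ennreal (2 / s n) * (\<integral>\<^sup>+ p. h n \<xi> p \<partial>lborel))"
    have mh1: "h n \<xi> \<in> borel_measurable lborel" for n \<xi>
      using measurable_compose[OF measurable_Pair1' mh, of \<xi>] sets sets_eq_imp_space_eq[OF sets] by simp
    have mJ: "J n \<in> borel_measurable \<mu>" for n
      unfolding J_def by (intro borel_measurable_times_ennreal lborel.borel_measurable_nn_integral) (use mh in \<open>auto simp: case_prod_unfold\<close>)
    have JF: "(\<integral>\<^sup>+ \<xi>. J n \<xi> * indicator F \<xi> \<partial>\<mu>) \<le> ennreal (D / (real n + 1))" for n
    proof -
      have "(\<integral>\<^sup>+ \<xi>. (\<integral>\<^sup>+ p. h n \<xi> p \<partial>lborel) * indicator F \<xi> \<partial>\<mu>) = (\<integral>\<^sup>+ \<xi>. (\<integral>\<^sup>+ p. h n \<xi> p * indicator F \<xi> \<partial>lborel) \<partial>\<mu>)"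
        by (intro nn_integral_cong nn_integral_multc[symmetric] mh1)
      also have "\<dots> = (\<integral>\<^sup>+ p. (\<integral>\<^sup>+ \<xi>. h n \<xi> p * indicator F \<xi> \<partial>\<mu>) \<partial>lborel)"
        by (rule Fubini'[symmetric]) (use mhF in \<open>simp add: case_prod_unfold\<close>)
      also have "\<dots> \<le> (\<integral>\<^sup>+ p. ennreal (D * (1 - cmod (f' (Complex (fst p) (snd p))))) * indicator (R n) p \<partial>lborel)"
      proof (rule nn_integral_mono)
        fix p
        show "(\<integral>\<^sup>+ \<xi>. h n \<xi> p * indicator F \<xi> \<partial>\<mu>) \<le> ennreal (D * (1 - cmod (f' (Complex (fst p) (snd p))))) * indicator (R n) p"
          using D(2)[OF f'disc] by (cases "p \<in> R n") (simp_all add: h_def)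
      qed
      also have "\<dots> = (\<integral>\<^sup>+ p. ennreal (D * (1 - cmod (f' (Complex (fst p) (snd p))))) * indicator (R n) p \<partial>(lborel \<Otimes>\<^sub>M lborel))"
        by (simp only: lborel_prod)
      also have "\<dots> = (\<integral>\<^sup>+ \<sigma>. (\<integral>\<^sup>+ t. ennreal (D * (1 - cmod (f' (Complex \<sigma> t)))) * indicator (R n) (\<sigma>, t) \<partial>lborel) \<partial>lborel)"
      proof (subst lborel.nn_integral_fst[symmetric])
        have "(\<lambda>p. ennreal (D * (1 - cmod (f' (Complex (fst p) (snd p))))) * indicator (R n) p) \<in> borel_measurable borel"
          by measurable
        then show "(\<lambda>p. ennreal (D * (1 - cmod (f' (Complex (fst p) (snd p))))) * indicator (R n) p) \<in> borel_measurable (lborel \<Otimes>\<^sub>M lborel)"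
          by (simp add: lborel_prod)
      qed simp
      also have "\<dots> \<le> (\<integral>\<^sup>+ \<sigma>. ennreal (D / (real n + 1)) * indicator {s n / 2..s n} \<sigma> \<partial>lborel)"
      proof (rule nn_integral_mono)
        fix \<sigma>
        show "(\<integral>\<^sup>+ t. ennreal (D * (1 - cmod (f' (Complex \<sigma> t)))) * indicator (R n) (\<sigma>, t) \<partial>lborel) \<le> ennreal (D / (real n + 1)) * indicator {s n / 2..s n} \<sigma>"
        proof (cases "\<sigma> \<in> {s n / 2..s n}")
          case True
          then have \<sigma>: "\<sigma> > 0" using s(1)[of n] by auto
          have "(\<integral>\<^sup>+ t. ennreal (D * (1 - cmod (f' (Complex \<sigma> t)))) * indicator (R n) (\<sigma>, t) \<partial>lborel)
             = (\<integral>\<^sup>+ t. ennreal (D * (1 - cmod (f (Complex \<sigma> t)))) * indicator {- real n..real n} t \<partial>lborel)"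
            using True \<sigma> by (intro nn_integral_cong) (auto simp: R_def f'_def split: split_indicator)
          also have "\<dots> = ennreal (integral {- real n..real n} (\<lambda>t. D * (1 - cmod (f (Complex \<sigma> t)))))"
          proof (rule nn_integral_has_integral_lebesgue'[OF _ integrable_integral])
            show "0 \<le> D * (1 - cmod (f (Complex \<sigma> t)))" for t using D(1) disc[of "Complex \<sigma> t"] \<sigma> by simp
            show "(\<lambda>t. D * (1 - cmod (f (Complex \<sigma> t)))) integrable_on {- real n..real n}"
              by (intro integrable_continuous_interval continuous_intros cf \<sigma>)
          qed
          also have "\<dots> \<le> ennreal (D * (1 / (real n + 1)))"
            unfolding integral_mult_right by (intro ennreal_leI mult_left_mono s(3) True D(1))
          finally show ?thesis using True by simp
        next
          case False
          then have "indicator (R n) (\<sigma>, t) = (0 :: ennreal)" for t by (auto simp: R_def)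
          then show ?thesis by simp
        qed
      qed
      also have "\<dots> = ennreal (D / (real n + 1)) * ennreal (s n / 2)"
        using s(1)[of n] by (subst nn_integral_cmult_indicator) (auto simp: )
      finally have "(\<integral>\<^sup>+ \<xi>. (\<integral>\<^sup>+ p. h n \<xi> p \<partial>lborel) * indicator F \<xi> \<partial>\<mu>) \<le> ennreal (D / (real n + 1)) * ennreal (s n / 2)" .
      then have "ennreal (2 / s n) * (\<integral>\<^sup>+ \<xi>. (\<integral>\<^sup>+ p. h n \<xi> p \<partial>lborel) * indicator F \<xi> \<partial>\<mu>) \<le> ennreal (2 / s n) * (ennreal (D / (real n + 1)) * ennreal (s n / 2))"
        by (rule mult_left_mono) simp
      also have "\<dots> = ennreal (2 / s n * (D / (real n + 1) * (s n / 2)))"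
        using s(1)[of n] D(1) by (intro em3) auto
      also have "2 / s n * (x * (s n / 2)) = x" for x using s(1)[of n] by simp
      also have "ennreal (2 / s n) * (\<integral>\<^sup>+ \<xi>. (\<integral>\<^sup>+ p. h n \<xi> p \<partial>lborel) * indicator F \<xi> \<partial>\<mu>) = (\<integral>\<^sup>+ \<xi>. J n \<xi> * indicator F \<xi> \<partial>\<mu>)"
      proof -
        have "(\<lambda>\<xi>. (\<integral>\<^sup>+ p. h n \<xi> p \<partial>lborel) * indicator F \<xi>) \<in> borel_measurable \<mu>"
          using mh by (intro borel_measurable_times_ennreal lborel.borel_measurable_nn_integral) (auto simp: case_prod_unfold)
        from nn_integral_cmult[OF this, of "ennreal (2 / s n)"] show ?thesis by (simp add: J_def mult.assoc)
      qed
      finally show ?thesis .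
    qed
    have "(\<integral>\<^sup>+ \<xi>. liminf (\<lambda>n. J n \<xi> * indicator F \<xi>) \<partial>\<mu>) \<le> liminf (\<lambda>n. \<integral>\<^sup>+ \<xi>. J n \<xi> * indicator F \<xi> \<partial>\<mu>)"
      by (rule nn_integral_liminf) (intro borel_measurable_times_ennreal mJ, simp)
    also have "\<dots> \<le> liminf (\<lambda>n. ennreal (D / (real n + 1)))" using JF by (intro Liminf_mono always_eventually) auto
    also have "\<dots> = 0"
    proof -
      have "(\<lambda>n. D / (real n + 1)) \<longlonglongrightarrow> 0" by real_asymp
      then have "(\<lambda>n. ennreal (D / (real n + 1))) \<longlonglongrightarrow> ennreal 0" by (rule tendsto_ennrealI)
      then show ?thesis using lim_imp_Liminf[OF sequentially_bot] by fastforce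
    qed
    finally have "(\<integral>\<^sup>+ \<xi>. liminf (\<lambda>n. J n \<xi> * indicator F \<xi>) \<partial>\<mu>) = 0" by simp
    then have AE0: "AE \<xi> in \<mu>. liminf (\<lambda>n. J n \<xi> * indicator F \<xi>) = 0"
      by (subst (asm) nn_integral_0_iff_AE) (auto intro!: borel_measurable_liminf borel_measurable_times_ennreal mJ)
    have "\<exists>\<xi>\<in>F. liminf (\<lambda>n. J n \<xi>) = 0"
    proof (rule ccontr)
      assume no: "\<not> (\<exists>\<xi>\<in>F. liminf (\<lambda>n. J n \<xi>) = 0)"
      have "AE \<xi> in \<mu>. \<xi> \<notin> F" using AE0
      proof eventually_elim
        case (elim \<xi>)
        then show ?case using no by (auto split: split_indicator_asm)
      qed
      then have "F \<in> null_sets \<mu>" using AE_iff_null_sets[OF Fb] by blast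
      then show False using F(3) by (simp add: null_sets_def)
    qed
    then obtain \<xi> where \<xi>: "\<xi> \<in> F" "liminf (\<lambda>n. J n \<xi>) = 0" by blast
    have \<xi>E: "\<xi> \<in> ?E" using \<xi>(1) F(2) K(2) by blast
    interpret half_plane_value f \<xi> by unfold_locales (use \<xi>E in auto)
    have "((\<lambda>X. N_count f \<xi> X) \<longlongrightarrow> ennreal L) at_top"
    proof (rule N_count_tendsto)
      fix \<delta> X \<sigma>0 :: real assume pos: "\<delta> > 0" "X > 0" "\<sigma>0 > 0"
      obtain N :: nat where N: "X + 1 / \<sigma>0 < real N" using reals_Archimedean2 by blast
      have "\<exists>n\<ge>N. J n \<xi> < ennreal \<delta>"
      proof (rule ccontr)
        assume "\<not> (\<exists>n\<ge>N. J n \<xi> < ennreal \<delta>)"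
        then have "\<forall>\<^sub>F n in sequentially. ennreal \<delta> \<le> J n \<xi>" unfolding eventually_sequentially by (meson not_le)
        then have "ennreal \<delta> \<le> liminf (\<lambda>n. J n \<xi>)" by (rule Liminf_bounded)
        then show False using \<xi>(2) pos by simp
      qed
      then obtain n where n: "n \<ge> N" "J n \<xi> < ennreal \<delta>" by blast
      have nX: "X \<le> real n" "1 / \<sigma>0 < real n + 1" using N n(1) pos divide_pos_pos[OF zero_less_one pos(3)] by linarith+
      have "1 / (real n + 1) < \<sigma>0" using nX(2) pos by (simp add: field_simps)
      then have sn: "s n < \<sigma>0" using s(2)[of n] by linarith
      have "\<exists>\<sigma>\<in>{s n / 2..s n}. (\<forall>p\<in>all_zeros. Re p \<noteq> \<sigma>) \<and> integral {- real n..real n} (gl \<sigma>) < \<delta>"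
      proof (rule ccontr)
        assume no: "\<not> (\<exists>\<sigma>\<in>{s n / 2..s n}. (\<forall>p\<in>all_zeros. Re p \<noteq> \<sigma>) \<and> integral {- real n..real n} (gl \<sigma>) < \<delta>)"
        \<comment> \<open>All but countably many abscissae are generic. If each of them had Green
          integral at least \<delta>, so would the mean \<open>J n \<xi>\<close>.\<close>
        have "AE \<sigma> in lborel. \<sigma> \<notin> Re ` all_zeros"
          by (intro AE_not_in countable_imp_null_set_lborel countable_image countable_all_zeros)
        then have "AE \<sigma> in lborel. ennreal \<delta> * indicator {s n / 2..s n} \<sigma> \<le> (\<integral>\<^sup>+ t. h n \<xi> (\<sigma>, t) \<partial>lborel)"
        proof eventually_elim
          case (elim \<sigma>)
          show ?case
          proof (cases "\<sigma> \<in> {s n / 2..s n}")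
            case True
            then have \<sigma>: "\<sigma> > 0" using s(1)[of n] by auto
            have g: "\<And>p. p \<in> all_zeros \<Longrightarrow> Re p \<noteq> \<sigma>" using elim by blast
            have "\<delta> \<le> integral {- real n..real n} (gl \<sigma>)" using no True g by force
            then have "ennreal \<delta> \<le> ennreal (integral {- real n..real n} (gl \<sigma>))" by (rule ennreal_leI)
            also have "\<dots> = (\<integral>\<^sup>+ t. ennreal (gl \<sigma> t) * indicator {- real n..real n} t \<partial>lborel)"
              by (rule nn_integral_has_integral_lebesgue'[OF _ integrable_integral, symmetric])
                (use gl_nonneg \<sigma> g in \<open>auto intro!: integrable_continuous_interval continuous_on_gl_vertical\<close>)
            also have "\<dots> = (\<integral>\<^sup>+ t. h n \<xi> (\<sigma>, t) \<partial>lborel)"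
              using True \<sigma> by (intro nn_integral_cong) (auto simp: h_def R_def gl_def f'_def split: split_indicator)
            finally show ?thesis using True by simp
          qed simp
        qed
        then have "(\<integral>\<^sup>+ \<sigma>. ennreal \<delta> * indicator {s n / 2..s n} \<sigma> \<partial>lborel) \<le> (\<integral>\<^sup>+ \<sigma>. (\<integral>\<^sup>+ t. h n \<xi> (\<sigma>, t) \<partial>lborel) \<partial>lborel)"
          by (rule nn_integral_mono_AE)
        also have "\<dots> = (\<integral>\<^sup>+ p. h n \<xi> p \<partial>(lborel \<Otimes>\<^sub>M lborel))"
          by (rule lborel.nn_integral_fst) (use mh1[of n \<xi>] in \<open>simp add: lborel_prod\<close>)
        also have "\<dots> = (\<integral>\<^sup>+ p. h n \<xi> p \<partial>lborel)" by (simp only: lborel_prod)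
        also have "(\<integral>\<^sup>+ \<sigma>. ennreal \<delta> * indicator {s n / 2..s n} \<sigma> \<partial>lborel) = ennreal \<delta> * ennreal (s n / 2)"
          using s(1)[of n] by (subst nn_integral_cmult_indicator) auto
        finally have "ennreal (2 / s n) * (ennreal \<delta> * ennreal (s n / 2)) \<le> J n \<xi>"
          unfolding J_def by (rule mult_left_mono) simp
        moreover have "ennreal (2 / s n) * (ennreal \<delta> * ennreal (s n / 2)) = ennreal \<delta>"
        proof -
          have "ennreal (2 / s n) * (ennreal \<delta> * ennreal (s n / 2)) = ennreal (2 / s n * (\<delta> * (s n / 2)))"
            using s(1)[of n] pos by (intro em3) auto
          then show ?thesis using s(1)[of n] by simp
        qed
        ultimately show False using n(2) by simp
      qed
      then obtain \<sigma> where \<sigma>: "\<sigma> \<in> {s n / 2..s n}" "\<forall>p\<in>all_zeros. Re p \<noteq> \<sigma>" "integral {- real n..real n} (gl \<sigma>) < \<delta>" by blast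
      have \<sigma>0: "\<sigma> > 0" using \<sigma>(1) s(1)[of n] by auto
      have "integral {- X..X} (gl \<sigma>) \<le> integral {- real n..real n} (gl \<sigma>)"
        by (rule integral_subset_le) (use nX \<sigma> \<sigma>0 gl_nonneg in \<open>auto intro!: integrable_continuous_interval continuous_on_gl_vertical\<close>)
      then show "\<exists>\<sigma>>0. \<sigma> < \<sigma>0 \<and> (\<forall>p\<in>all_zeros. Re p \<noteq> \<sigma>) \<and> integral {- X..X} (gl \<sigma>) < \<delta>"
        using \<sigma> \<sigma>0 sn by (intro exI[of _ \<sigma>]) auto
    qed
    then show False using \<xi>E by (simp add: L_def)
  qed
qed

end

subsection \<open>Construction of the blocks\<close>

text \<open>Majorant of \<open>ev\<close> on the line Re s = \<sigma>, valid for all points of the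
  torus at once.\<close>

definition l1 :: "laurent \<Rightarrow> real \<Rightarrow> real" where
  "l1 l \<sigma> = (\<Sum>(c, a, b)\<leftarrow>l. cmod c * exp (- freq a b * \<sigma>))"

text \<open>Both exponents are at least 1: the terms belong to integers 2^a 3^b >= 6, there is no
  constant term, and since ln 3 >= 1 every term decays at least like exp (- Re s).\<close>

definition pos_exps :: "laurent \<Rightarrow> bool" where
  "pos_exps l \<longleftrightarrow> (\<forall>(c, a, b)\<in>set l. a \<ge> 1 \<and> b \<ge> 1)"

text \<open>Multiplication by \<open>6 powr (- M s)\<close>.\<close>

definition shift :: "int \<Rightarrow> laurent \<Rightarrow> laurent" where
  "shift M l = map (\<lambda>(c, a, b). (c, a + M, b + M)) l"

lemma l1_simps [simp]: "l1 [] \<sigma> = 0" "l1 ((c, a, b) # l) \<sigma> = cmod c * exp (- freq a b * \<sigma>) + l1 l \<sigma>"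
  by (simp_all add: l1_def)

lemma pos_exps_simps [simp]: "pos_exps []" "pos_exps ((c, a, b) # l) \<longleftrightarrow> a \<ge> 1 \<and> b \<ge> 1 \<and> pos_exps l"
  "pos_exps (l @ m) \<longleftrightarrow> pos_exps l \<and> pos_exps m"
  by (simp_all add: pos_exps_def ball_Un)

lemma shift_simps [simp]: "shift M [] = []" "shift M ((c, a, b) # l) = (c, a + M, b + M) # shift M l"
  by (simp_all add: shift_def)

lemma l1_nonneg: "l1 l \<sigma> \<ge> 0"
  by (induction l) auto

lemma norm_monomial: "w \<in> torus \<Longrightarrow> cmod (monomial a b w s) = exp (- freq a b * Re s)"
  by (auto simp: monomial_def torus_def norm_mult norm_power_int)

lemma norm_ev_le: "w \<in> torus \<Longrightarrow> cmod (ev l w s) \<le> l1 l (Re s)"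
proof (induction l)
  case (Cons x l)
  obtain c a b where x: "x = (c, a, b)" by (cases x)
  have "cmod (ev (x # l) w s) \<le> cmod (c * monomial a b w s) + cmod (ev l w s)"
    unfolding x ev_simps by (rule norm_triangle_ineq)
  also have "\<dots> \<le> l1 (x # l) (Re s)" unfolding x l1_simps norm_mult norm_monomial[OF Cons.prems] using Cons by simp
  finally show ?case .
qed simp

lemma one_le_freq: assumes "a \<ge> 1" "b \<ge> 1" shows "freq a b \<ge> 1"
proof -
  have "1 \<le> ln (3::real)" using exp_le ln_ge_iff[of 3 1] by simp
  moreover have "1 * ln 3 \<le> of_int b * ln (3::real)" using assms by (intro mult_right_mono) auto
  moreover have "0 \<le> of_int a * ln (2::real)" using assms by simp
  ultimately show ?thesis unfolding freq_def by linarith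
qed

lemma l1_decay: "pos_exps l \<Longrightarrow> d \<ge> 0 \<Longrightarrow> l1 l (\<sigma> + d) \<le> exp (- d) * l1 l \<sigma>"
proof (induction l)
  case (Cons x l)
  obtain c a b where x: "x = (c, a, b)" by (cases x)
  have "1 * d \<le> freq a b * d" using Cons.prems one_le_freq[of a b] unfolding x by (intro mult_right_mono) auto
  then have "exp (- freq a b * (\<sigma> + d)) \<le> exp (- d) * exp (- freq a b * \<sigma>)"
    by (simp add: exp_add[symmetric] algebra_simps)
  then have "cmod c * exp (- freq a b * (\<sigma> + d)) \<le> cmod c * (exp (- d) * exp (- freq a b * \<sigma>))"
    by (rule mult_left_mono) simp
  then show ?case using Cons unfolding x l1_simps distrib_left by (simp add: mult_ac)
qed simp

lemma l1_antimono: assumes "pos_exps l" "\<sigma> \<le> \<sigma>'" shows "l1 l \<sigma>' \<le> l1 l \<sigma>"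
proof -
  have "l1 l \<sigma>' \<le> exp (- (\<sigma>' - \<sigma>)) * l1 l \<sigma>" using l1_decay[OF assms(1), of "\<sigma>' - \<sigma>" \<sigma>] assms(2) by simp
  also have "\<dots> \<le> 1 * l1 l \<sigma>" using assms l1_nonneg by (intro mult_right_mono) auto
  finally show ?thesis by simp
qed

lemma freq_add: "freq (a + a') (b + b') = freq a b + freq a' b'"
  by (simp add: freq_def algebra_simps)

lemma ev_shift: "w \<in> torus \<Longrightarrow> ev (shift M l) w s = monomial M M w s * ev l w s"
  by (induction l) (auto simp: monomial_add algebra_simps)

lemma l1_shift: "l1 (shift M l) \<sigma> = exp (- freq M M * \<sigma>) * l1 l \<sigma>"
proof (induction l)
  case (Cons x l)
  obtain c a b where x: "x = (c, a, b)" by (cases x)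
  have "exp (- freq (a + M) (b + M) * \<sigma>) = exp (- freq M M * \<sigma>) * exp (- freq a b * \<sigma>)"
    by (simp add: freq_add exp_add[symmetric] algebra_simps)
  then show ?case using Cons by (simp add: x algebra_simps)
qed simp

lemma filterlim_freq: "filterlim (\<lambda>M::nat. freq (int M) (int M)) at_top sequentially"
proof -
  have "0 < ln 2 + ln (3::real)" by (intro add_pos_pos) auto
  from filterlim_tendsto_pos_mult_at_top[OF tendsto_const this filterlim_real_sequentially]
  show ?thesis by (simp add: freq_def algebra_simps)
qed

lemma eventually_pos_exps_shift: "\<forall>\<^sub>F M in sequentially. pos_exps (shift (int M) l)"
proof (induction l)
  case (Cons x l)
  obtain c a b where x: "x = (c, a, b)" by (cases x)
  show ?case using Cons eventually_ge_at_top[of "nat (1 - a)"] eventually_ge_at_top[of "nat (1 - b)"]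
    by eventually_elim (auto simp: x)
qed simp

lemma eventually_l1_shift_le: assumes "\<sigma> > 0" "e > 0" shows "\<forall>\<^sub>F M in sequentially. l1 (shift (int M) l) \<sigma> \<le> e"
proof -
  have "((\<lambda>x. exp (- x * \<sigma>) * l1 l \<sigma>) \<longlongrightarrow> 0) at_top" using assms by real_asymp
  from filterlim_compose[OF this filterlim_freq]
  have "(\<lambda>M. l1 (shift (int M) l) \<sigma>) \<longlonglongrightarrow> 0" unfolding l1_shift .
  from order_tendstoD(2)[OF this assms(2)] show ?thesis by (rule eventually_mono) simp
qed

lemma ev_line: "ev l (1, 1) (Complex 0 t) = ev l (1, 1) (\<i> * of_real t)"
  by (rule arg_cong) (simp add: complex_eq_iff)

lemma continuous_on_ev_vertical: "continuous_on X (\<lambda>t. ev l (1, 1) (Complex \<sigma> t))"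
proof -
  have "Complex \<sigma> t = of_real \<sigma> + \<i> * of_real t" for t by (simp add: complex_eq_iff)
  then show ?thesis using continuous_on_ev_line[of X l "of_real \<sigma>"] by simp
qed

text \<open>A Riemann-Lebesgue estimate uniform in the interval: a term of frequency \<omega>
  integrates to at most 2 |c| / |\<omega>|, and the shift sends all frequencies to infinity. It
  makes a new block almost orthogonal to the earlier sum on every interval.\<close>

lemma eventually_integral_shift_le:
  assumes "e > 0"
  shows "\<forall>\<^sub>F M in sequentially. \<forall>p q. \<bar>integral {p..q} (\<lambda>t. Re (ev (shift (int M) l) (1, 1) (Complex 0 t)))\<bar> \<le> e"
  using assms
proof (induction l arbitrary: e)
  case (Cons x l)
  obtain c a b where x: "x = (c, a, b)" by (cases x)
  have "((\<lambda>y. 2 * cmod c / (freq a b + y)) \<longlongrightarrow> 0) at_top" by real_asymp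
  from filterlim_compose[OF this filterlim_freq]
  have "(\<lambda>M. 2 * cmod c / (freq a b + freq (int M) (int M))) \<longlonglongrightarrow> 0" .
  then have ev1: "\<forall>\<^sub>F M in sequentially. 2 * cmod c / (freq a b + freq (int M) (int M)) < e / 2"
    using Cons.prems by (intro order_tendstoD(2)) auto
  have ev2: "\<forall>\<^sub>F M in sequentially. freq (int M) (int M) > - freq a b"
    using filterlim_freq unfolding filterlim_at_top_dense by blast
  have ev3: "\<forall>\<^sub>F M in sequentially. \<forall>p q. \<bar>integral {p..q} (\<lambda>t. Re (ev (shift (int M) l) (1, 1) (Complex 0 t)))\<bar> \<le> e / 2"
    by (rule Cons.IH) (use Cons.prems in simp)
  show ?case using ev1 ev2 ev3
  proof eventually_elim
    case (elim M)
    define \<omega> where "\<omega> = freq (a + int M) (b + int M)"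
    have \<omega>: "\<omega> > 0" "2 * cmod c / \<omega> < e / 2" using elim by (auto simp: \<omega>_def freq_add)
    show ?case
    proof (intro allI)
      fix p q
      have m: "c * monomial (a + int M) (b + int M) (1, 1) (Complex 0 t) = c * exp (\<i> * of_real (- \<omega> * t))" for t
      proof -
        have "Complex 0 t = \<i> * of_real t" by (simp add: complex_eq_iff)
        then show ?thesis by (simp add: monomial_def \<omega>_def mult_ac)
      qed
      have i1: "(\<lambda>t. c * exp (\<i> * of_real (- \<omega> * t))) integrable_on {p..q}"
        by (intro integrable_continuous_interval continuous_intros)
      have "integral {p..q} (\<lambda>t. Re (c * exp (\<i> * of_real (- \<omega> * t)))) = Re (integral {p..q} (\<lambda>t. c * exp (\<i> * of_real (- \<omega> * t))))"
        using has_integral_Re[OF integrable_integral[OF i1]] by (rule integral_unique)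
      then have "\<bar>integral {p..q} (\<lambda>t. Re (c * exp (\<i> * of_real (- \<omega> * t))))\<bar> \<le> 2 * cmod c / \<bar>- \<omega>\<bar>"
        using abs_Re_le_cmod[of "integral {p..q} (\<lambda>t. c * exp (\<i> * of_real (- \<omega> * t)))"] integral_exp_line_bound[of "- \<omega>" p q c] \<omega> by linarith
      moreover have "integral {p..q} (\<lambda>t. Re (ev (shift (int M) (x # l)) (1, 1) (Complex 0 t)))
         = integral {p..q} (\<lambda>t. Re (c * exp (\<i> * of_real (- \<omega> * t)))) + integral {p..q} (\<lambda>t. Re (ev (shift (int M) l) (1, 1) (Complex 0 t)))"
        unfolding x shift_simps ev_simps m plus_complex.sel
        by (intro integral_add integrable_continuous_interval continuous_on_Re continuous_on_ev_vertical)
          (intro continuous_intros)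
      ultimately show "\<bar>integral {p..q} (\<lambda>t. Re (ev (shift (int M) (x # l)) (1, 1) (Complex 0 t)))\<bar> \<le> e"
        using elim(3)[rule_format, of p q] \<omega> by simp
    qed
  qed
qed simp

text \<open>Moving right by \<sigma> multiplies each monomial by a real factor that depends on
  \<sigma> only. For a finite sum the closeness is therefore uniform in t.\<close>

lemma eventually_ev_close_to_line:
  assumes "e > 0"
  shows "\<forall>\<^sub>F \<sigma> in at_right 0. \<forall>t. cmod (ev l (1, 1) (Complex \<sigma> t) - ev l (1, 1) (Complex 0 t)) \<le> e"
  using assms
proof (induction l arbitrary: e)
  case (Cons x l)
  obtain c a b where x: "x = (c, a, b)" by (cases x)
  have "((\<lambda>\<sigma>. cmod c * \<bar>exp (- freq a b * \<sigma>) - 1\<bar>) \<longlongrightarrow> cmod c * \<bar>exp (- freq a b * 0) - 1\<bar>) (at_right 0)"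
    by (intro tendsto_intros)
  then have ev1: "\<forall>\<^sub>F \<sigma> in at_right 0. cmod c * \<bar>exp (- freq a b * \<sigma>) - 1\<bar> < e / 2"
    using Cons.prems by (intro order_tendstoD(2)) auto
  have ev2: "\<forall>\<^sub>F \<sigma> in at_right 0. \<forall>t. cmod (ev l (1, 1) (Complex \<sigma> t) - ev l (1, 1) (Complex 0 t)) \<le> e / 2"
    by (rule Cons.IH) (use Cons.prems in simp)
  show ?case using ev1 ev2
  proof eventually_elim
    case (elim \<sigma>)
    show ?case
    proof
      fix t
      have "Complex \<sigma> t = of_real \<sigma> + Complex 0 t" by (simp add: complex_eq_iff)
      then have "monomial a b (1, 1) (Complex \<sigma> t) = of_real (exp (- freq a b * \<sigma>)) * monomial a b (1, 1) (Complex 0 t)"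
        by (simp add: monomial_def distrib_left exp_add[symmetric] exp_of_real[symmetric])
      then have "c * monomial a b (1, 1) (Complex \<sigma> t) - c * monomial a b (1, 1) (Complex 0 t)
         = c * of_real (exp (- freq a b * \<sigma>) - 1) * monomial a b (1, 1) (Complex 0 t)"
        by (simp add: algebra_simps)
      moreover have "cmod \<dots> = cmod c * \<bar>exp (- freq a b * \<sigma>) - 1\<bar>"
        unfolding norm_mult norm_monomial[OF one_in_torus] norm_of_real by simp
      ultimately have "cmod (c * monomial a b (1, 1) (Complex \<sigma> t) - c * monomial a b (1, 1) (Complex 0 t)) \<le> e / 2"
        using elim(1) by simp
      moreover have "ev (x # l) (1, 1) (Complex \<sigma> t) - ev (x # l) (1, 1) (Complex 0 t) =
         (c * monomial a b (1, 1) (Complex \<sigma> t) - c * monomial a b (1, 1) (Complex 0 t)) + (ev l (1, 1) (Complex \<sigma> t) - ev l (1, 1) (Complex 0 t))"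
        unfolding x ev_simps by simp
      ultimately show "cmod (ev (x # l) (1, 1) (Complex \<sigma> t) - ev (x # l) (1, 1) (Complex 0 t)) \<le> e"
        using elim(2)[rule_format, of t] norm_triangle_ineq[of "c * monomial a b (1, 1) (Complex \<sigma> t) - c * monomial a b (1, 1) (Complex 0 t)" "ev l (1, 1) (Complex \<sigma> t) - ev l (1, 1) (Complex 0 t)"]
        by simp
    qed
  qed
qed simp

section \<open>Small frequencies and the Fejer kernel\<close>

lemma freq_eq_0_iff: "freq a b = 0 \<longleftrightarrow> a = 0 \<and> b = 0"
proof
  have nat: "m = 0 \<and> n = 0" if "real m * ln 2 = real n * ln 3" for m n :: nat
  proof -
    have "ln ((2::real) ^ m) = ln (3 ^ n)" using that by (simp add: ln_realpow)
    then have "(2::real) ^ m = 3 ^ n" by simp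
    then have "real (2 ^ m) = real (3 ^ n)" by simp
    then have eq: "(2::nat) ^ m = 3 ^ n" by (simp only: of_nat_eq_iff)
    have "odd ((3::nat) ^ n)" by simp
    then have "m = 0" using eq by (metis dvd_power gr0I)
    then show ?thesis using eq by (cases n) auto
  qed
  assume 0: "freq a b = 0"
  have e: "real_of_int a * ln 2 = - real_of_int b * ln 3" using 0 by (simp add: freq_def)
  show "a = 0 \<and> b = 0"
  proof (cases "a \<ge> 0")
    case True
    then have "- real_of_int b * ln 3 \<ge> 0" using e by (metis ln_ge_zero mult_nonneg_nonneg of_int_0_le_iff one_le_numeral)
    then have "b \<le> 0" by (simp add: mult_le_0_iff)
    then show ?thesis using nat[of "nat a" "nat (- b)"] True e by simp
  next
    case False
    have e': "real_of_int (- a) * ln 2 = real_of_int b * ln 3" using e by simp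
    moreover have "real_of_int (- a) * ln 2 > 0" using False by (intro mult_pos_pos) auto
    ultimately have "b > 0" by (simp add: zero_less_mult_iff)
    then show ?thesis using nat[of "nat (- a)" "nat b"] False e' by simp
  qed
qed (simp add: freq_def)

text \<open>Dirichlet approximation of ln 2 / ln 3. The frequency found is nonzero because k >
  0.\<close>

lemma small_freq:
  assumes "d > 0" obtains a b where "freq a b \<noteq> 0" "\<bar>freq a b\<bar> < d"
proof -
  obtain N :: nat where N: "ln 3 / d < real N" using reals_Archimedean2 by blast
  have "ln (3::real) > 0" by simp
  then have "ln 3 / d > 0" using assms by simp
  then have N0: "N > 0" "real N > 0" using N by (metis gr0I of_nat_0 order_less_asym, linarith)
  obtain h k where hk: "0 < k" "k \<le> int N" "\<bar>of_int k * (ln 2 / ln 3) - of_int h\<bar> < 1 / real N"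
    using Dirichlet_approx[OF N0(1), of "ln 2 / ln (3::real)"] by blast
  have "freq k (- h) = ln 3 * (of_int k * (ln 2 / ln 3) - of_int h)"
    by (simp add: freq_def algebra_simps)
  then have "\<bar>freq k (- h)\<bar> = ln 3 * \<bar>of_int k * (ln 2 / ln 3) - of_int h\<bar>" by (simp add: abs_mult)
  also have "\<dots> < ln 3 * (1 / real N)" using hk(3) by (intro mult_strict_left_mono) auto
  also have "\<dots> < d" using N N0 assms by (simp add: divide_less_eq mult.commute)
  finally show ?thesis using that[of k "- h"] hk(1) freq_eq_0_iff[of k "- h"] by auto
qed

lemma monomial_0 [simp]: "monomial 0 0 w s = 1"
  by (simp add: monomial_def freq_def)

lemma ev_lrefl_line: "ev (lrefl l) (1, 1) (Complex 0 t) = cnj (ev l (1, 1) (Complex 0 t))"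
proof -
  have "- cnj (Complex 0 t) = Complex 0 t" by (simp add: complex_eq_iff)
  then show ?thesis by (simp add: ev_lrefl[OF one_in_torus])
qed

lemma norm_exp_i_minus_1_le: "cmod (exp (\<i> * of_real x) - 1) \<le> \<bar>x\<bar>"
  using abs_sin_x_le_abs_x[of "x / 2"] unfolding dist_exp_i_1 by simp

lemma sum_list_map_concat_map:
  fixes g :: "'a \<Rightarrow> 'b::comm_monoid_add"
  shows "sum_list (map g (concat (map h xs))) = (\<Sum>x\<leftarrow>xs. sum_list (map g (h x)))"
  by (induction xs) auto

text \<open>k is |d|^2, where d is the average of m exponentials with frequencies j *
  \<open>freq a b\<close> for j < m. Its mean is 1 / m, and as \<open>freq a b\<close> is tiny, d
  stays close to 1 for |t| <= J.\<close>

lemma fejer_kernel: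
  assumes "e > 0"
  obtains l :: laurent and k :: "real \<Rightarrow> real" where
    "\<And>t. ev l (1, 1) (Complex 0 t) = of_real (k t)" "\<And>t. 0 \<le> k t" "\<And>t. k t \<le> 1"
    "\<And>t. \<bar>t\<bar> \<le> J \<Longrightarrow> k t \<ge> 1 / 2" "\<exists>m\<le>e. has_mean k m" "continuous_on UNIV k"
proof -
  obtain m0 :: nat where "1 / e < real m0" using reals_Archimedean2 by blast
  moreover have "1 / e > 0" using assms by simp
  ultimately have m0: "real m0 > 0" "1 / e < real m0" by linarith+
  define m where "m = m0"
  have m: "real m > 0" "1 / real m \<le> e" using m0 assms by (auto simp: m_def field_simps)
  \<comment> \<open>Keeps each phase j * \<open>freq a b\<close> * t at most 1 / 4 for |t| <= J.
    Hence |d| >= 3 / 4 there, and k >= 9 / 16.\<close>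
  define q where "q = 1 / (4 * real m * (\<bar>J\<bar> + 1))"
  have q: "q > 0" using m by (auto simp: q_def intro!: mult_pos_pos)
  obtain a b where ab: "freq a b \<noteq> 0" "\<bar>freq a b\<bar> < q" using small_freq[OF q] by blast
  define D :: laurent where "D = map (\<lambda>j. (of_real (1 / real m), int j * a, int j * b)) [0..<m]"
  define d where "d = (\<lambda>t. ev D (1, 1) (Complex 0 t))"
  have fr: "freq (int j * a) (int j * b) = real j * freq a b" for j
    by (simp add: freq_def algebra_simps)
  have mo: "monomial (int j * a) (int j * b) (1, 1) (Complex 0 t) = exp (\<i> * of_real (- (real j * freq a b * t)))" for j t
  proof -
    have "Complex 0 t = \<i> * of_real t" by (simp add: complex_eq_iff)
    then show ?thesis unfolding monomial_def fr by (simp add: mult_ac)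
  qed
  have d: "d t = (\<Sum>j<m. of_real (1 / real m) * exp (\<i> * of_real (- (real j * freq a b * t))))" for t
    unfolding d_def D_def ev_def by (simp add: o_def mo interv_sum_list_conv_sum_set_nat atLeast0LessThan)
  have d1: "cmod (d t) \<le> 1" for t
  proof -
    have "cmod (d t) \<le> (\<Sum>j<m. 1 / real m)" unfolding d by (rule sum_norm_le) (simp add: norm_mult norm_divide)
    also have "\<dots> = 1" using m by simp
    finally show ?thesis .
  qed
  have dJ: "cmod (d t) \<ge> 3 / 4" if t: "\<bar>t\<bar> \<le> J" for t
  proof -
    have "d t - 1 = (\<Sum>j<m. of_real (1 / real m) * exp (\<i> * of_real (- (real j * freq a b * t))) - of_real (1 / real m))"
      unfolding d sum_subtractf using m by simp
    also have "cmod \<dots> \<le> (\<Sum>j<m. 1 / real m * (1 / 4))"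
    proof (rule sum_norm_le)
      fix j assume "j \<in> {..<m}"
      then have j: "real j \<le> real m" by simp
      have "cmod (of_real (1 / real m) * exp (\<i> * of_real (- (real j * freq a b * t))) - of_real (1 / real m))
         = 1 / real m * cmod (exp (\<i> * of_real (- (real j * freq a b * t))) - 1)"
        using m by (simp add: right_diff_distrib[symmetric] norm_mult norm_divide diff_divide_distrib[symmetric])
      also have "\<dots> \<le> 1 / real m * \<bar>- (real j * freq a b * t)\<bar>"
        by (intro mult_left_mono norm_exp_i_minus_1_le) simp
      also have "\<bar>- (real j * freq a b * t)\<bar> \<le> real m * q * (\<bar>J\<bar> + 1)"
        unfolding abs_minus_cancel abs_mult using j ab(2) t q by (intro mult_mono) auto
      also have "real m * q * (\<bar>J\<bar> + 1) = 1 / 4"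
      proof -
        have "real m * (1 / (4 * real m * x)) * x = 1 / 4" if "x > 0" for x using m that by simp
        then show ?thesis by (simp add: q_def)
      qed
      finally show "cmod (of_real (1 / real m) * exp (\<i> * of_real (- (real j * freq a b * t))) - of_real (1 / real m)) \<le> 1 / real m * (1 / 4)"
        by (simp add: mult_left_mono divide_right_mono)
    qed
    also have "\<dots> = 1 / 4" using m by simp
    finally show ?thesis using norm_triangle_ineq2[of 1 "1 - d t"] by (simp add: norm_minus_commute)
  qed
  define l where "l = lmult D (lrefl D)"
  define k where "k = (\<lambda>t. (cmod (d t))\<^sup>2)"
  have lk: "ev l (1, 1) (Complex 0 t) = of_real (k t)" for t
    unfolding l_def k_def d_def ev_lmult[OF one_in_torus] ev_lrefl_line by (rule complex_norm_square[symmetric])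
  have k: "k = (\<lambda>t. Re (ev l (1, 1) (\<i> * of_real t)))"
    by (rule ext) (simp add: ev_line[symmetric] lk)
  \<comment> \<open>Only the diagonal pairs have frequency 0, because \<open>freq a b\<close> is
    nonzero; the m of them contribute 1 / m^2 each.\<close>
  have "(\<Sum>(c, a, b)\<leftarrow>l. if freq a b = 0 then Re c else 0) = (\<Sum>j<m. \<Sum>i<m. if i = j then 1 / real m * (1 / real m) else 0)"
  proof -
    have fr0: "freq (int j * a - int i * a) (int j * b - int i * b) = (real j - real i) * freq a b" for i j
      by (simp add: freq_def algebra_simps)
    have re: "Re (1 / (of_nat m * of_nat m)) = 1 / (real m * real m)"
      unfolding of_nat_mult[symmetric] by (simp only: Re_divide_of_nat one_complex.sel)
    have "(\<Sum>(c, a, b)\<leftarrow>l. if freq a b = 0 then Re c else 0)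
      = (\<Sum>j<m. \<Sum>i<m. if freq (int j * a - int i * a) (int j * b - int i * b) = 0 then 1 / real m * (1 / real m) else 0)"
      unfolding l_def lmult_def lrefl_def D_def
      by (simp add: sum_list_map_concat_map o_def interv_sum_list_conv_sum_set_nat atLeast0LessThan case_prod_unfold re cong: if_cong)
    also have "\<dots> = (\<Sum>j<m. \<Sum>i<m. if i = j then 1 / real m * (1 / real m) else 0)"
      unfolding fr0 using ab(1) by (intro sum.cong refl) auto
    finally show ?thesis .
  qed
  also have "\<dots> = 1 / real m" using m by simp
  finally have mean: "has_mean k (1 / real m)" using has_mean_ev[of l] unfolding k by simp
  show ?thesis
  proof (rule that[OF lk])
    show "0 \<le> k t" "k t \<le> 1" for t using d1[of t] by (auto simp: k_def power_le_one)
    show "1 / 2 \<le> k t" if "\<bar>t\<bar> \<le> J" for t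
    proof -
      have "(3 / 4)\<^sup>2 \<le> k t" unfolding k_def using dJ[OF that] by (intro power_mono) auto
      then show ?thesis by (simp add: power2_eq_square)
    qed
    show "\<exists>m\<le>e. has_mean k m" using mean m(2) by blast
    show "continuous_on UNIV k" unfolding k_def d_def by (intro continuous_intros continuous_on_ev_vertical)
  qed
qed

text \<open>One step of the inner function construction: \<open>ev l + ev B\<close> moves \<open>ev l\<close> half of the way towards the
  unit circle where \<open>k\<close> is close to 1.\<close>
lemma block_step:
  assumes l: "\<And>t. cmod (ev l (1, 1) (Complex 0 t)) \<le> 1" and s: "s > 0" and e: "e > 0"
  obtains B k where "pos_exps B" "continuous_on UNIV k" "\<And>t. 0 \<le> k t" "\<And>t. k t \<le> 1" "\<And>t. \<bar>t\<bar> \<le> J \<Longrightarrow> k t \<ge> 1 / 2"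
    "\<exists>m\<le>e. has_mean k m"
    "\<And>t. cmod (ev B (1, 1) (Complex 0 t)) = (1 - (cmod (ev l (1, 1) (Complex 0 t)))\<^sup>2) / 2 * k t"
    "\<And>\<sigma> t. \<sigma> \<ge> 0 \<Longrightarrow> cmod (ev B (1, 1) (Complex \<sigma> t)) \<le> k t / 2 + e"
    "l1 B s \<le> e"
    "\<And>p q. \<bar>integral {p..q} (\<lambda>t. Re (cnj (ev l (1, 1) (Complex 0 t)) * ev B (1, 1) (Complex 0 t)))\<bar> \<le> e"
proof -
  obtain Kl k where k: "\<And>t. ev Kl (1, 1) (Complex 0 t) = of_real (k t)" "\<And>t. 0 \<le> k t" "\<And>t. k t \<le> 1"
    "\<And>t. \<bar>t\<bar> \<le> J \<Longrightarrow> k t \<ge> 1 / 2" "\<exists>m\<le>e. has_mean k m" "continuous_on UNIV k"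
    using fejer_kernel[OF e, of J] by metis
  \<comment> \<open>1 - |ev l|^2 on the axis, with \<open>lrefl\<close> as conjugation; \<Phi> is
    then the nonnegative function \<phi> on the axis, before the oscillating factor.\<close>
  define U where "U = (1, 0, 0) # lmult [(- 1, 0, 0)] (lmult l (lrefl l))"
  define \<Phi> where "\<Phi> = lmult [(1 / 2, 0, 0)] (lmult U Kl)"
  define \<phi> where "\<phi> = (\<lambda>t. (1 - (cmod (ev l (1, 1) (Complex 0 t)))\<^sup>2) / 2 * k t)"
  have U: "ev U (1, 1) (Complex 0 t) = of_real (1 - (cmod (ev l (1, 1) (Complex 0 t)))\<^sup>2)" for t
    unfolding U_def ev_simps ev_lmult[OF one_in_torus] ev_lrefl_line
    by (simp add: complex_norm_square[symmetric] del: of_real_power)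
  have \<Phi>: "ev \<Phi> (1, 1) (Complex 0 t) = of_real (\<phi> t)" for t
    unfolding \<Phi>_def ev_lmult[OF one_in_torus] U k(1) by (simp add: \<phi>_def)
  have sq: "0 \<le> 1 - (cmod (ev l (1, 1) (Complex 0 t)))\<^sup>2" "1 - (cmod (ev l (1, 1) (Complex 0 t)))\<^sup>2 \<le> 1" for t
    using l[of t] by (auto simp: power_le_one)
  have \<phi>0: "\<phi> t \<ge> 0" for t unfolding \<phi>_def using sq[of t] k(2)[of t] by simp
  have \<phi>k: "\<phi> t \<le> k t / 2" for t
  proof -
    have "(1 - (cmod (ev l (1, 1) (Complex 0 t)))\<^sup>2) * k t \<le> 1 * k t" using sq k(2) by (intro mult_right_mono) auto
    then show ?thesis by (simp add: \<phi>_def)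
  qed
  obtain \<theta> where \<theta>: "\<theta> > 0" "\<And>\<sigma> t. 0 < \<sigma> \<Longrightarrow> \<sigma> < \<theta> \<Longrightarrow> cmod (ev \<Phi> (1, 1) (Complex \<sigma> t) - ev \<Phi> (1, 1) (Complex 0 t)) \<le> e"
    using eventually_ev_close_to_line[OF e, of \<Phi>] unfolding eventually_at_right_field by auto
  \<comment> \<open>Splits the half-plane: left of \<sigma>0 the polynomial \<Phi> is within e of
    its axis values, from \<sigma>0 on the shift makes the block at most e.\<close>
  define \<sigma>0 where "\<sigma>0 = min s (\<theta> / 2)"
  have \<sigma>0: "\<sigma>0 > 0" "\<sigma>0 \<le> s" "\<sigma>0 < \<theta>" using s \<theta>(1) by (auto simp: \<sigma>0_def)
  \<comment> \<open>The third condition is the cross term with the earlier sum, because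
    \<open>lrefl l\<close> conjugates l on the axis.\<close>
  have "\<forall>\<^sub>F M in sequentially. pos_exps (shift (int M) \<Phi>) \<and> l1 (shift (int M) \<Phi>) \<sigma>0 \<le> e \<and>
     (\<forall>p q. \<bar>integral {p..q} (\<lambda>t. Re (ev (shift (int M) (lmult (lrefl l) \<Phi>)) (1, 1) (Complex 0 t)))\<bar> \<le> e)"
    using eventually_pos_exps_shift eventually_l1_shift_le[OF \<sigma>0(1) e] eventually_integral_shift_le[OF e]
    by (intro eventually_conj) auto
  then obtain M where M: "pos_exps (shift (int M) \<Phi>)" "l1 (shift (int M) \<Phi>) \<sigma>0 \<le> e"
     "\<And>p q. \<bar>integral {p..q} (\<lambda>t. Re (ev (shift (int M) (lmult (lrefl l) \<Phi>)) (1, 1) (Complex 0 t)))\<bar> \<le> e"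
    unfolding eventually_sequentially by blast
  define B where "B = shift (int M) \<Phi>"
  have fM: "freq (int M) (int M) \<ge> 0" by (simp add: freq_def)
  show ?thesis
  proof (rule that[of B k])
    show "pos_exps B" using M(1) by (simp add: B_def)
    show "cmod (ev B (1, 1) (Complex 0 t)) = (1 - (cmod (ev l (1, 1) (Complex 0 t)))\<^sup>2) / 2 * k t" for t
      unfolding B_def ev_shift[OF one_in_torus] norm_mult norm_monomial[OF one_in_torus] \<Phi> norm_of_real
      using \<phi>0[of t] by (simp add: \<phi>_def)
    show "l1 B s \<le> e" using l1_antimono[OF M(1) \<sigma>0(2)] M(2) by (simp add: B_def)
    show "\<bar>integral {p..q} (\<lambda>t. Re (cnj (ev l (1, 1) (Complex 0 t)) * ev B (1, 1) (Complex 0 t)))\<bar> \<le> e" for p q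
      using M(3)[of p q] unfolding B_def ev_shift[OF one_in_torus] ev_lmult[OF one_in_torus] ev_lrefl_line
      by (simp only: mult.left_commute)
    show "cmod (ev B (1, 1) (Complex \<sigma> t)) \<le> k t / 2 + e" if \<sigma>: "\<sigma> \<ge> 0" for \<sigma> t
    proof (cases "\<sigma> \<ge> \<sigma>0")
      case True
      have "cmod (ev B (1, 1) (Complex \<sigma> t)) \<le> l1 B \<sigma>" using norm_ev_le[OF one_in_torus, of B "Complex \<sigma> t"] by simp
      also have "\<dots> \<le> l1 B \<sigma>0" unfolding B_def by (rule l1_antimono[OF M(1) True])
      finally show ?thesis using M(2) k(2)[of t] by (simp add: B_def)
    next
      case False
      have "cmod (ev \<Phi> (1, 1) (Complex \<sigma> t) - ev \<Phi> (1, 1) (Complex 0 t)) \<le> e"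
        using \<theta>(2)[of \<sigma> t] \<sigma> False \<sigma>0 e by (cases "\<sigma> = 0") auto
      then have "cmod (ev \<Phi> (1, 1) (Complex \<sigma> t)) \<le> \<phi> t + e"
        using norm_triangle_ineq2[of "ev \<Phi> (1, 1) (Complex \<sigma> t)" "ev \<Phi> (1, 1) (Complex 0 t)"] \<phi>0[of t] by (simp add: \<Phi>)
      moreover have "cmod (ev B (1, 1) (Complex \<sigma> t)) \<le> 1 * cmod (ev \<Phi> (1, 1) (Complex \<sigma> t))"
        unfolding B_def ev_shift[OF one_in_torus] norm_mult norm_monomial[OF one_in_torus]
        using \<sigma> fM by (intro mult_right_mono) auto
      ultimately show ?thesis using \<phi>k[of t] by simp
    qed
  qed (use k in auto)
qed

text \<open>s n is a width at which stage n is still visible: for Re z in [s n / 2, s n] all blocks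
  from n on are small by \<open>l1_B\<close>, while \<open>s_close\<close> ties the partial sum to
  its axis values. The budget \<epsilon> / 16 * 2^-n leaves room for the total 5 \<epsilon> / 16 <
  \<epsilon> / 2 in \<open>F_mean\<close>.\<close>

locale block_sequence =
  fixes \<epsilon> :: real and l B :: "nat \<Rightarrow> laurent" and s :: "nat \<Rightarrow> real" and k :: "nat \<Rightarrow> real \<Rightarrow> real" and e :: "nat \<Rightarrow> real"
  assumes eps: "0 < \<epsilon>" "\<epsilon> < 1" and e_def: "\<And>n. e n = \<epsilon> / 16 * (1 / 2) ^ n"
    and l_0: "l 0 = []" and l_Suc: "\<And>n. l (Suc n) = l n @ B n"
    and l_line: "\<And>n t. cmod (ev (l n) (1, 1) (Complex 0 t)) \<le> 1"
    and s_pos: "\<And>n. s n > 0" and s_dec: "\<And>n. s (Suc n) \<le> s n" and s_le: "\<And>n. s n \<le> 1 / (real n + 1)"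
    and s_close: "\<And>n \<sigma> t. 0 \<le> \<sigma> \<Longrightarrow> \<sigma> \<le> s n \<Longrightarrow>
        cmod (ev (l n) (1, 1) (Complex \<sigma> t) - ev (l n) (1, 1) (Complex 0 t)) \<le> 1 / (real n + 1)"
    and B_pos: "\<And>n. pos_exps (B n)"
    and k_cont: "\<And>n. continuous_on UNIV (k n)" and k_ge: "\<And>n t. 0 \<le> k n t" and k_le: "\<And>n t. k n t \<le> 1"
    and k_half: "\<And>n t. \<bar>t\<bar> \<le> real n \<Longrightarrow> k n t \<ge> 1 / 2" and k_mean: "\<And>n. \<exists>m\<le>e n. has_mean (k n) m"
    and B_line: "\<And>n t. cmod (ev (B n) (1, 1) (Complex 0 t)) = (1 - (cmod (ev (l n) (1, 1) (Complex 0 t)))\<^sup>2) / 2 * k n t"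
    and B_le: "\<And>n \<sigma> t. \<sigma> \<ge> 0 \<Longrightarrow> cmod (ev (B n) (1, 1) (Complex \<sigma> t)) \<le> k n t / 2 + e n"
    and l1_B: "\<And>n. l1 (B n) (s n / 2) \<le> e n"
    and cross: "\<And>n p q. \<bar>integral {p..q} (\<lambda>t. Re (cnj (ev (l n) (1, 1) (Complex 0 t)) * ev (B n) (1, 1) (Complex 0 t)))\<bar> \<le> e n"

lemma block_sequence_exists:
  assumes "0 < \<epsilon>" "\<epsilon> < 1"
  shows "\<exists>l B s k e. block_sequence \<epsilon> l B s k e"
proof -
  define e where "e = (\<lambda>n. \<epsilon> / 16 * (1 / 2) ^ n :: real)"
  have e: "e n > 0" for n using assms by (simp add: e_def)
  \<comment> \<open>A state is a partial sum with its width. \<open>R\<close> states what the next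
    block must satisfy relative to it, and \<open>Q\<close> adds that the width does not
    grow.\<close>
  define P where "P = (\<lambda>n (x :: laurent \<times> real). (n = 0 \<longrightarrow> fst x = []) \<and> (\<forall>t. cmod (ev (fst x) (1, 1) (Complex 0 t)) \<le> 1) \<and> snd x > 0 \<and> snd x \<le> 1 / (real n + 1)
     \<and> (\<forall>\<sigma> t. 0 \<le> \<sigma> \<longrightarrow> \<sigma> \<le> snd x \<longrightarrow> cmod (ev (fst x) (1, 1) (Complex \<sigma> t) - ev (fst x) (1, 1) (Complex 0 t)) \<le> 1 / (real n + 1)))"
  define R where "R = (\<lambda>n (x :: laurent \<times> real) B k. pos_exps B \<and> continuous_on UNIV k \<and> (\<forall>t. 0 \<le> k t) \<and> (\<forall>t. k t \<le> 1) \<and> (\<forall>t. \<bar>t\<bar> \<le> real n \<longrightarrow> k t \<ge> 1 / 2) \<and>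
    (\<exists>m\<le>e n. has_mean k m) \<and>
    (\<forall>t. cmod (ev B (1, 1) (Complex 0 t)) = (1 - (cmod (ev (fst x) (1, 1) (Complex 0 t)))\<^sup>2) / 2 * k t) \<and>
    (\<forall>\<sigma> t. \<sigma> \<ge> 0 \<longrightarrow> cmod (ev B (1, 1) (Complex \<sigma> t)) \<le> k t / 2 + e n) \<and>
    l1 B (snd x / 2) \<le> e n \<and>
    (\<forall>p q. \<bar>integral {p..q} (\<lambda>t. Re (cnj (ev (fst x) (1, 1) (Complex 0 t)) * ev B (1, 1) (Complex 0 t)))\<bar> \<le> e n))"
  define Q where "Q = (\<lambda>n (x :: laurent \<times> real) (y :: laurent \<times> real). snd y \<le> snd x \<and> (\<exists>B k. fst y = fst x @ B \<and> R n x B k))"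
  have "\<exists>x. \<forall>n. P n (x n) \<and> Q n (x n) (x (Suc n))"
  proof (rule dependent_nat_choice)
    show "\<exists>x. P 0 x" by (rule exI[of _ "([], 1)"]) (simp add: P_def)
    fix x n assume Px: "P n x"
    have l1x: "cmod (ev (fst x) (1, 1) (Complex 0 t)) \<le> 1" for t using Px by (simp add: P_def)
    have sx: "snd x / 2 > 0" using Px by (simp add: P_def)
    have "\<exists>B k. R n x B k"
    proof (rule block_step[OF l1x sx e[of n], of "real n"])
      fix B k
      assume "pos_exps B" "continuous_on UNIV k" "\<And>t. 0 \<le> k t" "\<And>t. k t \<le> 1" "\<And>t. \<bar>t\<bar> \<le> real n \<Longrightarrow> k t \<ge> 1 / 2"
        "\<exists>m\<le>e n. has_mean k m"
        "\<And>t. cmod (ev B (1, 1) (Complex 0 t)) = (1 - (cmod (ev (fst x) (1, 1) (Complex 0 t)))\<^sup>2) / 2 * k t"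
        "\<And>\<sigma> t. \<sigma> \<ge> 0 \<Longrightarrow> cmod (ev B (1, 1) (Complex \<sigma> t)) \<le> k t / 2 + e n"
        "l1 B (snd x / 2) \<le> e n"
        "\<And>p q. \<bar>integral {p..q} (\<lambda>t. Re (cnj (ev (fst x) (1, 1) (Complex 0 t)) * ev B (1, 1) (Complex 0 t)))\<bar> \<le> e n"
      then have "R n x B k" unfolding R_def by (intro conjI allI impI)
      then show "\<exists>B k. R n x B k" by blast
    qed
    then obtain B k where B: "R n x B k" by blast
    \<comment> \<open>Whatever the phase of the block, c + (1 - c^2) / 2 <= 1 for c in
      [0, 1].\<close>
    have le: "cmod (ev (fst x @ B) (1, 1) (Complex 0 t)) \<le> 1" for t
    proof -
      define c where "c = cmod (ev (fst x) (1, 1) (Complex 0 t))"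
      have c: "0 \<le> c" "c \<le> 1" using Px by (auto simp: c_def P_def)
      have "cmod (ev B (1, 1) (Complex 0 t)) = (1 - c\<^sup>2) / 2 * k t" using B by (auto simp: R_def c_def)
      also have "\<dots> \<le> (1 - c\<^sup>2) / 2 * 1" using B c by (intro mult_left_mono) (auto simp: R_def power_le_one)
      also have "\<dots> = (1 - c) * ((1 + c) / 2)" by (simp add: power2_eq_square algebra_simps)
      also have "\<dots> \<le> (1 - c) * 1" using c by (intro mult_left_mono) auto
      finally have "c + cmod (ev B (1, 1) (Complex 0 t)) \<le> 1" by simp
      then show ?thesis using norm_triangle_ineq[of "ev (fst x) (1, 1) (Complex 0 t)" "ev B (1, 1) (Complex 0 t)"] by (simp add: c_def)
    qed
    obtain b where b: "b > 0" "\<And>\<sigma> t. 0 < \<sigma> \<Longrightarrow> \<sigma> < b \<Longrightarrow> cmod (ev (fst x @ B) (1, 1) (Complex \<sigma> t) - ev (fst x @ B) (1, 1) (Complex 0 t)) \<le> 1 / (real (Suc n) + 1)"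
      using eventually_ev_close_to_line[of "1 / (real (Suc n) + 1)" "fst x @ B"] unfolding eventually_at_right_field by auto
    define s' where "s' = min (snd x) (min (1 / (real (Suc n) + 1)) (b / 2))"
    have s': "s' > 0" "s' \<le> snd x" "s' \<le> 1 / (real (Suc n) + 1)" "s' < b" using Px b(1) by (auto simp: s'_def P_def min_def)
    have "P (Suc n) (fst x @ B, s')"
      unfolding P_def fst_conv snd_conv
    proof (intro conjI allI impI le s')
      show "fst x @ B = []" if "Suc n = 0" using that by simp
      fix \<sigma> t assume "0 \<le> \<sigma>" "\<sigma> \<le> s'"
      then show "cmod (ev (fst x @ B) (1, 1) (Complex \<sigma> t) - ev (fst x @ B) (1, 1) (Complex 0 t)) \<le> 1 / (real (Suc n) + 1)"
        using b(2)[of \<sigma> t] s' by (cases "\<sigma> = 0") auto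
    qed
    moreover have "Q n x (fst x @ B, s')" using B s' by (auto simp: Q_def)
    ultimately show "\<exists>y. P (Suc n) y \<and> Q n x y" by blast
  qed
  then obtain x where x: "\<And>n. P n (x n)" "\<And>n. Q n (x n) (x (Suc n))" by blast
  define l s where "l = (\<lambda>n. fst (x n))" and "s = (\<lambda>n. snd (x n))"
  have "\<exists>B k. l (Suc n) = l n @ B \<and> R n (x n) B k" for n using x(2)[of n] by (simp add: Q_def l_def)
  then obtain B k where Bk: "\<And>n. l (Suc n) = l n @ B n" "\<And>n. R n (x n) (B n) (k n)" by metis
  have "block_sequence \<epsilon> l B s k e"
  proof
    show "0 < \<epsilon>" "\<epsilon> < 1" by (rule assms)+
    show "e n = \<epsilon> / 16 * (1 / 2) ^ n" for n by (simp add: e_def)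
    show "l 0 = []" using x(1)[of 0] by (simp add: P_def l_def)
    show "s (Suc n) \<le> s n" for n using x(2)[of n] by (simp add: Q_def s_def)
  qed (use x(1) Bk in \<open>simp_all add: P_def R_def l_def s_def\<close>)
  then show ?thesis by blast
qed

lemma has_mean_cmult:
  assumes "has_mean g m" shows "has_mean (\<lambda>t. c * g t) (c * m)"
  using tendsto_mult_left[OF assms[unfolded has_mean_def], of c] unfolding has_mean_def by simp

subsection \<open>The limit function\<close>

context block_sequence begin

lemma e_pos: "e n > 0"
  using eps by (simp add: e_def)

lemma sums_e: "(\<lambda>n. e (n + N)) sums (2 * e N)"
proof -
  have "(\<lambda>n. \<epsilon> / 16 * (1 / 2) ^ N * (1 / 2) ^ n) sums (\<epsilon> / 16 * (1 / 2) ^ N * (1 / (1 - 1 / 2)))"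
    by (intro sums_mult geometric_sums) simp
  then show ?thesis by (simp add: e_def power_add mult_ac)
qed

lemma e_tendsto_0: "e \<longlonglongrightarrow> 0"
proof -
  have "(\<lambda>n. \<epsilon> / 16 * (1 / 2) ^ n) \<longlonglongrightarrow> \<epsilon> / 16 * 0"
    by (intro tendsto_intros LIMSEQ_realpow_zero) auto
  moreover have "e = (\<lambda>n. \<epsilon> / 16 * (1 / 2) ^ n)" by (rule ext) (rule e_def)
  ultimately show ?thesis by (metis mult_zero_right)
qed

lemma s_antimono: "m \<le> n \<Longrightarrow> s n \<le> s m"
  using lift_Suc_antimono_le[of s] s_dec by blast

lemma s_small: assumes "c > 0" obtains N where "\<And>n. n \<ge> N \<Longrightarrow> s n / 2 \<le> c"
proof -
  obtain N :: nat where N: "1 / c < real N" using reals_Archimedean2 by blast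
  have "s N \<le> c"
  proof -
    have "1 / (real N + 1) \<le> c" using N assms by (simp add: field_simps)
    then show ?thesis using s_le[of N] by linarith
  qed
  then have "s n / 2 \<le> c" if "n \<ge> N" for n using s_antimono[OF that] s_pos[of n] by simp
  then show ?thesis using that by blast
qed

definition H :: "complex \<times> complex \<Rightarrow> complex \<Rightarrow> complex" where "H w z = (\<Sum>n. ev (B n) w z)"

definition F :: "complex \<Rightarrow> complex" where "F z = H (1, 1) z"

lemma ev_l: "ev (l n) w z = (\<Sum>i<n. ev (B i) w z)"
  by (induction n) (auto simp: l_0 l_Suc)

lemma pos_exps_l: "pos_exps (l n)"
  by (induction n) (auto simp: l_0 l_Suc B_pos)

lemma block_le: assumes "w \<in> torus" "s N / 2 \<le> Re z" "N \<le> n" shows "cmod (ev (B n) w z) \<le> e n"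
proof -
  have "cmod (ev (B n) w z) \<le> l1 (B n) (Re z)" by (rule norm_ev_le[OF assms(1)])
  also have "\<dots> \<le> l1 (B n) (s n / 2)" using s_antimono[OF assms(3)] assms(2) by (intro l1_antimono B_pos) auto
  also have "\<dots> \<le> e n" by (rule l1_B)
  finally show ?thesis .
qed

lemma summable_blocks: assumes "w \<in> torus" "Re z > 0" shows "summable (\<lambda>n. ev (B n) w z)"
proof -
  obtain N where N: "\<And>n. n \<ge> N \<Longrightarrow> s n / 2 \<le> Re z" using s_small[OF assms(2)] by blast
  have "summable (\<lambda>n. e (n + 0))" using sums_e sums_summable by blast
  then have "summable e" by simp
  then show ?thesis by (rule summable_comparison_test'[of _ N]) (use block_le[OF assms(1)] N in auto)
qed

text \<open>To the right of s N / 2 each block from N on is at most its budget, and the geometric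
  tail adds up to 2 \<open>e N\<close>.\<close>

lemma H_tail: assumes w: "w \<in> torus" and z: "Re z > 0" "s N / 2 \<le> Re z" shows "cmod (H w z - ev (l N) w z) \<le> 2 * e N"
proof -
  have "H w z - ev (l N) w z = (\<Sum>n. ev (B (n + N)) w z)"
    unfolding H_def ev_l using suminf_minus_initial_segment[OF summable_blocks[OF w z(1)]] by simp
  also have "cmod \<dots> \<le> (\<Sum>n. e (n + N))"
    by (rule norm_suminf_le[OF _ sums_summable[OF sums_e]]) (rule block_le[OF w z(2)], simp)
  also have "\<dots> = 2 * e N" using sums_e sums_unique by metis
  finally show ?thesis .
qed

lemma uniform_limit_H:
  assumes "c > 0" shows "uniform_limit (torus \<times> {z. Re z \<ge> c}) (\<lambda>N (w, z). ev (l N) w z) (\<lambda>(w, z). H w z) sequentially"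
proof (rule uniform_limitI)
  fix d :: real assume d: "d > 0"
  obtain N where N: "\<And>n. n \<ge> N \<Longrightarrow> s n / 2 \<le> c" using s_small[OF assms] by blast
  have "(\<lambda>n. 2 * e n) \<longlonglongrightarrow> 2 * 0" by (intro tendsto_intros e_tendsto_0)
  then have "\<forall>\<^sub>F n in sequentially. 2 * e n < d" using d by (intro order_tendstoD(2)) auto
  then show "\<forall>\<^sub>F n in sequentially. \<forall>x\<in>torus \<times> {z. Re z \<ge> c}. dist (case x of (w, z) \<Rightarrow> ev (l n) w z) (case x of (w, z) \<Rightarrow> H w z) < d"
    using eventually_ge_at_top[of N]
  proof eventually_elim
    case (elim n)
    have "dist (ev (l n) w z) (H w z) < d" if "w \<in> torus" "Re z \<ge> c" for w z
      using H_tail[OF that(1), of z n] that(2) N[OF elim(2)] elim(1) assms by (simp add: dist_norm norm_minus_commute)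
    then show ?case by auto
  qed
qed

lemma H_holomorphic: assumes w: "w \<in> torus" shows "H w holomorphic_on {z. Re z > 0}"
proof (rule holomorphic_uniform_sequence)
  show "open {z. Re z > 0}" by (rule open_halfspace_Re_gt)
  show "ev (l n) w holomorphic_on {z. Re z > 0}" for n by (rule holomorphic_on_ev)
  fix z assume z: "z \<in> {z. Re z > 0}"
  have sub: "x \<in> {z. Re z \<ge> Re y / 2}" if "x \<in> cball y (Re y / 2)" for x y
    using abs_Re_le_cmod[of "y - x"] that by (simp add: dist_norm)
  show "\<exists>d>0. cball z d \<subseteq> {z. Re z > 0} \<and> uniform_limit (cball z d) (\<lambda>n. ev (l n) w) (H w) sequentially"
  proof (intro exI conjI)
    show "Re z / 2 > 0" using z by simp
    show "cball z (Re z / 2) \<subseteq> {z. Re z > 0}" using sub[of _ z] z by force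
    show "uniform_limit (cball z (Re z / 2)) (\<lambda>n. ev (l n) w) (H w) sequentially"
    proof -
      have "uniform_limit (cball z (Re z / 2)) (\<lambda>n x. (case (w, x) of (w, z) \<Rightarrow> ev (l n) w z)) (\<lambda>x. (case (w, x) of (w, z) \<Rightarrow> H w z)) sequentially"
        by (rule uniform_limit_compose'[OF uniform_limit_H[of "Re z / 2"]]) (use z w sub[of _ z] in \<open>auto simp: Pi_iff\<close>)
      then show ?thesis by simp
    qed
  qed
qed

text \<open>Convergence is uniform only on closed half-planes Re z >= c > 0, so continuity is proved
  there and transferred locally.\<close>

lemma H_continuous: "continuous_on (torus \<times> {z. Re z > 0}) (\<lambda>(w, z). H w z)"
proof -
  have c: "continuous_on (torus \<times> {z. Re z \<ge> c}) (\<lambda>(w, z). H w z)" if "c > 0" for c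
  proof (rule uniform_limit_theorem[OF _ uniform_limit_H[OF that]])
    show "\<forall>\<^sub>F n in sequentially. continuous_on (torus \<times> {z. Re z \<ge> c}) (\<lambda>(w, z). ev (l n) w z)"
      by (intro always_eventually allI continuous_on_subset[OF continuous_on_ev]) auto
  qed simp
  show ?thesis
    unfolding continuous_on_eq_continuous_within
  proof
    fix x assume x: "x \<in> torus \<times> {z. Re z > 0}"
    define c where "c = Re (snd x) / 2"
    have c0: "c > 0" using x by (auto simp: c_def)
    have "continuous (at x within torus \<times> {z. Re z \<ge> c}) (\<lambda>(w, z). H w z)"
      using c[OF c0] x c0 unfolding continuous_on_eq_continuous_within by (cases x) (auto simp: c_def)
    moreover have "at x within torus \<times> {z. Re z > 0} = at x within torus \<times> {z. Re z \<ge> c}"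
    proof (rule at_within_nhd)
      show "x \<in> UNIV \<times> {z. Re z > c}" using x c0 by (auto simp: c_def mem_Times_iff)
      show "open (UNIV \<times> {z. Re z > c} :: ((complex \<times> complex) \<times> complex) set)"
        by (intro open_Times open_halfspace_Re_gt) auto
    qed (use c0 in auto)
    ultimately show "continuous (at x within torus \<times> {z. Re z > 0}) (\<lambda>(w, z). H w z)" by simp
  qed
qed

lemma H_far: assumes w: "w \<in> torus" and z: "Re z \<ge> 1" shows "cmod (H w z) \<le> exp (- (Re z - 1)) * \<epsilon>"
proof -
  have b: "cmod (ev (B n) w z) \<le> exp (- (Re z - 1)) * e (n + 0)" for n
  proof -
    have "cmod (ev (B n) w z) \<le> l1 (B n) (1 + (Re z - 1))" using norm_ev_le[OF w, of "B n" z] by simp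
    also have "\<dots> \<le> exp (- (Re z - 1)) * l1 (B n) 1" using z by (intro l1_decay B_pos) auto
    also have "l1 (B n) 1 \<le> l1 (B n) (s n / 2)"
    proof (rule l1_antimono[OF B_pos])
      have "1 / (real n + 1) \<le> 1" by (simp add: field_simps)
      then show "s n / 2 \<le> 1" using s_le[of n] s_pos[of n] by linarith
    qed
    also have "\<dots> \<le> e n" by (rule l1_B)
    finally show ?thesis by (simp add: mult_left_mono)
  qed
  have "cmod (H w z) \<le> (\<Sum>n. exp (- (Re z - 1)) * e (n + 0))"
    unfolding H_def by (rule norm_suminf_le[OF b]) (intro summable_mult sums_summable[OF sums_e])
  also have "\<dots> = exp (- (Re z - 1)) * (2 * e 0)" by (rule sums_unique[symmetric], rule sums_mult, rule sums_e)
  also have "\<dots> \<le> exp (- (Re z - 1)) * \<epsilon>" using eps by (intro mult_left_mono) (auto simp: e_def)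
  finally show ?thesis .
qed

lemma H_vanish: assumes "\<delta> > 0" shows "\<exists>A>0. \<forall>w\<in>torus. \<forall>z. Re z \<ge> A \<longrightarrow> cmod (H w z) \<le> \<delta>"
proof -
  have "((\<lambda>x. exp (- (x - 1)) * \<epsilon>) \<longlongrightarrow> 0) at_top" by real_asymp
  then have "\<forall>\<^sub>F x in at_top. exp (- (x - 1)) * \<epsilon> < \<delta>" using assms by (rule order_tendstoD(2))
  then obtain A where A: "\<And>x. x \<ge> A \<Longrightarrow> exp (- (x - 1)) * \<epsilon> < \<delta>" unfolding eventually_at_top_linorder by blast
  have "cmod (H w z) \<le> \<delta>" if "w \<in> torus" "Re z \<ge> max A 1" for w z
    using H_far[OF that(1), of z] A[of "Re z"] that(2) by simp
  then show ?thesis by (intro exI[of _ "max A 1"]) auto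
qed

lemma H_flow: "H (flow \<tau>) z = F (z + \<i> * of_real \<tau>)"
  by (simp add: H_def F_def ev_flow)

end

text \<open>The bound on the half-plane follows from the maximum principle applied to \<open>g ^ n / (1 + z)\<close>
  on large half-discs, as \<open>n \<rightarrow> \<infinity>\<close>.\<close>
lemma half_plane_maximum_principle:
  assumes hol: "g holomorphic_on UNIV" and bdd: "\<And>z. Re z \<ge> 0 \<Longrightarrow> cmod (g z) \<le> C"
    and line: "\<And>t. cmod (g (Complex 0 t)) \<le> 1" and z: "Re z \<ge> 0"
  shows "cmod (g z) \<le> 1"
proof -
  have pow: "cmod (g z) ^ n \<le> cmod (1 + z)" for n
  proof -
    define h where "h = (\<lambda>z. g z ^ n / (1 + z))"
    \<comment> \<open>On the arc |x| = R the denominator satisfies |1 + x| >= R - 1 >= C^n, which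
      compensates the crude bound for g^n.\<close>
    define R where "R = max (cmod z + 1) (C ^ n + 1)"
    define S where "S = {z. Re z > 0} \<inter> ball 0 R"
    have C0: "C \<ge> 0" using bdd[of 0] norm_ge_zero[of "g 0"] by (simp del: norm_ge_zero)
    have R: "cmod z < R" "C ^ n + 1 \<le> R" "R > 0"
      unfolding R_def using add_nonneg_pos[OF norm_ge_zero[of z] zero_less_one] by (auto simp: less_max_iff_disj)
    have cl: "closure S \<subseteq> {z. Re z \<ge> 0} \<inter> cball 0 R"
      by (rule closure_minimal) (auto simp: S_def closed_halfspace_Re_ge)
    have nz: "1 + w \<noteq> 0" if "Re w \<ge> 0" for w
    proof
      assume "1 + w = 0"
      then have "Re (1 + w) = 0" by simp
      then show False using that by simp
    qed
    have hh: "h holomorphic_on {z. Re z > - 1}"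
      unfolding h_def by (intro holomorphic_intros holomorphic_on_subset[OF hol]) (auto simp: complex_eq_iff)
    have "cmod (h w) \<le> 1" if w: "w \<in> closure S" for w
    proof (rule maximum_modulus_frontier[OF _ _ _ _ w])
      show "h holomorphic_on interior (closure S)"
        using cl interior_subset by (intro holomorphic_on_subset[OF hh]) fastforce
      show "continuous_on (closure (closure S)) h"
        using cl by (intro continuous_on_subset[OF holomorphic_on_imp_continuous_on[OF hh]]) fastforce
      show "bounded (closure S)" by (auto simp: S_def bounded_Int)
      fix x assume x: "x \<in> frontier (closure S)"
      then have x': "x \<in> closure S" "x \<notin> S" 
        using open_Int[OF open_halfspace_Re_gt[of 0] open_ball[of 0 R]] interior_maximal[of S "closure S"] closure_subset[of S]
        by (auto simp: frontier_def S_def[symmetric])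
      then have xr: "Re x \<ge> 0" "cmod x \<le> R" using cl by auto
      consider "Re x = 0" | "cmod x = R" using x'(2) xr by (auto simp: S_def)
      then show "cmod (h x) \<le> 1"
      proof cases
        case 1
        then have "x = Complex 0 (Im x)" by (simp add: complex_eq_iff)
        then have "cmod (g x) \<le> 1" using line by metis
        then have "cmod (g x) ^ n \<le> 1" by (simp add: power_le_one)
        moreover have "1 \<le> cmod (1 + x)" using 1 abs_Re_le_cmod[of "1 + x"] by simp
        ultimately show ?thesis by (simp add: h_def norm_divide norm_power divide_le_eq)
      next
        case 2
        have "cmod (g x) ^ n \<le> C ^ n" using bdd[OF xr(1)] by (intro power_mono) auto
        also have "\<dots> \<le> cmod (1 + x)" using R(2) 2 norm_triangle_ineq2[of x "- 1"] by (simp add: add.commute)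
        finally show ?thesis using nz[OF xr(1)] by (simp add: h_def norm_divide norm_power divide_le_eq)
      qed
    qed
    moreover have "z \<in> closure S"
    proof (cases "Re z > 0")
      case True
      then show ?thesis using R(1) closure_subset[of S] by (auto simp: S_def)
    next
      case False
      have lim: "(\<lambda>j. z + of_real (inverse (real (Suc j)))) \<longlonglongrightarrow> z + of_real 0"
        by (intro tendsto_intros tendsto_of_real LIMSEQ_inverse_real_of_nat)
      have "\<forall>\<^sub>F j in sequentially. z + of_real (inverse (real (Suc j))) \<in> ball 0 R"
        by (rule topological_tendstoD[OF lim]) (use R in auto)
      then have "\<forall>\<^sub>F j in sequentially. z + of_real (inverse (real (Suc j))) \<in> closure S"
      proof (rule eventually_mono)
        fix j assume "z + of_real (inverse (real (Suc j))) \<in> ball 0 R"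
        moreover have "Re (z + of_real (inverse (real (Suc j)))) > 0"
          unfolding plus_complex.sel Re_complex_of_real using z by (intro add_nonneg_pos) auto
        ultimately show "z + of_real (inverse (real (Suc j))) \<in> closure S"
          using closure_subset[of S] by (auto simp: S_def)
      qed
      from Lim_in_closed_set[OF closed_closure this _ lim] show ?thesis by simp
    qed
    ultimately have "cmod (h z) \<le> 1" by blast
    then show ?thesis using nz[OF z] by (simp add: h_def norm_divide norm_power divide_le_eq)
  qed
  show ?thesis
  proof (rule ccontr)
    assume "\<not> cmod (g z) \<le> 1"
    \<comment> \<open>The bound |g z|^n <= |1 + z| has a right-hand side independent of n, so a
      modulus above 1 is impossible.\<close>
    then obtain n where "cmod (1 + z) < cmod (g z) ^ n" using real_arch_pow[of "cmod (g z)"] by auto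
    then show False using pow[of n] by simp
  qed
qed

section \<open>The limit function: values in the disc, means on lines, modulus near the axis\<close>

context block_sequence begin

lemma l_le_1: assumes "Re z \<ge> 0" shows "cmod (ev (l n) (1, 1) z) \<le> 1"
proof (rule half_plane_maximum_principle[OF holomorphic_on_ev _ l_line assms])
  fix z :: complex assume "Re z \<ge> 0"
  then show "cmod (ev (l n) (1, 1) z) \<le> l1 (l n) 0"
    using norm_ev_le[OF one_in_torus, of "l n" z] l1_antimono[OF pos_exps_l, of 0 "Re z" n] by simp
qed

lemma F_tail: "Re z > 0 \<Longrightarrow> s N / 2 \<le> Re z \<Longrightarrow> cmod (F z - ev (l N) (1, 1) z) \<le> 2 * e N"
  unfolding F_def by (rule H_tail[OF one_in_torus])

lemma F_holomorphic: "F holomorphic_on {z. Re z > 0}"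
  using H_holomorphic[OF one_in_torus] unfolding F_def .

lemma F_vanish: "\<delta> > 0 \<Longrightarrow> \<exists>A>0. \<forall>z. Re z \<ge> A \<longrightarrow> cmod (F z) \<le> \<delta>"
  using H_vanish[of \<delta>] one_in_torus unfolding F_def by blast

text \<open>The partial sums give the bound 1. Equality at one point would make F constant by the
  maximum principle, which contradicts its decay to the right.\<close>

lemma F_disc: assumes z: "Re z > 0" shows "cmod (F z) < 1"
proof -
  have le: "cmod (F w) \<le> 1" if w: "Re w > 0" for w
  proof (rule field_le_epsilon)
    fix d :: real assume d: "d > 0"
    obtain N where N: "\<And>n. n \<ge> N \<Longrightarrow> s n / 2 \<le> Re w" using s_small[OF w] by blast
    have "(\<lambda>n. 2 * e n) \<longlonglongrightarrow> 2 * 0" by (intro tendsto_intros e_tendsto_0)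
    then have "\<forall>\<^sub>F n in sequentially. 2 * e n < d \<and> n \<ge> N"
      using d by (intro eventually_conj order_tendstoD(2) eventually_ge_at_top) auto
    then obtain n where n: "2 * e n < d" "n \<ge> N" by (auto simp: eventually_sequentially)
    show "cmod (F w) \<le> 1 + d"
      using F_tail[OF w N[OF n(2)]] n(1) l_le_1[of w n] w norm_triangle_ineq2[of "F w" "ev (l n) (1, 1) w"] by simp
  qed
  show ?thesis
  proof (rule ccontr)
    assume "\<not> cmod (F z) < 1"
    then have one: "cmod (F z) = 1" using le[OF z] by simp
    have "F constant_on {z. Re z > 0}"
    proof (rule maximum_modulus_principle[OF F_holomorphic])
      show "open {z. Re z > 0}" "connected {z. Re z > 0}" "open {z. Re z > 0}"
        by (simp_all add: open_halfspace_Re_gt convex_halfspace_Re_gt convex_connected)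
      show "cmod (F w) \<le> cmod (F z)" if "w \<in> {z. Re z > 0}" for w using le one that by simp
    qed (use z in auto)
    then obtain c where c: "\<And>w. Re w > 0 \<Longrightarrow> F w = c" by (auto simp: constant_on_def)
    obtain A where A: "A > 0" "\<And>z. Re z \<ge> A \<Longrightarrow> cmod (F z) \<le> 1 / 2" using F_vanish[of "1/2"] by auto
    have "F (of_real A) = F z" using c[of "of_real A"] c[OF z] A(1) by simp
    then show False using A(2)[of "of_real A"] one by simp
  qed
qed

text \<open>On a fixed line |F| is at most the sum over n < N of k n / 2 + e n, plus the tail 2
  \<open>e N\<close>. The mean of each summand is at most 3/2 \<open>e n\<close>, so the total is at
  most 3 \<open>e 0\<close> + 2 \<open>e 0\<close> = 5 \<epsilon> / 16.\<close>

lemma F_mean: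
  assumes \<sigma>: "\<sigma> > 0"
  shows "\<forall>\<^sub>F X in at_top. integral {- X..X} (\<lambda>t. cmod (F (Complex \<sigma> t))) / (2 * X) \<le> \<epsilon> / 2"
proof -
  obtain N where N: "s N / 2 \<le> \<sigma>" using s_small[OF \<sigma>] by blast
  obtain m where m: "\<And>n. m n \<le> e n" "\<And>n. has_mean (k n) (m n)" using k_mean by metis
  define g where "g = (\<lambda>j t. (\<Sum>n<j. k n t / 2 + e n))"
  have cg: "continuous_on UNIV (g j)" for j unfolding g_def by (intro continuous_intros k_cont) auto
  have mg: "has_mean (g j) (\<Sum>n<j. m n / 2 + e n)" for j
  proof (induction j)
    case (Suc j)
    have "has_mean (\<lambda>t. (1 / 2) * k j t + e j) ((1 / 2) * m j + e j)"
      by (intro has_mean_add has_mean_cmult has_mean_const m continuous_intros k_cont)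
    from has_mean_add[OF Suc this cg] show ?case unfolding g_def by (simp add: continuous_intros k_cont)
  qed (simp add: g_def has_mean_const)
  define M where "M = (\<Sum>n<N. m n / 2 + e n) + 2 * e N"
  have "has_mean (\<lambda>t. g N t + 2 * e N) M" unfolding M_def by (intro has_mean_add mg has_mean_const cg continuous_intros)
  moreover have "M < \<epsilon> / 2"
  proof -
    have "(\<Sum>n<N. m n / 2 + e n) \<le> (\<Sum>n<N. (3 / 2) * e n)"
    proof (rule sum_mono)
      fix n show "m n / 2 + e n \<le> 3 / 2 * e n" using m(1)[of n] by linarith
    qed
    also have "\<dots> = (3 / 2) * (\<Sum>n<N. e n)" by (rule sum_distrib_left[symmetric])
    also have "(\<Sum>n<N. e n) \<le> (\<Sum>n. e (n + 0))"
      using sum_le_suminf[OF sums_summable[OF sums_e[of 0]], of "{..<N}"] e_pos less_imp_le by auto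
    also have "(\<Sum>n. e (n + 0)) = 2 * e 0" using sums_e[of 0] sums_unique by metis
    finally have "(\<Sum>n<N. m n / 2 + e n) \<le> 3 * e 0" by simp
    moreover have "e N \<le> e 0" unfolding e_def using eps by (intro mult_left_mono power_decreasing) auto
    moreover have "e 0 = \<epsilon> / 16" by (simp add: e_def)
    ultimately show ?thesis using eps unfolding M_def by linarith
  qed
  ultimately have "\<forall>\<^sub>F X in at_top. integral {- X..X} (\<lambda>t. g N t + 2 * e N) / (2 * X) < \<epsilon> / 2"
    unfolding has_mean_def by (intro order_tendstoD(2))
  then show ?thesis using eventually_gt_at_top[of 0]
  proof eventually_elim
    case (elim X)
    have "integral {- X..X} (\<lambda>t. cmod (F (Complex \<sigma> t))) \<le> integral {- X..X} (\<lambda>t. g N t + 2 * e N)"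
    proof (rule integral_le)
      have "continuous_on {- X..X} (\<lambda>t. F (Complex \<sigma> t))"
        by (rule continuous_on_compose2[OF holomorphic_on_imp_continuous_on[OF F_holomorphic]])
          (use \<sigma> in \<open>auto simp: Complex_eq intro!: continuous_intros\<close>)
      then show "(\<lambda>t. cmod (F (Complex \<sigma> t))) integrable_on {- X..X}"
        by (intro integrable_continuous_interval continuous_on_norm)
      show "(\<lambda>t. g N t + 2 * e N) integrable_on {- X..X}"
        by (intro integrable_of_continuous continuous_intros cg)
      fix t
      have "cmod (ev (l N) (1, 1) (Complex \<sigma> t)) \<le> g N t"
        unfolding ev_l g_def by (rule sum_norm_le) (use B_le \<sigma> in auto)
      then show "cmod (F (Complex \<sigma> t)) \<le> g N t + 2 * e N"
        using F_tail[of "Complex \<sigma> t" N] \<sigma> N norm_triangle_ineq2[of "F (Complex \<sigma> t)" "ev (l N) (1, 1) (Complex \<sigma> t)"] by simp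
    qed
    then have "integral {- X..X} (\<lambda>t. cmod (F (Complex \<sigma> t))) / (2 * X) \<le> integral {- X..X} (\<lambda>t. g N t + 2 * e N) / (2 * X)"
      using elim by (intro divide_right_mono) auto
    then show ?case using elim by simp
  qed
qed

definition defect :: "nat \<Rightarrow> real \<Rightarrow> real" where
  "defect N t = 1 - (cmod (ev (l N) (1, 1) (Complex 0 t)))\<^sup>2"

lemma defect_bounds: "0 \<le> defect N t" "defect N t \<le> 1"
  using l_line[of N t] by (auto simp: defect_def power_le_one)

lemma continuous_on_defect: "continuous_on X (defect N)"
  unfolding defect_def by (intro continuous_intros continuous_on_ev_vertical)

text \<open>Up to the small cross terms, the energies of the blocks on a fixed interval add up to the energy of
  \<open>ev (l N)\<close>, which is bounded.\<close>
lemma defect_tendsto_0: "(\<lambda>N. integral {- real n..real n} (\<lambda>t. (defect N t)\<^sup>2)) \<longlonglongrightarrow> 0"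
proof -
  define E where "E = (\<lambda>N. integral {- real n..real n} (\<lambda>t. (cmod (ev (l N) (1, 1) (Complex 0 t)))\<^sup>2))"
  define b where "b = (\<lambda>N. integral {- real n..real n} (\<lambda>t. (cmod (ev (B N) (1, 1) (Complex 0 t)))\<^sup>2))"
  have iev: "(\<lambda>t. (cmod (ev L (1, 1) (Complex 0 t)))\<^sup>2) integrable_on {- real n..real n}" for L
    by (intro integrable_continuous_interval continuous_intros continuous_on_ev_vertical)
  have ic: "(\<lambda>t. Re (cnj (ev (l N) (1, 1) (Complex 0 t)) * ev (B N) (1, 1) (Complex 0 t))) integrable_on {- real n..real n}" for N
    by (intro integrable_continuous_interval continuous_intros continuous_on_ev_vertical)
  have step: "b N \<le> E (Suc N) - E N + 2 * e N" for N
  proof -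
    have sq: "(cmod (x + y))\<^sup>2 = (cmod x)\<^sup>2 + (cmod y)\<^sup>2 + 2 * Re (cnj x * y)" for x y
      unfolding cmod_power2 by (simp add: power2_eq_square algebra_simps)
    have "E (Suc N) = integral {- real n..real n} (\<lambda>t. (cmod (ev (l N) (1, 1) (Complex 0 t)))\<^sup>2 + (cmod (ev (B N) (1, 1) (Complex 0 t)))\<^sup>2
        + 2 * Re (cnj (ev (l N) (1, 1) (Complex 0 t)) * ev (B N) (1, 1) (Complex 0 t)))"
      unfolding E_def l_Suc ev_simps sq ..
    also have "\<dots> = E N + b N + 2 * integral {- real n..real n} (\<lambda>t. Re (cnj (ev (l N) (1, 1) (Complex 0 t)) * ev (B N) (1, 1) (Complex 0 t)))"
      unfolding E_def b_def
      by (simp only: integral_add[OF integrable_add[OF iev iev] integrable_on_mult_right[OF ic]] integral_add[OF iev iev] integral_mult_right)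
    finally show ?thesis using cross[of "- real n" "real n" N] by linarith
  qed
  have b0: "b N \<ge> 0" for N unfolding b_def by (rule integral_nonneg[OF iev]) simp
  have E: "0 \<le> E N" "E N \<le> 2 * real n" for N
  proof -
    show "0 \<le> E N" unfolding E_def by (rule integral_nonneg[OF iev]) simp
    have "E N \<le> integral {- real n..real n} (\<lambda>t. 1)"
      unfolding E_def by (rule integral_le[OF iev]) (use l_line in \<open>auto simp: power_le_one\<close>)
    then show "E N \<le> 2 * real n" by simp
  qed
  have "summable b"
  proof (rule bounded_imp_summable[OF b0])
    fix N
    have "(\<Sum>i\<le>N. b i) \<le> (\<Sum>i\<le>N. E (Suc i) - E i + 2 * e i)" by (intro sum_mono step)
    also have "\<dots> = E (Suc N) - E 0 + 2 * (\<Sum>i\<le>N. e i)"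
    proof -
      have "(\<Sum>i\<le>N. E (Suc i) - E i) = E (Suc N) - E 0" by (induction N) auto
      then show ?thesis by (simp only: sum.distrib sum_distrib_left[symmetric])
    qed
    also have "(\<Sum>i\<le>N. e i) \<le> (\<Sum>n. e (n + 0))"
      using sum_le_suminf[OF sums_summable[OF sums_e[of 0]], of "{..N}"] e_pos less_imp_le by auto
    finally show "(\<Sum>i\<le>N. b i) \<le> 2 * real n + 2 * (\<Sum>n. e (n + 0))" using E(1)[of 0] E(2)[of "Suc N"] by linarith
  qed
  then have "b \<longlonglongrightarrow> 0" by (rule summable_LIMSEQ_zero)
  then have "(\<lambda>N. 16 * b N) \<longlonglongrightarrow> 16 * 0" by (intro tendsto_intros)
  then have lim: "(\<lambda>N. 16 * b N) \<longlonglongrightarrow> 0" by simp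
  have id: "(\<lambda>t. (defect N t)\<^sup>2) integrable_on {- real n..real n}" for N
    by (intro integrable_continuous_interval continuous_intros continuous_on_defect)
  show ?thesis
  proof (rule tendsto_sandwich[OF _ _ tendsto_const lim])
    show "\<forall>\<^sub>F N in sequentially. 0 \<le> integral {- real n..real n} (\<lambda>t. (defect N t)\<^sup>2)"
      by (intro always_eventually allI integral_nonneg[OF id]) simp
    show "\<forall>\<^sub>F N in sequentially. integral {- real n..real n} (\<lambda>t. (defect N t)\<^sup>2) \<le> 16 * b N"
    proof (rule eventually_mono[OF eventually_ge_at_top[of n]])
      fix N assume N: "n \<le> N"
      have "integral {- real n..real n} (\<lambda>t. (defect N t)\<^sup>2) \<le> integral {- real n..real n} (\<lambda>t. 16 * (cmod (ev (B N) (1, 1) (Complex 0 t)))\<^sup>2)"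
      proof (rule integral_le[OF id integrable_on_mult_right[OF iev]])
        fix t assume t: "t \<in> {- real n..real n}"
        \<comment> \<open>For N >= n the kernel is at least 1 / 2 on the whole interval, so the
          block is at least a quarter of the defect; hence the factor 16.\<close>
        have "1 / 2 \<le> k N t" using t N by (intro k_half) auto
        then have "defect N t / 2 * (1 / 2) \<le> defect N t / 2 * k N t" using defect_bounds[of N t] by (intro mult_left_mono) auto
        then have "defect N t / 4 \<le> cmod (ev (B N) (1, 1) (Complex 0 t))" unfolding B_line defect_def by simp
        then have "(defect N t / 4)\<^sup>2 \<le> (cmod (ev (B N) (1, 1) (Complex 0 t)))\<^sup>2"
          using defect_bounds[of N t] by (intro power_mono) auto
        then show "(defect N t)\<^sup>2 \<le> 16 * (cmod (ev (B N) (1, 1) (Complex 0 t)))\<^sup>2" by (simp add: power_divide)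
      qed
      then show "integral {- real n..real n} (\<lambda>t. (defect N t)\<^sup>2) \<le> 16 * b N" by (simp add: b_def)
    qed
  qed
qed

text \<open>For Re z in [s N / 2, s N], F is within 2 \<open>e N\<close> of the partial sum and this
  within 1 / (N + 1) of its axis values. Those have modulus near 1 in mean square because the defect
  tends to 0 on [-n, n]. All abscissae of the interval are covered, as
  \<open>exceptional_set_capacity_zero\<close> demands.\<close>

lemma F_inner:
  "\<exists>r>0. r \<le> 1 / (real n + 1) \<and>
     (\<forall>\<sigma>\<in>{r / 2..r}. integral {- real n..real n} (\<lambda>t. 1 - cmod (F (Complex \<sigma> t))) \<le> 1 / (real n + 1))"
proof -
  define q where "q = 1 / (real n + 1)"
  \<comment> \<open>The constant part then integrates to 2 n * 2 \<delta> = n q^2 / 2 <= q / 2,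
    which leaves q / 2 for the defect.\<close>
  define \<delta> where "\<delta> = q\<^sup>2 / 8"
  have q: "0 < q" "real n * q \<le> 1" by (auto simp: q_def)
  have \<delta>: "\<delta> > 0" using q by (simp add: \<delta>_def)
  define \<tau> where "\<tau> = (\<lambda>N. 1 / (real N + 1) + 2 * e N)"
  have "(\<lambda>N. 1 / (real N + 1)) \<longlonglongrightarrow> 0" by real_asymp
  then have "\<tau> \<longlonglongrightarrow> 0 + 2 * 0" unfolding \<tau>_def by (intro tendsto_intros e_tendsto_0)
  then have ev1: "\<forall>\<^sub>F N in sequentially. \<tau> N < \<delta>" using \<delta> by (intro order_tendstoD(2)) auto
  have ev2: "\<forall>\<^sub>F N in sequentially. integral {- real n..real n} (\<lambda>t. (defect N t)\<^sup>2) < \<delta> * (q / 2)"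
    using defect_tendsto_0 \<delta> q by (intro order_tendstoD(2)) auto
  obtain N where N: "\<tau> N < \<delta>" "integral {- real n..real n} (\<lambda>t. (defect N t)\<^sup>2) < \<delta> * (q / 2)" "n \<le> N"
    using eventually_conj[OF ev1 eventually_conj[OF ev2 eventually_ge_at_top[of n]]] by (auto simp: eventually_sequentially)
  have sn: "s N \<le> 1 / (real n + 1)"
  proof -
    have "1 / (real N + 1) \<le> 1 / (real n + 1)" using N(3) by (intro divide_left_mono) auto
    then show ?thesis using s_le[of N] by linarith
  qed
  have "integral {- real n..real n} (\<lambda>t. 1 - cmod (F (Complex \<sigma> t))) \<le> q" if \<sigma>: "\<sigma> \<in> {s N / 2..s N}" for \<sigma>
  proof -
    have \<sigma>0: "\<sigma> > 0" using \<sigma> s_pos[of N] by auto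
    have id: "(\<lambda>t. (defect N t)\<^sup>2) integrable_on {- real n..real n}"
      by (intro integrable_continuous_interval continuous_intros continuous_on_defect)
    have "integral {- real n..real n} (\<lambda>t. 1 - cmod (F (Complex \<sigma> t))) \<le> integral {- real n..real n} (\<lambda>t. 2 * \<delta> + 1 / \<delta> * (defect N t)\<^sup>2)"
    proof (rule integral_le)
      have "continuous_on {- real n..real n} (\<lambda>t. F (Complex \<sigma> t))"
        by (rule continuous_on_compose2[OF holomorphic_on_imp_continuous_on[OF F_holomorphic]])
          (use \<sigma>0 in \<open>auto simp: Complex_eq intro!: continuous_intros\<close>)
      then show "(\<lambda>t. 1 - cmod (F (Complex \<sigma> t))) integrable_on {- real n..real n}"
        by (intro integrable_continuous_interval continuous_intros)
      show "(\<lambda>t. 2 * \<delta> + 1 / \<delta> * (defect N t)\<^sup>2) integrable_on {- real n..real n}"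
        by (intro integrable_add integrable_on_mult_right id) auto
      fix t
      have "cmod (F (Complex \<sigma> t) - ev (l N) (1, 1) (Complex \<sigma> t)) \<le> 2 * e N" using F_tail[of "Complex \<sigma> t" N] \<sigma> \<sigma>0 by simp
      moreover have "cmod (ev (l N) (1, 1) (Complex \<sigma> t) - ev (l N) (1, 1) (Complex 0 t)) \<le> 1 / (real N + 1)"
        using s_close[of \<sigma> N t] \<sigma> \<sigma>0 by simp
      ultimately have near: "cmod (ev (l N) (1, 1) (Complex 0 t)) - cmod (F (Complex \<sigma> t)) \<le> \<tau> N"
        using norm_triangle_ineq2[of "ev (l N) (1, 1) (Complex 0 t)" "F (Complex \<sigma> t)"]
          norm_triangle_ineq[of "F (Complex \<sigma> t) - ev (l N) (1, 1) (Complex \<sigma> t)" "ev (l N) (1, 1) (Complex \<sigma> t) - ev (l N) (1, 1) (Complex 0 t)"]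
        unfolding \<tau>_def by (simp add: norm_minus_commute)
      define u where "u = defect N t"
      have "1 - cmod (ev (l N) (1, 1) (Complex 0 t)) \<le> u"
        using l_line[of N t] power2_le_iff_abs_le[of 1] mult_left_le_one_le[of "cmod (ev (l N) (1, 1) (Complex 0 t))" "cmod (ev (l N) (1, 1) (Complex 0 t))"]
        unfolding u_def defect_def power2_eq_square by simp
      \<comment> \<open>A Chebyshev-type bound: either u <= \<delta>, or u <= u * (u / \<delta>). It
        lets the mean square control the mean.\<close>
      moreover have "u \<le> \<delta> + 1 / \<delta> * u\<^sup>2"
      proof (cases "u \<le> \<delta>")
        case True
        then show ?thesis using \<delta> by (simp add: add_increasing2)
      next
        case False
        then have "u * 1 \<le> u * (u / \<delta>)" using \<delta> by (intro mult_left_mono) auto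
        then show ?thesis using \<delta> by (simp add: power2_eq_square)
      qed
      ultimately show "1 - cmod (F (Complex \<sigma> t)) \<le> 2 * \<delta> + 1 / \<delta> * (defect N t)\<^sup>2"
        using near N(1) unfolding u_def by linarith
    qed
    also have "\<dots> = 2 * real n * (2 * \<delta>) + 1 / \<delta> * integral {- real n..real n} (\<lambda>t. (defect N t)\<^sup>2)"
      using integral_add[OF integrable_on_const integrable_on_mult_right[OF id, of "1 / \<delta>"], of "2 * \<delta>"] by simp
    also have "\<dots> \<le> q / 2 + 1 / \<delta> * (\<delta> * (q / 2))"
    proof (intro add_mono mult_left_mono)
      have "2 * real n * (2 * \<delta>) = (real n * q) * (q / 2)" by (simp add: \<delta>_def power2_eq_square)
      also have "\<dots> \<le> 1 * (q / 2)" using q by (intro mult_right_mono) auto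
      finally show "2 * real n * (2 * \<delta>) \<le> q / 2" by simp
    qed (use N(2) \<delta> in auto)
    also have "\<dots> = q" using \<delta> by simp
    finally show ?thesis .
  qed
  then show ?thesis using s_pos[of N] sn unfolding q_def by (intro exI[of _ "s N"]) auto
qed

end

subsection \<open>The Dirichlet series\<close>

definition monomial_index :: "int \<Rightarrow> int \<Rightarrow> nat" where "monomial_index a b = 2 ^ nat a * 3 ^ nat b"

definition coef :: "laurent \<Rightarrow> nat \<Rightarrow> complex" where
  "coef L n = (\<Sum>(c, a, b)\<leftarrow>L. if n = monomial_index a b then c else 0)"

text \<open>Different triples of the list may share an index and cancel in \<open>coef\<close>.
  Adding moduli instead gives a majorant whose sum is exactly \<open>l1\<close>.\<close>

definition abs_coef :: "laurent \<Rightarrow> nat \<Rightarrow> real" where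
  "abs_coef L n = (\<Sum>(c, a, b)\<leftarrow>L. if n = monomial_index a b then cmod c else 0)"

lemma coef_simps [simp]: "coef [] n = 0" "coef ((c, a, b) # L) n = (if n = monomial_index a b then c else 0) + coef L n"
  "abs_coef [] n = 0" "abs_coef ((c, a, b) # L) n = (if n = monomial_index a b then cmod c else 0) + abs_coef L n"
  by (simp_all add: coef_def abs_coef_def)

lemma norm_coef_le: "cmod (coef L n) \<le> abs_coef L n"
proof (induction L)
  case (Cons x L)
  obtain c a b where x: "x = (c, a, b)" by (cases x)
  show ?case using Cons norm_triangle_ineq[of c "coef L n"] by (auto simp: x)
qed simp

lemma ln_monomial_index: assumes "a \<ge> 1" "b \<ge> 1" shows "ln (real (monomial_index a b)) = freq a b"
proof -
  have "ln (real (monomial_index a b)) = real (nat a) * ln 2 + real (nat b) * ln 3"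
    by (simp add: monomial_index_def ln_mult ln_realpow)
  then show ?thesis using assms by (simp add: freq_def)
qed

lemma monomial_index_ge: assumes "a \<ge> 1" "b \<ge> 1" shows "monomial_index a b \<ge> 2"
proof -
  have "(2::nat) ^ 1 \<le> 2 ^ nat a" using assms by (intro power_increasing) auto
  moreover have "(1::nat) \<le> 3 ^ nat b" by simp
  ultimately have "2 * 1 \<le> (2::nat) ^ nat a * 3 ^ nat b" by (intro mult_le_mono) auto
  then show ?thesis by (simp add: monomial_index_def)
qed

lemma powr_monomial_index:
  assumes "a \<ge> 1" "b \<ge> 1" shows "of_nat (monomial_index a b) powr (- z) = monomial a b (1, 1) z"
proof -
  have pos: "real (monomial_index a b) > 0" using monomial_index_ge[OF assms] by linarith
  have "Ln (of_nat (monomial_index a b)) = of_real (freq a b)"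
    using Ln_of_real[OF pos] ln_monomial_index[OF assms] by simp
  then show ?thesis using pos by (simp add: powr_def monomial_def mult.commute)
qed

lemma has_sum_single_index:
  fixes v :: "nat \<Rightarrow> 'a::{real_normed_field}"
  shows "((\<lambda>n. (if n = m then c else 0) * v n) has_sum c * v m) UNIV"
proof -
  have "((\<lambda>n. (if n = m then c else 0) * v n) has_sum (\<Sum>n\<in>{m}. (if n = m then c else 0) * v n)) {m}"
    by (rule has_sum_finite) simp
  then have "((\<lambda>n. (if n = m then c else 0) * v n) has_sum c * v m) {m}" by simp
  then show ?thesis by (rule has_sum_cong_neutral[THEN iffD1, rotated -1]) auto
qed

lemma coef_has_sum: "pos_exps L \<Longrightarrow> ((\<lambda>n. coef L n * of_nat n powr (- z)) has_sum ev L (1, 1) z) UNIV"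
proof (induction L)
  case (Cons x L)
  obtain c a b where x: "x = (c, a, b)" by (cases x)
  have ab: "a \<ge> 1" "b \<ge> 1" "pos_exps L" using Cons.prems by (auto simp: x)
  from has_sum_add[OF has_sum_single_index[of "monomial_index a b" c "\<lambda>n. of_nat n powr (- z)"] Cons.IH[OF ab(3)]]
  show ?case by (simp add: x powr_monomial_index[OF ab(1,2)] distrib_right)
qed simp

lemma abs_coef_has_sum: "pos_exps L \<Longrightarrow> ((\<lambda>n. abs_coef L n * cmod (of_nat n powr (- z))) has_sum l1 L (Re z)) UNIV"
proof (induction L)
  case (Cons x L)
  obtain c a b where x: "x = (c, a, b)" by (cases x)
  have ab: "a \<ge> 1" "b \<ge> 1" "pos_exps L" using Cons.prems by (auto simp: x)
  from has_sum_add[OF has_sum_single_index[of "monomial_index a b" "cmod c" "\<lambda>n. cmod (of_nat n powr (- z))"] Cons.IH[OF ab(3)]]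
  show ?case by (simp add: x powr_monomial_index[OF ab(1,2)] norm_monomial[OF one_in_torus] distrib_right)
qed simp

section \<open>Dirichlet coefficients of the limit function\<close>

context block_sequence begin

definition dirichlet_coef :: "nat \<Rightarrow> complex" where "dirichlet_coef n = (\<Sum>\<^sub>\<infinity>j. coef (B j) n)"

lemma coef_B_1: "coef (B j) 1 = 0"
proof -
  have "coef L 1 = 0" if "pos_exps L" for L
    using that
  proof (induction L)
    case (Cons x L)
    obtain c a b where x: "x = (c, a, b)" by (cases x)
    show ?case using Cons monomial_index_ge[of a b] by (auto simp: x)
  qed simp
  then show ?thesis using B_pos by blast
qed

lemma dirichlet_coef_1: "dirichlet_coef 1 = 0"
  by (simp add: dirichlet_coef_def coef_B_1[simplified])

text \<open>For Re z > 1 all thresholds s j / 2 have been passed, so block j has absolute sum at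
  most \<open>e j\<close>. The double series over blocks and integers converges absolutely, and the
  order of summation may be exchanged.\<close>

lemma dirichlet_series_F:
  assumes z: "Re z > 1"
  shows "(\<lambda>n. dirichlet_coef (Suc n) * of_nat (Suc n) powr (- z)) sums F z"
proof -
  define g where "g = (\<lambda>j n. coef (B j) n * of_nat n powr (- z))"
  have z0: "Re z > 0" and zs: "s 0 / 2 \<le> Re z" using z s_le[of 0] by auto
  have gj: "(g j has_sum ev (B j) (1, 1) z) UNIV" for j unfolding g_def by (rule coef_has_sum[OF B_pos])
  have gabs: "(\<lambda>n. norm (g j n)) summable_on UNIV" and gle: "(\<Sum>\<^sub>\<infinity>n. norm (g j n)) \<le> e j" for j
  proof -
    note A = abs_coef_has_sum[OF B_pos[of j], of z]
    have le: "norm (g j n) \<le> abs_coef (B j) n * cmod (of_nat n powr (- z))" for n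
      unfolding g_def norm_mult by (intro mult_right_mono norm_coef_le) simp
    show s: "(\<lambda>n. norm (g j n)) summable_on UNIV"
      by (rule summable_on_comparison_test[OF has_sum_imp_summable[OF A]]) (use le in auto)
    have "(\<Sum>\<^sub>\<infinity>n. norm (g j n)) \<le> (\<Sum>\<^sub>\<infinity>n. abs_coef (B j) n * cmod (of_nat n powr (- z)))"
      by (rule infsum_mono[OF s has_sum_imp_summable[OF A] le])
    also have "\<dots> = l1 (B j) (Re z)" by (rule infsumI[OF A])
    also have "\<dots> \<le> l1 (B j) (s j / 2)" using s_antimono[of 0 j] zs by (intro l1_antimono B_pos) auto
    also have "\<dots> \<le> e j" by (rule l1_B)
    finally show "(\<Sum>\<^sub>\<infinity>n. norm (g j n)) \<le> e j" .
  qed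
  have "summable (\<lambda>n. e (n + 0))" using sums_e sums_summable by blast
  then have "summable (\<lambda>n. norm (e n))" using e_pos by (simp add: less_imp_le)
  then have esum: "e summable_on UNIV" by (rule norm_summable_imp_summable_on)
  have "(\<lambda>x. norm (case x of (j, n) \<Rightarrow> g j n)) summable_on UNIV \<times> UNIV"
  proof (subst Infinite_Sum.abs_summable_on_Sigma_iff, intro conjI ballI)
    show "(\<lambda>j. norm (infsum (\<lambda>n. norm (case (j, n) of (j, n) \<Rightarrow> g j n)) UNIV)) summable_on UNIV"
    proof (rule summable_on_comparison_test[OF esum])
      fix j
      have "0 \<le> (\<Sum>\<^sub>\<infinity>n. norm (g j n))" by (rule infsum_nonneg) simp
      then show "norm (infsum (\<lambda>n. norm (case (j, n) of (j, n) \<Rightarrow> g j n)) UNIV) \<le> e j" using gle[of j] by simp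
    qed auto
  qed (use gabs in auto)
  then have sum2: "(\<lambda>(j, n). g j n) summable_on UNIV \<times> UNIV" by (rule abs_summable_summable)
  then have sum2': "(\<lambda>(n, j). g j n) summable_on UNIV \<times> UNIV"
    using summable_on_swap[of "\<lambda>(j, n). g j n" UNIV UNIV] by (simp add: case_prod_unfold)
  have swap: "(\<Sum>\<^sub>\<infinity>j. \<Sum>\<^sub>\<infinity>n. g j n) = (\<Sum>\<^sub>\<infinity>n. \<Sum>\<^sub>\<infinity>j. g j n)"
    by (rule infsum_swap_banach[OF sum2])
  have "(\<lambda>j. \<Sum>\<^sub>\<infinity>n. g j n) summable_on UNIV" by (rule summable_on_Sigma_banach[OF sum2])
  then have "(\<lambda>j. ev (B j) (1, 1) z) summable_on UNIV" by (simp add: infsumI[OF gj])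
  then have "(\<lambda>j. ev (B j) (1, 1) z) sums (\<Sum>\<^sub>\<infinity>j. ev (B j) (1, 1) z)" by (intro has_sum_imp_sums has_sum_infsum)
  then have "(\<Sum>\<^sub>\<infinity>j. ev (B j) (1, 1) z) = F z" unfolding F_def H_def by (rule sums_unique)
  then have Fz: "(\<Sum>\<^sub>\<infinity>n. \<Sum>\<^sub>\<infinity>j. g j n) = F z" using swap by (simp add: infsumI[OF gj])
  have "(\<lambda>n. \<Sum>\<^sub>\<infinity>j. g j n) summable_on UNIV" by (rule summable_on_Sigma_banach[OF sum2'])
  then have "(\<lambda>n. \<Sum>\<^sub>\<infinity>j. g j n) sums F z" unfolding Fz[symmetric] by (intro has_sum_imp_sums has_sum_infsum)
  moreover have "(\<Sum>\<^sub>\<infinity>j. g j n) = dirichlet_coef n * of_nat n powr (- z)" for n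
    unfolding g_def dirichlet_coef_def by (rule infsum_cmult_left')
  ultimately have "(\<lambda>n. dirichlet_coef n * of_nat n powr (- z)) sums F z" by simp
  \<comment> \<open>The term n = 0 vanishes because 0 powr anything is 0, so the index can be
    shifted.\<close>
  then show ?thesis by (subst sums_Suc_iff) simp
qed

end

theorem theorem1p6:
  fixes \<epsilon> :: real
  assumes "0 < \<epsilon>" and "\<epsilon> < 1"
  shows "\<exists>f a. dirichlet_series_C0_D f a \<and> a 1 = 0 \<and>
    (\<exists>E. log_capacity_zero E \<and>
       (\<forall>\<xi> \<in> ball 0 1 - {0} - E.
          ((\<lambda>T. N_count f \<xi> T) \<longlongrightarrow> ennreal (ln (1 / cmod \<xi>))) at_top)) \<and>
    (\<forall>\<xi> \<in> ball 0 1 - {0}.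
       mean_counting f \<xi> \<le> ln (1 / cmod \<xi>) - (1 - \<epsilon>) * (1 - (cmod \<xi>)\<^sup>2) / 2)"
proof -
  obtain l B s k e where "block_sequence \<epsilon> l B s k e"
    using block_sequence_exists[OF assms] by blast
  then interpret block_sequence \<epsilon> l B s k e .
  interpret lifted_map F H
    using F_holomorphic F_disc F_vanish H_holomorphic H_continuous H_vanish H_flow by unfold_locales auto
  show ?thesis
  proof (intro exI conjI ballI)
    show "dirichlet_series_C0_D F dirichlet_coef"
      unfolding dirichlet_series_C0_D_def using F_holomorphic F_disc dirichlet_series_F
      by (intro conjI exI[of _ 1]) auto
    show "dirichlet_coef 1 = 0" by (rule dirichlet_coef_1)
    show "log_capacity_zero {\<xi> \<in> ball 0 1 - {0}. \<not> ((\<lambda>T. N_count F \<xi> T) \<longlongrightarrow> ennreal (ln (1 / cmod \<xi>))) at_top}"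
      by (rule exceptional_set_capacity_zero[OF F_inner])
  next
    fix \<xi> assume "\<xi> \<in> ball 0 1 - {0} - {\<xi> \<in> ball 0 1 - {0}. \<not> ((\<lambda>T. N_count F \<xi> T) \<longlongrightarrow> ennreal (ln (1 / cmod \<xi>))) at_top}"
    then show "((\<lambda>T. N_count F \<xi> T) \<longlongrightarrow> ennreal (ln (1 / cmod \<xi>))) at_top" by blast
  next
    fix \<xi> :: complex assume "\<xi> \<in> ball 0 1 - {0}"
    then interpret lifted_value F H \<xi> by unfold_locales auto
    show "mean_counting F \<xi> \<le> ln (1 / cmod \<xi>) - (1 - \<epsilon>) * (1 - (cmod \<xi>)\<^sup>2) / 2"
      using mean_counting_le[OF F_mean] by (simp add: L_def)
  qed
qed

end
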